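(* Let $X$ be an infinite dimensional complex Banach space and let $T\in L(X)$. Then $$\partial\sigma_{D}(T)\subset\partial\sigma_{B\mathcal{W}}(T)\subset\partial\sigma_{B\Phi}(T)\subset\partial\sigma_{Kt}(T)$$ and $$\eta\sigma_{Kt}(T)=\eta\sigma_{B\Phi}(T)=\eta\sigma_{B\mathcal{W}}(T)=\eta\sigma_{D}(T).$$
   Context: $\partial K$ is the boundary of $K\subset\mathbb{C}$. For compact $K\subset\mathbb{C}$, the connected hull $\eta K$ is the complement of the unbounded component of $\mathbb{C}\setminus K$. (All spectra below are compact, possibly empty, subsets of $\mathbb{C}$.) $L(Y)$ is the algebra of bounded linear operators on a Banach space $Y$ (finite dimensional or zero spaces allowed for $Y$); $T-\lambda$ means $T-\lambda I$; $N(S)$, $R(S)$ denote kernel and range of $S\in L(Y)$. $S\in L(Y)$ is Fredholm if $\dim N(S)<\infty$ and $\operatorname{codim}R(S)<\infty$, and Weyl if it is Fredholm with $\dim N(S)=\operatorname{codim}R(S)$. $S\in L(X)$ is B-Fredholm (B-Weyl) if there is $n\in\mathbb{N}$ such that $R(S^n)$ is closed and the restriction of $S$ to $R(S^n)$, viewed in $L(R(S^n))$, is Fredholm (Weyl). $(M,N)\in Red(S)$ means that $M,N$ are closed $S$-invariant subspaces of $X$ with $X=M\oplus N$; $S_M\in L(M)$, $S_N\in L(N)$ are the restrictions. $S\in L(X)$ is Drazin invertible if and only if there is $(M,N)\in Red(S)$ with $S_M$ invertible and $S_N$ nilpotent. $S\in L(Y)$ is Kato if $R(S)$ is closed and $N(S)\subset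 R(S^n)$ for all $n\ge 0$; $S\in L(X)$ is of Kato type if there is $(M,N)\in Red(S)$ with $S_M$ Kato and $S_N$ nilpotent. $\sigma_D(T)$, $\sigma_{B\mathcal{W}}(T)$, $\sigma_{B\Phi}(T)$, $\sigma_{Kt}(T)$ are the sets of $\lambda\in\mathbb{C}$ such that $T-\lambda$ is, respectively, not Drazin invertible, not B-Weyl, not B-Fredholm, not of Kato type. *)

theory Defs
  imports "HOL-Analysis.Analysis"
begin

class complex_normed_vector = real_normed_vector +
  fixes scaleC :: "complex \<Rightarrow> 'a \<Rightarrow> 'a"  (infixr \<open>*\<^sub>C\<close> 75)
  assumes scaleC_add_right: "a *\<^sub>C (x + y) = a *\<^sub>C x + a *\<^sub>C y"
    and scaleC_add_left: "(a + b) *\<^sub>C x = a *\<^sub>C x + b *\<^sub>C x"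
    and scaleC_scaleC: "a *\<^sub>C b *\<^sub>C x = (a * b) *\<^sub>C x"
    and scaleC_of_real: "complex_of_real r *\<^sub>C x = r *\<^sub>R x"
    and norm_scaleC: "norm (a *\<^sub>C x) = cmod a * norm x"

class complex_banach = complex_normed_vector + banach

instantiation complex :: complex_banach
begin

definition scaleC_complex :: "complex \<Rightarrow> complex \<Rightarrow> complex"
  where "scaleC_complex a x = a * x"

instance
  by standard (simp_all add: scaleC_complex_def algebra_simps norm_mult scaleR_conv_of_real)

end

text \<open>\<open>cdim V\<close> is the number of elements of a finite basis of \<open>V\<close>; it is \<open>0\<close> by
  convention when \<open>V\<close> is infinite dimensional.\<close>

global_interpretation complex_vector:
  vector_space "scaleC :: complex \<Rightarrow> 'a \<Rightarrow> 'a::complex_normed_vector"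
  defines csubspace = complex_vector.subspace
    and cspan = complex_vector.span
    and cdependent = complex_vector.dependent
    and cdim = complex_vector.dim
proof
  fix x :: 'a
  show "1 *\<^sub>C x = x"
    using scaleC_of_real[of 1 x] by simp
qed (simp_all add: scaleC_add_right scaleC_add_left scaleC_scaleC)

definition cfinite_dim :: "'a::complex_normed_vector set \<Rightarrow> bool"
  where "cfinite_dim V \<longleftrightarrow> (\<exists>B. finite B \<and> V \<subseteq> cspan B)"

text \<open>Algebraic direct sum \<open>Y = M \<oplus> N\<close>.\<close>

definition direct_sum ::
    "'a::complex_normed_vector set \<Rightarrow> 'a set \<Rightarrow> 'a set \<Rightarrow> bool"
  where "direct_sum Y M N \<longleftrightarrow> csubspace M \<and> csubspace N \<and> M \<inter> N = {0} \<and>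
    Y = {m + n | m n. m \<in> M \<and> n \<in> N}"

text \<open>The quotient \<open>Y/R\<close> is isomorphic to any algebraic complement of \<open>R\<close> in \<open>Y\<close>, so the
  codimension of \<open>R\<close> in \<open>Y\<close> is the dimension of such a complement. As with \<open>cdim\<close>, the value
  \<open>ccodim Y R\<close> is meaningful only under \<open>cfinite_codim Y R\<close>.\<close>

definition cfinite_codim :: "'a::complex_normed_vector set \<Rightarrow> 'a set \<Rightarrow> bool"
  where "cfinite_codim Y R \<longleftrightarrow> (\<exists>C. direct_sum Y R C \<and> cfinite_dim C)"

definition ccodim :: "'a::complex_normed_vector set \<Rightarrow> 'a set \<Rightarrow> nat"
  where "ccodim Y R = cdim (SOME C. direct_sum Y R C)"

locale bounded_clinear = bounded_linear T
  for T :: "'a::complex_normed_vector \<Rightarrow> 'b::complex_normed_vector" +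
  assumes scaleC: "T (c *\<^sub>C x) = c *\<^sub>C T x"

text \<open>An operator in \<open>L(Y)\<close>, where \<open>Y\<close> is a closed subspace of the ambient space, is given by a
  function \<open>S\<close> on the ambient space which is only evaluated on \<open>Y\<close>. The predicates below are
  applied only to operators mapping \<open>Y\<close> linearly and boundedly into itself. For a closed
  subspace \<open>Y\<close>, a subset of \<open>Y\<close> is closed in \<open>Y\<close> iff it is closed in the ambient space.\<close>

definition kernel_on :: "'a::complex_normed_vector set \<Rightarrow> ('a \<Rightarrow> 'a) \<Rightarrow> 'a set"
  where "kernel_on Y S = {x \<in> Y. S x = 0}"

definition fredholm_on :: "'a::complex_normed_vector set \<Rightarrow> ('a \<Rightarrow> 'a) \<Rightarrow> bool"
  where "fredholm_on Y S \<longleftrightarrow> cfinite_dim (kernel_on Y S) \<and> cfinite_codim Y (S ` Y)"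

definition weyl_on :: "'a::complex_normed_vector set \<Rightarrow> ('a \<Rightarrow> 'a) \<Rightarrow> bool"
  where "weyl_on Y S \<longleftrightarrow> fredholm_on Y S \<and> cdim (kernel_on Y S) = ccodim Y (S ` Y)"

definition invertible_on :: "'a::complex_normed_vector set \<Rightarrow> ('a \<Rightarrow> 'a) \<Rightarrow> bool"
  where "invertible_on Y S \<longleftrightarrow> (\<exists>R.
    R ` Y \<subseteq> Y \<and>
    (\<forall>x\<in>Y. \<forall>y\<in>Y. R (x + y) = R x + R y) \<and>
    (\<forall>c. \<forall>x\<in>Y. R (c *\<^sub>C x) = c *\<^sub>C R x) \<and>
    (\<exists>K. \<forall>x\<in>Y. norm (R x) \<le> K * norm x) \<and>
    (\<forall>x\<in>Y. R (S x) = x \<and> S (R x) = x))"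

definition nilpotent_on :: "'a::complex_normed_vector set \<Rightarrow> ('a \<Rightarrow> 'a) \<Rightarrow> bool"
  where "nilpotent_on Y S \<longleftrightarrow> (\<exists>k::nat. \<forall>x\<in>Y. (S ^^ k) x = 0)"

definition kato_on :: "'a::complex_normed_vector set \<Rightarrow> ('a \<Rightarrow> 'a) \<Rightarrow> bool"
  where "kato_on Y S \<longleftrightarrow> closed (S ` Y) \<and> (\<forall>n::nat. kernel_on Y S \<subseteq> (S ^^ n) ` Y)"

definition Red :: "('a::complex_normed_vector \<Rightarrow> 'a) \<Rightarrow> ('a set \<times> 'a set) set"
  where "Red S = {(M, N). closed M \<and> closed N \<and> direct_sum UNIV M N \<and>
    S ` M \<subseteq> M \<and> S ` N \<subseteq> N}"

definition b_fredholm :: "('a::complex_normed_vector \<Rightarrow> 'a) \<Rightarrow> bool"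
  where "b_fredholm S \<longleftrightarrow>
    (\<exists>n::nat. closed (range (S ^^ n)) \<and> fredholm_on (range (S ^^ n)) S)"

definition b_weyl :: "('a::complex_normed_vector \<Rightarrow> 'a) \<Rightarrow> bool"
  where "b_weyl S \<longleftrightarrow>
    (\<exists>n::nat. closed (range (S ^^ n)) \<and> weyl_on (range (S ^^ n)) S)"

definition drazin_invertible :: "('a::complex_normed_vector \<Rightarrow> 'a) \<Rightarrow> bool"
  where "drazin_invertible S \<longleftrightarrow>
    (\<exists>(M, N) \<in> Red S. invertible_on M S \<and> nilpotent_on N S)"

definition kato_type :: "('a::complex_normed_vector \<Rightarrow> 'a) \<Rightarrow> bool"
  where "kato_type S \<longleftrightarrow>
    (\<exists>(M, N) \<in> Red S. kato_on M S \<and> nilpotent_on N S)"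

definition drazin_spectrum :: "('a::complex_normed_vector \<Rightarrow> 'a) \<Rightarrow> complex set"
  where "drazin_spectrum T = {\<mu>. \<not> drazin_invertible (\<lambda>x. T x - \<mu> *\<^sub>C x)}"

definition b_weyl_spectrum :: "('a::complex_normed_vector \<Rightarrow> 'a) \<Rightarrow> complex set"
  where "b_weyl_spectrum T = {\<mu>. \<not> b_weyl (\<lambda>x. T x - \<mu> *\<^sub>C x)}"

definition b_fredholm_spectrum :: "('a::complex_normed_vector \<Rightarrow> 'a) \<Rightarrow> complex set"
  where "b_fredholm_spectrum T = {\<mu>. \<not> b_fredholm (\<lambda>x. T x - \<mu> *\<^sub>C x)}"

definition kato_type_spectrum :: "('a::complex_normed_vector \<Rightarrow> 'a) \<Rightarrow> complex set"
  where "kato_type_spectrum T = {\<mu>. \<not> kato_type (\<lambda>x. T x - \<mu> *\<^sub>C x)}"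

text \<open>The library's \<open>outside K\<close> is the union of all unbounded components of the complement of
  \<open>K\<close>; for compact \<open>K\<close> there is exactly one, as the lemma below confirms.\<close>

definition connected_hull :: "complex set \<Rightarrow> complex set"
  where "connected_hull K = - outside K"

lemma connected_hull_compact:
  assumes "compact K"
  shows "\<exists>!C. C \<in> components (- K) \<and> \<not> bounded C"
    and "\<And>C. C \<in> components (- K) \<Longrightarrow> \<not> bounded C \<Longrightarrow> connected_hull K = - C"
proof -
  have K: "bounded (- (- K))"
    using assms compact_imp_bounded by simp
  have ex: "\<exists>C. C \<in> components (- K) \<and> \<not> bounded C"
    using cobounded_unbounded_components[OF K] by simp
  have uniq: "C = D" if "C \<in> components (- K)" "\<not> bounded C"
    "D \<in> components (- K)" "\<not> bounded D" for C D
    using cobounded_unique_unbounded_components[OF K that(3,4,1,2)] by simp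
  show "\<exists>!C. C \<in> components (- K) \<and> \<not> bounded C"
    using ex uniq by blast
  show "connected_hull K = - C" if C: "C \<in> components (- K)" "\<not> bounded C" for C
  proof -
    have "outside K = C"
    proof (intro equalityI subsetI)
      fix x assume x: "x \<in> outside K"
      then have "connected_component_set (- K) x \<in> components (- K)"
        "\<not> bounded (connected_component_set (- K) x)" "x \<in> - K"
        by (auto simp: outside_def components_def)
      then show "x \<in> C"
        using uniq C connected_component_refl_eq by (metis mem_Collect_eq)
    next
      fix x assume "x \<in> C"
      obtain y where "C = connected_component_set (- K) y"
        using C(1) by (auto simp: components_def)
      then have "connected_component_set (- K) x = C"
        using \<open>x \<in> C\<close> by (metis connected_component_eq)
      moreover have "x \<in> - K"
        using \<open>x \<in> C\<close> in_components_subset[OF C(1)] by blast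
      ultimately show "x \<in> outside K"
        using C by (auto simp: outside_def)
    qed
    then show ?thesis by (simp add: connected_hull_def)
  qed
qed

end

(* Dimensions of quotients Y/R are measured by an enat-valued relative dimension, which turns
   index computations into additivity of quotient dimensions. If T - \<lambda> is B-Fredholm, its
   restriction to the range of a high power is both Fredholm and Kato, so T - \<nu> has constant
   finite nullity and deficiency, and is Kato, for all \<nu> in a punctured disc around \<lambda>. These two
   constants decide whether \<lambda> is a B-Weyl (they agree) or a Drazin (both vanish) point, which gives
   the first two inclusions. For the third, nullity and deficiency are lower semicontinuous on Kato
   operators, so a connectedness argument shows that a Kato type limit of B-Fredholm points is
   B-Fredholm; that every B-Fredholm operator is of Kato type is never used. Finally, the unbounded
   component of the complement of each spectrum cannot meet the Drazin spectrum, whose frontier lies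
   in all four spectra, and this yields the equality of the hulls. *)

theory Submission
  imports Defs
begin

text \<open>For \<open>\<mu> \<noteq> 0\<close> the polynomials z^k and z - \<mu> are coprime, so S
  - \<mu> has the same nullity and deficiency on the whole space and on the range of S^k. This moves
  information between T and the ranges on which B-Fredholm operators become Fredholm, and it is the
  reason for punctured discs: at the centre both numbers may jump. Constancy of the two numbers is a
  meeting of two bounds. Fredholm operators give upper semicontinuity and a constant index, Kato
  operators give lower semicontinuity. The obstacle in the latter is that a Kato operator may have
  an infinite dimensional kernel and a range of infinite codimension, so complements are not at
  hand. They are replaced by the intersection of the ranges of all powers: it contains the kernel
  and is mapped onto itself, and surjectivity survives small perturbations. All estimates come from
  one scheme: if every equation can be solved up to a fixed fraction q < 1 of its right-hand side,
  then iterating on the remainder solves it exactly. Open mappings, perturbed surjections and closed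
  ranges are instances.\<close>

section \<open>Relative dimension\<close>

definition subspace_sum :: "'a::complex_normed_vector set \<Rightarrow> 'a set \<Rightarrow> 'a set"
  where "subspace_sum M N = {m + n | m n. m \<in> M \<and> n \<in> N}"

text \<open>Linear independence of the cosets \<open>v i + R\<close>. Indexed families are used
  instead of sets, so that a repeated vector counts as a dependence when
  \<open>0 \<in> R\<close>.\<close>

definition indep_mod ::
    "'a::complex_normed_vector set \<Rightarrow> 'i set \<Rightarrow> ('i \<Rightarrow> 'a) \<Rightarrow> bool"
  where "indep_mod R I v \<longleftrightarrow>
    (\<forall>a. (\<Sum>i\<in>I. a i *\<^sub>C v i) \<in> R \<longrightarrow> (\<forall>i\<in>I. a i = 0))"

text \<open>The dimension of \<open>(Y + R)/R\<close>; \<open>R\<close> need not be contained in \<open>Y\<close>.\<close>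

definition qdim :: "'a::complex_normed_vector set \<Rightarrow> 'a set \<Rightarrow> enat"
  where "qdim Y R =
    Sup {enat m | m. \<exists>v. v ` {..<m} \<subseteq> Y \<and> indep_mod R {..<m} v}"

lemma indep_modD:
  "indep_mod R I v \<Longrightarrow> (\<Sum>i\<in>I. a i *\<^sub>C v i) \<in> R \<Longrightarrow> i \<in> I \<Longrightarrow> a i = 0"
  by (auto simp: indep_mod_def)

lemma indep_mod_reindex:
  assumes "inj_on h J" "indep_mod R (h ` J) v"
  shows "indep_mod R J (v \<circ> h)"
  unfolding indep_mod_def
proof (intro allI impI ballI)
  fix a j assume s: "(\<Sum>i\<in>J. a i *\<^sub>C (v \<circ> h) i) \<in> R" and j: "j \<in> J"
  have "(\<Sum>i\<in>h ` J. a (the_inv_into J h i) *\<^sub>C v i) = (\<Sum>i\<in>J. a i *\<^sub>C (v \<circ> h) i)"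
    using assms(1) by (simp add: sum.reindex the_inv_into_f_f)
  with s have "a (the_inv_into J h (h j)) = 0"
    using indep_modD[OF assms(2), of "\<lambda>i. a (the_inv_into J h i)" "h j"] j by simp
  then show "a j = 0" using assms(1) j by (simp add: the_inv_into_f_f)
qed

lemma indep_mod_subset:
  assumes "finite I" "J \<subseteq> I" "indep_mod R I v"
  shows "indep_mod R J v"
  unfolding indep_mod_def
proof (intro allI impI ballI)
  fix a j assume s: "(\<Sum>i\<in>J. a i *\<^sub>C v i) \<in> R" and j: "j \<in> J"
  have "(\<Sum>i\<in>I. (if i \<in> J then a i else 0) *\<^sub>C v i) = (\<Sum>i\<in>J. a i *\<^sub>C v i)"
    using assms by (intro sum.mono_neutral_cong_right) auto
  with s show "a j = 0"
    using indep_modD[OF assms(3), of "\<lambda>i. if i \<in> J then a i else 0" j] j assms(2) by auto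
qed

lemma indep_mod_mono: "indep_mod R I v \<Longrightarrow> S \<subseteq> R \<Longrightarrow> indep_mod S I v"
  by (auto simp: indep_mod_def)

lemma card_le_qdim:
  assumes "finite I" "v ` I \<subseteq> Y" "indep_mod R I v"
  shows "enat (card I) \<le> qdim Y R"
proof -
  obtain h where h: "bij_betw h {..<card I} I"
    using assms(1) ex_bij_betw_nat_finite[of I] by (auto simp: atLeast0LessThan)
  then have "indep_mod R {..<card I} (v \<circ> h)"
    using assms(3) by (intro indep_mod_reindex) (auto simp: bij_betw_def)
  moreover have "(v \<circ> h) ` {..<card I} \<subseteq> Y"
    using h assms(2) by (auto simp: bij_betw_def)
  ultimately show ?thesis
    unfolding qdim_def by (intro Sup_upper CollectI exI[of _ "card I"] conjI refl exI[of _ "v \<circ> h"])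
qed

lemma qdim_le:
  assumes "\<And>m v. v ` {..<m} \<subseteq> Y \<Longrightarrow> indep_mod R {..<m::nat} v \<Longrightarrow> enat m \<le> N"
  shows "qdim Y R \<le> N"
  unfolding qdim_def using assms by (intro Sup_least) auto

text \<open>If all independent families were shorter than m, the supremum would be at most m - 1;
  and a longer family can be truncated to length exactly m.\<close>

lemma le_qdimE:
  assumes "enat m \<le> qdim Y R"
  obtains v where "v ` {..<m} \<subseteq> Y" "indep_mod R {..<m} v"
proof (cases m)
  case 0
  then show ?thesis using that[of "\<lambda>_. undefined"] by (auto simp: indep_mod_def)
next
  case (Suc k)
  have "\<exists>n v. m \<le> n \<and> v ` {..<n} \<subseteq> Y \<and> indep_mod R {..<n} v"
  proof (rule ccontr)
    assume "\<not> ?thesis"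
    then have "qdim Y R \<le> enat k"
      using Suc by (intro qdim_le) (metis enat_ord_simps(1) not_less_eq_eq)
    with assms have "enat m \<le> enat k" by (rule order.trans)
    then show False using Suc by simp
  qed
  then obtain n v where "m \<le> n" "v ` {..<n} \<subseteq> Y" "indep_mod R {..<n} v" by blast
  then show ?thesis
    using that[of v] indep_mod_subset[of "{..<n}" "{..<m}" R v] by fastforce
qed

lemma qdim_mono: "Y \<subseteq> Y' \<Longrightarrow> R' \<subseteq> R \<Longrightarrow> qdim Y R \<le> qdim Y' R'"
  unfolding qdim_def by (intro Sup_subset_mono) (blast intro: indep_mod_mono)

text \<open>Write \<open>v i = r i + f i\<close> with \<open>r i \<in> R\<close>. A linear relation
  among the \<open>f i\<close> is a relation among the \<open>v i\<close> modulo R, so the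
  \<open>f i\<close> are independent in the span of F and the exchange bound applies.\<close>

lemma indep_mod_in_span:
  assumes R: "csubspace R" and I: "finite I" and F: "finite F"
    and v: "v ` I \<subseteq> subspace_sum R (cspan F)" and ind: "indep_mod R I v"
  shows "card I \<le> card F"
proof -
  have "\<forall>i\<in>I. \<exists>r f. r \<in> R \<and> f \<in> cspan F \<and> v i = r + f"
    using v unfolding subspace_sum_def image_subset_iff by blast
  then obtain r f where rf: "\<And>i. i \<in> I \<Longrightarrow> r i \<in> R \<and> f i \<in> cspan F \<and> v i = r i + f i"
    by metis
  have key: "\<forall>i\<in>I. a i = 0" if "(\<Sum>i\<in>I. a i *\<^sub>C f i) = 0" for a
  proof -
    have "(\<Sum>i\<in>I. a i *\<^sub>C v i) = (\<Sum>i\<in>I. a i *\<^sub>C r i) + (\<Sum>i\<in>I. a i *\<^sub>C f i)"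
      unfolding sum.distrib[symmetric]
      by (rule sum.cong) (auto simp: rf scaleC_add_right)
    also have "\<dots> = (\<Sum>i\<in>I. a i *\<^sub>C r i)" using that by simp
    also have "\<dots> \<in> R"
      using rf by (intro complex_vector.subspace_sum[OF R] complex_vector.subspace_scale[OF R]) auto
    finally show ?thesis using indep_modD[OF ind] by blast
  qed
  have inj: "inj_on f I"
  proof (rule inj_onI, rule ccontr)
    fix i j assume ij: "i \<in> I" "j \<in> I" "f i = f j" "i \<noteq> j"
    define a :: "'b \<Rightarrow> complex" where "a k = (if k = i then 1 else if k = j then -1 else 0)" for k
    have "(\<Sum>k\<in>I. a k *\<^sub>C f k) = (\<Sum>k\<in>{i,j}. a k *\<^sub>C f k)"
      using ij I by (intro sum.mono_neutral_right) (auto simp: a_def)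
    also have "\<dots> = 0" using ij by (simp add: a_def)
    finally have "a i = 0" using key ij by blast
    then show False by (simp add: a_def)
  qed
  have "\<not> cdependent (f ` I)"
    unfolding complex_vector.dependent_finite[OF finite_imageI[OF I]]
  proof safe
    fix u i assume i: "i \<in> I" "u (f i) \<noteq> 0" and s: "(\<Sum>v\<in>f ` I. u v *\<^sub>C v) = 0"
    have "(\<Sum>i\<in>I. u (f i) *\<^sub>C f i) = 0" using s inj by (simp add: sum.reindex)
    then have "u (f i) = 0" using key[of "\<lambda>i. u (f i)"] i(1) by simp
    then show False using i(2) by simp
  qed
  then have "card (f ` I) \<le> card F"
    using complex_vector.independent_span_bound[OF F, of "f ` I"] rf by auto
  then show ?thesis using inj by (simp add: card_image)
qed

lemma qdim_le_card:
  assumes "csubspace R" "finite F" "Y \<subseteq> subspace_sum R (cspan F)"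
  shows "qdim Y R \<le> enat (card F)"
proof (rule qdim_le)
  fix m and v :: "nat \<Rightarrow> 'a" assume "v ` {..<m} \<subseteq> Y" "indep_mod R {..<m} v"
  then show "enat m \<le> enat (card F)"
    using indep_mod_in_span[OF assms(1) _ assms(2), of "{..<m}" v] assms(3) by auto
qed

lemma sum_in_span: "(\<Sum>i\<in>I. a i *\<^sub>C v i) \<in> cspan (v ` I)"
  by (intro complex_vector.span_sum complex_vector.span_scale complex_vector.span_base) auto

text \<open>An independent family of maximal length spans modulo R: adjoining y creates a relation,
  in which the coefficient of y cannot vanish, so y can be solved for.\<close>

lemma qdim_basis:
  assumes R: "csubspace R" and q: "qdim Y R = enat n"
  obtains v where "v ` {..<n} \<subseteq> Y" "indep_mod R {..<n} v"
    "Y \<subseteq> subspace_sum R (cspan (v ` {..<n}))"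
proof -
  obtain v where v: "v ` {..<n} \<subseteq> Y" "indep_mod R {..<n} v"
    using le_qdimE[of n Y R] q by auto
  have "y \<in> subspace_sum R (cspan (v ` {..<n}))" if y: "y \<in> Y" for y
  proof -
    define w where "w i = (if i < n then v i else y)" for i
    have "\<not> indep_mod R {..<Suc n} w"
    proof
      assume "indep_mod R {..<Suc n} w"
      then have "enat (card {..<Suc n}) \<le> qdim Y R"
        using v(1) y by (intro card_le_qdim) (auto simp: w_def)
      then show False using q by simp
    qed
    then obtain a where a: "(\<Sum>i<Suc n. a i *\<^sub>C w i) \<in> R" "\<exists>i<Suc n. a i \<noteq> 0"
      by (auto simp: indep_mod_def)
    have "(\<Sum>i<n. a i *\<^sub>C w i) = (\<Sum>i<n. a i *\<^sub>C v i)"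
      by (rule sum.cong) (auto simp: w_def)
    then have s: "(\<Sum>i<n. a i *\<^sub>C v i) + a n *\<^sub>C y \<in> R" using a(1) by (simp add: w_def)
    have an: "a n \<noteq> 0"
    proof
      assume "a n = 0"
      then have "\<forall>i<n. a i = 0" using s indep_modD[OF v(2)] by auto
      then show False using a(2) \<open>a n = 0\<close> less_Suc_eq by auto
    qed
    let ?r = "inverse (a n) *\<^sub>C ((\<Sum>i<n. a i *\<^sub>C v i) + a n *\<^sub>C y)"
    let ?s = "inverse (a n) *\<^sub>C (\<Sum>i<n. a i *\<^sub>C v i)"
    have "y = ?r + (- ?s)"
      using an scaleC_of_real[of 1 y] by (simp add: scaleC_add_right scaleC_scaleC)
    moreover have "?r \<in> R" using s by (intro complex_vector.subspace_scale[OF R])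
    moreover have "- ?s \<in> cspan (v ` {..<n})"
      by (intro complex_vector.span_neg complex_vector.span_scale sum_in_span)
    ultimately show ?thesis unfolding subspace_sum_def by blast
  qed
  then show ?thesis using v that by blast
qed

lemma csubspace_subspace_sum:
  assumes "csubspace M" "csubspace N" shows "csubspace (subspace_sum M N)"
  unfolding subspace_sum_def using complex_vector.subspace_sums[OF assms] by simp

lemma subspace_sum_memI: "m \<in> M \<Longrightarrow> n \<in> N \<Longrightarrow> m + n \<in> subspace_sum M N"
  by (auto simp: subspace_sum_def)

lemma subspace_sum_superset1: "csubspace N \<Longrightarrow> M \<subseteq> subspace_sum M N"
  using complex_vector.subspace_0[of N] by (force simp: subspace_sum_def)

lemma subspace_sum_superset2: "csubspace M \<Longrightarrow> N \<subseteq> subspace_sum M N"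
  using complex_vector.subspace_0[of M] by (force simp: subspace_sum_def)

text \<open>Generators modulo W and generators of W modulo R together generate Y modulo R, and
  independent families concatenate in the same way. Infinite values are handled by comparing all
  finite lower bounds; every index computation below rests on this identity.\<close>

lemma qdim_add:
  assumes R: "csubspace R" and W: "csubspace W" and RW: "R \<subseteq> W" and WY: "W \<subseteq> Y"
  shows "qdim Y R = qdim Y W + qdim W R"
proof (rule antisym)
  show "qdim Y R \<le> qdim Y W + qdim W R"
  proof (cases "qdim Y W"; cases "qdim W R")
    fix m k assume mk: "qdim Y W = enat m" "qdim W R = enat k"
    obtain v where v: "Y \<subseteq> subspace_sum W (cspan (v ` {..<m}))"
      by (rule qdim_basis[OF W mk(1)])
    obtain w where w: "W \<subseteq> subspace_sum R (cspan (w ` {..<k}))"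
      by (rule qdim_basis[OF R mk(2)])
    let ?F = "w ` {..<k} \<union> v ` {..<m}"
    have "Y \<subseteq> subspace_sum R (cspan ?F)"
    proof
      fix y assume "y \<in> Y"
      then obtain x s where 1: "y = x + s" "x \<in> W" "s \<in> cspan (v ` {..<m})"
        using v by (auto simp: subspace_sum_def)
      then obtain r t where 2: "x = r + t" "r \<in> R" "t \<in> cspan (w ` {..<k})"
        using w by (auto simp: subspace_sum_def)
      have "t + s \<in> cspan ?F"
        using 1 2 complex_vector.span_mono[of "v ` {..<m}" ?F] complex_vector.span_mono[of "w ` {..<k}" ?F]
        by (intro complex_vector.span_add) auto
      then have "r + (t + s) \<in> subspace_sum R (cspan ?F)" using 2 by (intro subspace_sum_memI)
      then show "y \<in> subspace_sum R (cspan ?F)" using 1 2 by (simp add: add.assoc)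
    qed
    then have "qdim Y R \<le> enat (card ?F)" by (intro qdim_le_card[OF R]) auto
    also have "card ?F \<le> k + m"
      by (rule order.trans[OF card_Un_le]) (metis add_mono card_image_le card_lessThan finite_lessThan)
    finally show ?thesis using mk by (simp add: add.commute)
  qed auto
next
  have key: "enat m + enat k \<le> qdim Y R" if m: "enat m \<le> qdim Y W" and k: "enat k \<le> qdim W R" for m k
  proof -
    obtain v where v: "v ` {..<m} \<subseteq> Y" "indep_mod W {..<m} v" using le_qdimE[OF m] .
    obtain w where w: "w ` {..<k} \<subseteq> W" "indep_mod R {..<k} w" using le_qdimE[OF k] .
    \<comment> \<open>Tagging the indices makes the concatenation disjoint regardless of the values
      of v and w.\<close>
    define I where "I = Inl ` {..<m} \<union> Inr ` {..<k}"
    define u where "u = case_sum v w"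
    have I: "finite I" "card I = m + k"
      unfolding I_def by (simp, subst card_Un_disjoint, auto simp: card_image)
    have split: "(\<Sum>i\<in>I. a i *\<^sub>C u i) = (\<Sum>i<m. a (Inl i) *\<^sub>C v i) + (\<Sum>i<k. a (Inr i) *\<^sub>C w i)" for a
      unfolding I_def by (subst sum.union_disjoint) (auto simp: sum.reindex u_def)
    have "indep_mod R I u"
      unfolding indep_mod_def
    proof (intro allI impI)
      fix a assume "(\<Sum>i\<in>I. a i *\<^sub>C u i) \<in> R"
      then have s: "(\<Sum>i<m. a (Inl i) *\<^sub>C v i) + (\<Sum>i<k. a (Inr i) *\<^sub>C w i) \<in> R"
        unfolding split .
      have "(\<Sum>i<k. a (Inr i) *\<^sub>C w i) \<in> W"
        using w by (intro complex_vector.subspace_sum[OF W] complex_vector.subspace_scale[OF W]) auto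
      then have "(\<Sum>i<m. a (Inl i) *\<^sub>C v i) \<in> W"
        using complex_vector.subspace_diff[OF W, OF subsetD[OF RW s]] by fastforce
      then have 1: "\<forall>i<m. a (Inl i) = 0" using indep_modD[OF v(2), of "a \<circ> Inl"] by auto
      then have "(\<Sum>i<k. a (Inr i) *\<^sub>C w i) \<in> R" using s by simp
      then have "\<forall>i<k. a (Inr i) = 0" using indep_modD[OF w(2), of "a \<circ> Inr"] by auto
      with 1 show "\<forall>i\<in>I. a i = 0" by (auto simp: I_def)
    qed
    moreover have "u ` I \<subseteq> Y"
    proof -
      have "u ` I = v ` {..<m} \<union> w ` {..<k}" by (simp add: I_def u_def image_Un image_image)
      then show ?thesis using v(1) w(1) WY by blast
    qed
    ultimately have "enat (card I) \<le> qdim Y R" by (intro card_le_qdim[OF I(1)])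
    then show ?thesis using I by simp
  qed
  have inf: "q = \<infinity>" if "\<And>m. enat m \<le> q" for q
  proof (cases q)
    case (enat n)
    then show ?thesis using that[of "Suc n"] by simp
  qed
  show "qdim Y W + qdim W R \<le> qdim Y R"
  proof (cases "qdim Y W")
    case (enat m)
    show ?thesis
    proof (cases "qdim W R")
      case (enat k)
      then show ?thesis using key[of m k] \<open>qdim Y W = enat m\<close> by simp
    next
      case infinity
      have "enat k \<le> qdim Y R" for k using key[of 0 k] infinity by (simp add: zero_enat_def[symmetric])
      then show ?thesis using inf[of "qdim Y R"] by simp
    qed
  next
    case infinity
    have "enat k \<le> qdim Y R" for k using key[of k 0] infinity by (simp add: zero_enat_def[symmetric])
    then show ?thesis using inf[of "qdim Y R"] by simp
  qed
qed

lemma bounded_clinear_sum: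
  assumes "bounded_clinear f"
  shows "f (\<Sum>i\<in>I. a i *\<^sub>C v i) = (\<Sum>i\<in>I. a i *\<^sub>C f (v i))"
proof -
  interpret bounded_clinear f by fact
  show ?thesis by (simp add: sum scaleC)
qed

text \<open>A combination of the \<open>v i\<close> lies in the preimage of R exactly when the same
  combination of the \<open>f (v i)\<close> lies in R, so independent families correspond. No
  surjectivity or injectivity enters, which makes this the tool for codimensions of one image in
  another.\<close>

lemma qdim_image:
  assumes f: "bounded_clinear f"
  shows "qdim (f ` Y) R = qdim Y (f -` R)"
proof (rule antisym)
  have eq: "indep_mod (f -` R) I v \<longleftrightarrow> indep_mod R I (\<lambda>i. f (v i))" for I :: "nat set" and v
    by (simp add: indep_mod_def bounded_clinear_sum[OF f])
  show "qdim (f ` Y) R \<le> qdim Y (f -` R)"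
  proof (rule qdim_le)
    fix m and v :: "nat \<Rightarrow> 'b" assume v: "v ` {..<m} \<subseteq> f ` Y" "indep_mod R {..<m} v"
    then have "\<forall>i\<in>{..<m}. \<exists>y\<in>Y. v i = f y" by auto
    then obtain y where y: "\<And>i. i < m \<Longrightarrow> y i \<in> Y \<and> v i = f (y i)"
      by (metis lessThan_iff)
    have "indep_mod R {..<m} (\<lambda>i. f (y i))"
      using v(2) y by (auto simp: indep_mod_def)
    then have "enat (card {..<m}) \<le> qdim Y (f -` R)"
      using y by (intro card_le_qdim) (auto simp: eq)
    then show "enat m \<le> qdim Y (f -` R)" by simp
  qed
  show "qdim Y (f -` R) \<le> qdim (f ` Y) R"
  proof (rule qdim_le)
    fix m and v :: "nat \<Rightarrow> 'a" assume "v ` {..<m} \<subseteq> Y" "indep_mod (f -` R) {..<m} v"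
    then have "enat (card {..<m}) \<le> qdim (f ` Y) R"
      using eq[of "{..<m}" v] by (intro card_le_qdim[of _ "\<lambda>i. f (v i)"]) auto
    then show "enat m \<le> qdim (f ` Y) R" by simp
  qed
qed

text \<open>The second isomorphism theorem: Y / (Y \<inter> R) and (Y + R) / R have the same
  dimension.\<close>

lemma qdim_Int:
  assumes Y: "csubspace Y" shows "qdim Y (Y \<inter> R) = qdim Y R"
proof (rule antisym)
  show "qdim Y (Y \<inter> R) \<le> qdim Y R"
  proof (rule qdim_le)
    fix m and v :: "nat \<Rightarrow> 'a" assume v: "v ` {..<m} \<subseteq> Y" "indep_mod (Y \<inter> R) {..<m} v"
    have "(\<Sum>i<m. a i *\<^sub>C v i) \<in> Y" for a
      using v by (intro complex_vector.subspace_sum[OF Y] complex_vector.subspace_scale[OF Y]) auto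
    then have "indep_mod R {..<m} v" using v(2) by (auto simp: indep_mod_def)
    then show "enat m \<le> qdim Y R" using card_le_qdim[of "{..<m}" v Y R] v by simp
  qed
qed (auto intro: qdim_mono)

text \<open>Summands from R are invisible modulo R: dropping the W-component of each vector
  preserves independence.\<close>

lemma qdim_subspace_sum:
  assumes R: "csubspace R" and W: "csubspace W" and WR: "W \<subseteq> R"
  shows "qdim (subspace_sum Y W) R = qdim Y R"
proof (rule antisym)
  show "qdim (subspace_sum Y W) R \<le> qdim Y R"
  proof (rule qdim_le)
    fix m and v :: "nat \<Rightarrow> 'a" assume v: "v ` {..<m} \<subseteq> subspace_sum Y W" "indep_mod R {..<m} v"
    have "\<forall>i\<in>{..<m}. \<exists>y w. y \<in> Y \<and> w \<in> W \<and> v i = y + w"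
      using v(1) unfolding subspace_sum_def image_subset_iff by blast
    then obtain y w where yw: "\<And>i. i < m \<Longrightarrow> y i \<in> Y \<and> w i \<in> W \<and> v i = y i + w i"
      by (metis lessThan_iff)
    have "indep_mod R {..<m} y"
      unfolding indep_mod_def
    proof (intro allI impI)
      fix a assume s: "(\<Sum>i<m. a i *\<^sub>C y i) \<in> R"
      have "(\<Sum>i<m. a i *\<^sub>C w i) \<in> R"
        using yw WR by (intro complex_vector.subspace_sum[OF R] complex_vector.subspace_scale[OF R]) auto
      then have "(\<Sum>i<m. a i *\<^sub>C y i) + (\<Sum>i<m. a i *\<^sub>C w i) \<in> R"
        by (rule complex_vector.subspace_add[OF R s])
      moreover have "(\<Sum>i<m. a i *\<^sub>C v i) = (\<Sum>i<m. a i *\<^sub>C y i) + (\<Sum>i<m. a i *\<^sub>C w i)"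
        unfolding sum.distrib[symmetric]
        by (rule sum.cong) (auto simp: yw scaleC_add_right)
      ultimately have "(\<Sum>i<m. a i *\<^sub>C v i) \<in> R" by simp
      then show "\<forall>i\<in>{..<m}. a i = 0" using v(2) unfolding indep_mod_def by blast
    qed
    moreover have "y ` {..<m} \<subseteq> Y" using yw by auto
    ultimately show "enat m \<le> qdim Y R" using card_le_qdim[of "{..<m}" y Y R] by simp
  qed
  show "qdim Y R \<le> qdim (subspace_sum Y W) R"
    by (intro qdim_mono subspace_sum_superset1[OF W]) auto
qed

lemma qdim_eq_0_iff:
  assumes Y: "csubspace Y" and R: "csubspace R"
  shows "qdim Y R = 0 \<longleftrightarrow> Y \<subseteq> R"
proof
  assume "qdim Y R = 0"
  then obtain v where "Y \<subseteq> subspace_sum R (cspan (v ` {..<0::nat}))"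
    using qdim_basis[OF R, of Y 0] by (metis zero_enat_def)
  then show "Y \<subseteq> R" by (auto simp: subspace_sum_def)
next
  assume "Y \<subseteq> R"
  then have "qdim Y R \<le> enat (card ({}::'a set))"
    by (intro qdim_le_card[OF R]) (auto simp: subspace_sum_def)
  then show "qdim Y R = 0" by (simp add: zero_enat_def[symmetric])
qed

section \<open>Agreement with the dimensions and codimensions of the definitions\<close>

lemma cfinite_dim_iff_qdim:
  assumes V: "csubspace V" shows "cfinite_dim V \<longleftrightarrow> qdim V {0} \<noteq> \<infinity>"
proof
  assume "cfinite_dim V"
  then obtain B where "finite B" "V \<subseteq> cspan B" by (auto simp: cfinite_dim_def)
  then have "qdim V {0} \<le> enat (card B)"
    by (intro qdim_le_card) (auto simp: subspace_sum_def complex_vector.subspace_single_0)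
  then show "qdim V {0} \<noteq> \<infinity>" by (cases "qdim V {0}") auto
next
  assume "qdim V {0} \<noteq> \<infinity>"
  then obtain n where "qdim V {0} = enat n" by auto
  then obtain v where "V \<subseteq> subspace_sum {0} (cspan (v ` {..<n}))"
    using qdim_basis[OF complex_vector.subspace_single_0] by metis
  then have "V \<subseteq> cspan (v ` {..<n})" by (auto simp: subspace_sum_def)
  then show "cfinite_dim V" unfolding cfinite_dim_def by blast
qed

lemma cdim_eq_qdim:
  assumes V: "csubspace V" and fin: "qdim V {0} \<noteq> \<infinity>"
  shows "enat (cdim V) = qdim V {0}"
proof -
  obtain n where n: "qdim V {0} = enat n" using fin by auto
  obtain B where B: "B \<subseteq> V" "\<not> cdependent B" "V \<subseteq> cspan B" "card B = cdim V"
    using complex_vector.basis_exists[of V] by blast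
  obtain G where G: "finite G" "V \<subseteq> cspan G"
    using fin cfinite_dim_iff_qdim[OF V] by (auto simp: cfinite_dim_def)
  have finB: "finite B"
    using complex_vector.independent_span_bound[OF G(1) B(2)] B(1) G(2) by auto
  have "qdim V {0} \<le> enat (card B)"
    using B finB by (intro qdim_le_card) (auto simp: subspace_sum_def complex_vector.subspace_single_0)
  moreover have "enat (card B) \<le> qdim V {0}"
  proof (rule card_le_qdim[of B "\<lambda>x. x"])
    show "indep_mod {0} B (\<lambda>x. x)"
      using B(2) complex_vector.dependent_finite[OF finB] by (auto simp: indep_mod_def)
  qed (use B finB in auto)
  ultimately show ?thesis using B(4) by simp
qed

text \<open>Modulo R only the summand C of Y survives, and it meets R trivially. Hence all
  complements have the same dimension, and the choice made by \<open>SOME\<close> in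
  \<open>ccodim\<close> is harmless.\<close>

lemma qdim_direct_sum:
  assumes "direct_sum Y R C" shows "qdim Y R = qdim C {0}"
proof -
  have RC: "csubspace R" "csubspace C" "R \<inter> C = {0}" and Y: "Y = subspace_sum C R"
    using assms by (auto simp: direct_sum_def subspace_sum_def) (metis add.commute)+
  have "qdim Y R = qdim C (C \<inter> R)"
    using RC by (simp add: Y qdim_subspace_sum qdim_Int)
  then show ?thesis using RC by (simp add: Int_commute)
qed

text \<open>The span of a family that is maximal independent modulo R meets R only in 0, because
  each of its elements is a combination indexed by the family. The vectors are exported too, since
  bounded projections are built from them later.\<close>

lemma complement_exists:
  assumes Y: "csubspace Y" and R: "csubspace R" and RY: "R \<subseteq> Y" and fin: "qdim Y R = enat n"
  obtains v where "v ` {..<n} \<subseteq> Y" "indep_mod R {..<n} v" "direct_sum Y R (cspan (v ` {..<n}))"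
proof -
  obtain v where v: "v ` {..<n} \<subseteq> Y" "indep_mod R {..<n} v"
      "Y \<subseteq> subspace_sum R (cspan (v ` {..<n}))"
    using qdim_basis[OF R fin] .
  have "x = 0" if x: "x \<in> R" "x \<in> cspan (v ` {..<n})" for x
  proof -
    have "\<exists>a. x = (\<Sum>i<n. a i *\<^sub>C v i)"
      using x(2)
    proof (induction rule: complex_vector.span_induct_alt)
      case base
      then show ?case by (intro exI[of _ "\<lambda>_. 0"]) simp
    next
      case (step c y z)
      then obtain j a where j: "j < n" "y = v j" "z = (\<Sum>i<n. a i *\<^sub>C v i)" by auto
      have "(\<Sum>i<n. (a i + (if i = j then c else 0)) *\<^sub>C v i)
          = (\<Sum>i<n. a i *\<^sub>C v i) + (\<Sum>i<n. (if i = j then c else 0) *\<^sub>C v i)"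
        by (simp add: scaleC_add_left sum.distrib)
      also have "(\<Sum>i<n. (if i = j then c else 0) *\<^sub>C v i) = (\<Sum>i\<in>{j}. c *\<^sub>C v i)"
        using j by (intro sum.mono_neutral_cong_right) auto
      finally have "c *\<^sub>C y + z = (\<Sum>i<n. (a i + (if i = j then c else 0)) *\<^sub>C v i)"
        using j by (simp add: add.commute)
      then show ?case by (rule exI[of _ "\<lambda>i. a i + (if i = j then c else 0)"])
    qed
    then obtain a where a: "x = (\<Sum>i<n. a i *\<^sub>C v i)" by blast
    then have "\<forall>i<n. a i = 0" using indep_modD[OF v(2), of a] x(1) by simp
    then show "x = 0" using a by simp
  qed
  moreover have "0 \<in> R" using complex_vector.subspace_0[OF R] .
  moreover have "subspace_sum R (cspan (v ` {..<n})) \<subseteq> Y"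
    using RY v(1) complex_vector.span_minimal[OF v(1) Y]
    by (auto simp: subspace_sum_def intro!: complex_vector.subspace_add[OF Y])
  ultimately have "direct_sum Y R (cspan (v ` {..<n}))"
    using v R complex_vector.span_zero[of "v ` {..<n}"]
    unfolding direct_sum_def subspace_sum_def by auto
  then show ?thesis using that v by blast
qed

lemma cfinite_codim_iff_qdim:
  assumes "csubspace Y" "csubspace R" "R \<subseteq> Y"
  shows "cfinite_codim Y R \<longleftrightarrow> qdim Y R \<noteq> \<infinity>"
proof
  assume "cfinite_codim Y R"
  then show "qdim Y R \<noteq> \<infinity>"
    by (metis cfinite_codim_def cfinite_dim_iff_qdim direct_sum_def qdim_direct_sum)
next
  assume "qdim Y R \<noteq> \<infinity>"
  then obtain n where "qdim Y R = enat n" by auto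
  then obtain v where "direct_sum Y R (cspan (v ` {..<n}))"
    using complement_exists[OF assms] by metis
  then show "cfinite_codim Y R"
    unfolding cfinite_codim_def cfinite_dim_def by (metis finite_imageI finite_lessThan order.refl)
qed

lemma ccodim_eq_qdim:
  assumes "csubspace Y" "csubspace R" "R \<subseteq> Y" "qdim Y R \<noteq> \<infinity>"
  shows "enat (ccodim Y R) = qdim Y R"
proof -
  define C where "C = (SOME C. direct_sum Y R C)"
  have "\<exists>C. direct_sum Y R C"
    using cfinite_codim_iff_qdim[OF assms(1-3)] assms(4) by (auto simp: cfinite_codim_def)
  then have C: "direct_sum Y R C" unfolding C_def by (rule someI_ex)
  then have "qdim Y R = qdim C {0}" by (rule qdim_direct_sum)
  moreover have "enat (cdim C) = qdim C {0}"
    using C assms(4) calculation by (intro cdim_eq_qdim) (auto simp: direct_sum_def)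
  ultimately show ?thesis by (simp add: ccodim_def C_def)
qed

section \<open>Bounded functionals and projections\<close>

text \<open>Homogeneity is asked as one inequality, which is easy to check for infima; applying it
  with \<open>inverse r\<close> yields equality.\<close>

definition sublinear :: "('a::real_vector \<Rightarrow> real) \<Rightarrow> bool"
  where "sublinear p \<longleftrightarrow> (\<forall>x y. p (x + y) \<le> p x + p y) \<and> p 0 = 0 \<and>
    (\<forall>r>0. \<forall>x. p (r *\<^sub>R x) \<le> r * p x)"

lemma sublinear_add: "sublinear p \<Longrightarrow> p (x + y) \<le> p x + p y"
  and sublinear_0: "sublinear p \<Longrightarrow> p 0 = 0"
  by (auto simp: sublinear_def)

lemma sublinear_minus: "sublinear p \<Longrightarrow> - p (- x) \<le> p x"
  using sublinear_add[of p x "- x"] sublinear_0[of p] by simp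

lemma sublinear_scaleR:
  assumes "sublinear p" "r \<ge> 0" shows "p (r *\<^sub>R x) = r * p x"
proof (cases "r = 0")
  case False
  then have r: "r > 0" using assms by simp
  have "p (inverse r *\<^sub>R r *\<^sub>R x) \<le> inverse r * p (r *\<^sub>R x)"
    using assms(1) r unfolding sublinear_def by (meson positive_imp_inverse_positive)
  then have "r * p x \<le> p (r *\<^sub>R x)" using r by (simp add: field_simps)
  moreover have "p (r *\<^sub>R x) \<le> r * p x" using assms(1) r by (simp add: sublinear_def)
  ultimately show ?thesis by simp
qed (simp add: sublinear_0[OF assms(1)])

text \<open>The infimum of \<open>p (x + t *\<^sub>R a) - t * p a\<close> over
  \<open>t \<ge> 0\<close> is sublinear because two rays add up to a ray. Its value at - a is at
  most - p a, so it lies below p and is linear along a; this is how minimality will force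
  linearity.\<close>

lemma sublinear_shift:
  fixes p :: "'a::real_vector \<Rightarrow> real"
  assumes p: "sublinear p"
  obtains q where "sublinear q" "\<And>x. q x \<le> p x" "\<And>x t. t \<ge> 0 \<Longrightarrow> q x \<le> p (x + t *\<^sub>R a) - t * p a"
proof -
  define q where "q x = (INF t\<in>{0..}. p (x + t *\<^sub>R a) - t * p a)" for x
  \<comment> \<open>A lower bound uniform in t, without which the real-valued infimum would carry no
    information.\<close>
  have lb: "- p (- x) \<le> p (x + t *\<^sub>R a) - t * p a" if "t \<ge> 0" for x t
    using sublinear_add[OF p, of "x + t *\<^sub>R a" "- x"] sublinear_scaleR[OF p that, of a] by simp
  have q: "q x \<le> p (x + t *\<^sub>R a) - t * p a" if "t \<ge> 0" for x t
    unfolding q_def using that lb by (intro cINF_lower bdd_belowI2[of _ "- p (- x)"]) auto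
  have qI: "y \<le> q x" if "\<And>t. t \<ge> 0 \<Longrightarrow> y \<le> p (x + t *\<^sub>R a) - t * p a" for x y
    unfolding q_def using that by (intro cINF_greatest) auto
  have "sublinear q"
    unfolding sublinear_def
  proof (intro conjI allI impI)
    fix x y
    have "q (x + y) - (p (x + t *\<^sub>R a) - t * p a) \<le> p (y + s *\<^sub>R a) - s * p a" if "s \<ge> 0" "t \<ge> 0" for s t
    proof -
      have "q (x + y) \<le> p (x + y + (s + t) *\<^sub>R a) - (s + t) * p a" using that by (intro q) auto
      also have "x + y + (s + t) *\<^sub>R a = (x + t *\<^sub>R a) + (y + s *\<^sub>R a)" by (simp add: algebra_simps)
      finally show ?thesis
        using sublinear_add[OF p, of "x + t *\<^sub>R a" "y + s *\<^sub>R a"] by (simp add: algebra_simps)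
    qed
    then have "q (x + y) - (p (x + t *\<^sub>R a) - t * p a) \<le> q y" if "t \<ge> 0" for t
      using that by (intro qI) auto
    then have "q (x + y) - q y \<le> q x" by (intro qI) (simp add: algebra_simps)
    then show "q (x + y) \<le> q x + q y" by simp
  next
    show "q 0 = 0"
      using q[of 0 0] qI[of 0 0] by (simp add: sublinear_scaleR[OF p] sublinear_0[OF p])
  next
    fix r :: real and x assume r: "r > 0"
    have "inverse r * q (r *\<^sub>R x) \<le> p (x + t *\<^sub>R a) - t * p a" if "t \<ge> 0" for t
    proof -
      have "q (r *\<^sub>R x) \<le> p (r *\<^sub>R x + (r * t) *\<^sub>R a) - r * t * p a" using that r by (intro q) auto
      also have "r *\<^sub>R x + (r * t) *\<^sub>R a = r *\<^sub>R (x + t *\<^sub>R a)" by (simp add: algebra_simps)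
      also have "p \<dots> = r * p (x + t *\<^sub>R a)" using r by (intro sublinear_scaleR[OF p]) auto
      finally show ?thesis using r by (simp add: field_simps)
    qed
    then have "inverse r * q (r *\<^sub>R x) \<le> q x" by (intro qI) auto
    then show "q (r *\<^sub>R x) \<le> r * q x" using r by (simp add: field_simps)
  qed
  moreover have "q x \<le> p x" for x using q[of 0 x] by simp
  ultimately show ?thesis using that q by blast
qed

text \<open>In a chain, of two members p and p' the smaller one bounds the infimum at x + y by p x +
  p' y, which gives subadditivity. The common upper bound q supplies the lower bound - q (-
  x).\<close>

lemma sublinear_INF:
  fixes C :: "('a::real_vector \<Rightarrow> real) set"
  assumes C: "C \<noteq> {}" "\<And>p. p \<in> C \<Longrightarrow> sublinear p" "\<And>p. p \<in> C \<Longrightarrow> p \<le> q"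
    and chain: "\<And>p p'. p \<in> C \<Longrightarrow> p' \<in> C \<Longrightarrow> p \<le> p' \<or> p' \<le> p"
  shows "sublinear (\<lambda>x. INF p\<in>C. p x)" "\<And>p x. p \<in> C \<Longrightarrow> (INF p\<in>C. p x) \<le> p x"
proof -
  define u where "u x = (INF p\<in>C. p x)" for x
  have lb: "- q (- x) \<le> p x" if "p \<in> C" for p x
    using sublinear_minus[OF C(2)[OF that], of x] le_funD[OF C(3)[OF that], of "- x"] by simp
  have u: "u x \<le> p x" if "p \<in> C" for p x
    unfolding u_def using that lb by (intro cINF_lower bdd_belowI2[of _ "- q (- x)"]) auto
  then show "\<And>p x. p \<in> C \<Longrightarrow> (INF p\<in>C. p x) \<le> p x" by (simp add: u_def)
  have uI: "y \<le> u x" if "\<And>p. p \<in> C \<Longrightarrow> y \<le> p x" for x y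
    unfolding u_def using that C(1) by (intro cINF_greatest) auto
  have "sublinear u"
    unfolding sublinear_def
  proof (intro conjI allI impI)
    fix x y
    have "u (x + y) - p x \<le> p' y" if pp: "p \<in> C" "p' \<in> C" for p p'
    proof -
      obtain r where r: "r \<in> C" "r \<le> p" "r \<le> p'" using chain[OF pp] pp by blast
      have "u (x + y) \<le> r x + r y" using u[OF r(1)] sublinear_add[OF C(2)[OF r(1)]] by (rule order.trans)
      then show ?thesis using le_funD[OF r(2), of x] le_funD[OF r(3), of y] by linarith
    qed
    then have "u (x + y) - p x \<le> u y" if "p \<in> C" for p using that by (intro uI) auto
    then have "u (x + y) - u y \<le> u x" by (intro uI) (simp add: algebra_simps)
    then show "u (x + y) \<le> u x + u y" by simp
  next
    obtain p where "p \<in> C" using C(1) by blast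
    then show "u 0 = 0"
      using u[of p 0] uI[of 0 0] C(2) by (simp add: sublinear_0)
  next
    fix r :: real and x assume r: "r > 0"
    have "inverse r * u (r *\<^sub>R x) \<le> p x" if "p \<in> C" for p
      using u[OF that, of "r *\<^sub>R x"] sublinear_scaleR[OF C(2)[OF that], of r x] r
      by (simp add: field_simps)
    then have "inverse r * u (r *\<^sub>R x) \<le> u x" by (intro uI) auto
    then show "u (r *\<^sub>R x) \<le> r * u x" using r by (simp add: field_simps)
  qed
  moreover have "u = (\<lambda>x. INF p\<in>C. p x)" by (simp add: fun_eq_iff u_def)
  ultimately show "sublinear (\<lambda>x. INF p\<in>C. p x)" by simp
qed

text \<open>A minimal sublinear functional is linear, and Zorn's lemma provides one; this replaces
  the extension of functionals from subspaces.\<close>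

theorem Hahn_Banach_sublinear:
  fixes q :: "'a::real_vector \<Rightarrow> real"
  assumes q: "sublinear q"
  obtains f where "linear f" "\<And>x. f x \<le> q x" "f a = q a"
proof -
  \<comment> \<open>Shifting along a before minimising fixes the value at a: anything below q' is at
    most - q a at - a.\<close>
  obtain q' where q': "sublinear q'" "\<And>x. q' x \<le> q x"
      "\<And>x t. t \<ge> 0 \<Longrightarrow> q' x \<le> q (x + t *\<^sub>R a) - t * q a"
    using sublinear_shift[OF q, of a] by blast
  define A where "A = {p. sublinear p \<and> p \<le> q'}"
  have "\<exists>m\<in>A. \<forall>p\<in>A. p \<le> m \<longrightarrow> p = m"
  proof (rule predicate_Zorn)
    show "partial_order_on A (relation_of (\<lambda>x y. y \<le> x) A)"
      by (rule partial_order_on_relation_ofI) auto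
    fix C assume C: "C \<in> Chains (relation_of (\<lambda>x y. y \<le> x) A)"
    then have CA: "C \<subseteq> A" and ch: "\<And>p p'. p \<in> C \<Longrightarrow> p' \<in> C \<Longrightarrow> p \<le> p' \<or> p' \<le> p"
      by (auto simp: Chains_def relation_of_def)
    show "\<exists>u\<in>A. \<forall>a\<in>C. u \<le> a"
    proof (cases "C = {}")
      case True
      then show ?thesis using q'(1) by (auto simp: A_def)
    next
      case False
      have prem: "\<And>p. p \<in> C \<Longrightarrow> sublinear p" "\<And>p. p \<in> C \<Longrightarrow> p \<le> q'"
        using CA by (auto simp: A_def)
      note * = sublinear_INF[OF False prem ch]
      obtain p where p: "p \<in> C" using False by blast
      then have "(\<lambda>x. INF p\<in>C. p x) \<le> p" by (auto intro!: le_funI *(2))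
      then have "(\<lambda>x. INF p\<in>C. p x) \<in> A"
        using *(1) prem(2)[OF p] by (auto simp: A_def)
      moreover have "\<forall>a\<in>C. (\<lambda>x. INF p\<in>C. p x) \<le> a" using *(2) by (auto intro!: le_funI)
      ultimately show ?thesis by (intro bexI[of _ "\<lambda>x. INF p\<in>C. p x"])
    qed
  qed
  then obtain f where fA: "f \<in> A" and f_min: "\<forall>p\<in>A. p \<le> f \<longrightarrow> p = f" by (rule bexE)
  have f: "sublinear f" "f \<le> q'" using fA by (auto simp: A_def)
  have min: "p = f" if "sublinear p" "p \<le> f" for p
    using f_min that order.trans[OF that(2) f(2)] unfolding A_def by blast
  \<comment> \<open>The shift of f along y lies below f, hence equals f by minimality; its defining
    bound at t = 1 is superadditivity.\<close>
  have add: "f (x + y) = f x + f y" for x y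
  proof -
    obtain p where p: "sublinear p" "\<And>x. p x \<le> f x"
        "\<And>x t. t \<ge> 0 \<Longrightarrow> p x \<le> f (x + t *\<^sub>R y) - t * f y"
      using sublinear_shift[OF f(1), of y] by blast
    have "p = f" using p by (intro min) (auto simp: le_fun_def)
    then have "f x + f y \<le> f (x + y)" using p(3)[of 1 x] by simp
    then show ?thesis using sublinear_add[OF f(1), of x y] by simp
  qed
  have neg: "f (- x) = - f x" for x
    using add[of x "- x"] sublinear_0[OF f(1)] by simp
  have "f (r *\<^sub>R x) = r * f x" for r x
  proof (cases "r \<ge> 0")
    case True
    then show ?thesis by (rule sublinear_scaleR[OF f(1)])
  next
    case False
    then show ?thesis using neg[of "(- r) *\<^sub>R x"] sublinear_scaleR[OF f(1), of "- r" x] by simp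
  qed
  then have "linear f" using add by (intro linearI) auto
  moreover have le: "f x \<le> q x" for x using f(2) q'(2)[of x] by (metis le_funD order.trans)
  moreover have "f a = q a"
  proof (rule antisym[OF le])
    have "f (- a) \<le> q (- a + 1 *\<^sub>R a) - 1 * q a"
      using le_funD[OF f(2), of "- a"] q'(3)[of 1 "- a"] by simp
    then show "q a \<le> f a" using neg[of a] sublinear_0[OF q] by simp
  qed
  ultimately show ?thesis using that by blast
qed

section \<open>Separation from closed complex subspaces and finite rank projections\<close>

lemma csubspace_scaleR: "csubspace W \<Longrightarrow> x \<in> W \<Longrightarrow> r *\<^sub>R x \<in> W"
  unfolding scaleC_of_real[symmetric] by (rule complex_vector.subspace_scale)

lemma sublinear_infdist:
  assumes W: "csubspace W" shows "sublinear (\<lambda>x. infdist x W)"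
proof -
  have ne: "W \<noteq> {}" using complex_vector.subspace_0[OF W] by auto
  have add: "infdist (x + y) W \<le> infdist x W + infdist y W" for x y
  proof (rule field_le_epsilon)
    fix e :: real assume e: "e > 0"
    have "\<exists>w\<in>W. dist x w < infdist x W + e/2" for x
    proof (rule ccontr)
      assume "\<not> ?thesis"
      then have "infdist x W + e/2 \<le> infdist x W"
        using ne by (subst (2) infdist_def) (auto intro!: cINF_greatest simp: not_less)
      then show False using e by simp
    qed
    then obtain w z where wz: "w \<in> W" "z \<in> W" "dist x w < infdist x W + e/2" "dist y z < infdist y W + e/2"
      by metis
    have "infdist (x + y) W \<le> dist (x + y) (w + z)"
      using wz complex_vector.subspace_add[OF W] by (intro infdist_le) auto
    also have "\<dots> \<le> dist x w + dist y z" by (rule dist_triangle_add)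
    finally show "infdist (x + y) W \<le> infdist x W + infdist y W + e" using wz by simp
  qed
  have "infdist (r *\<^sub>R x) W \<le> r * infdist x W" if r: "r > 0" for r x
  proof -
    have "inverse r * infdist (r *\<^sub>R x) W \<le> infdist x W"
      unfolding infdist_notempty[OF ne, of x]
    proof (rule cINF_greatest[OF ne])
      fix w assume "w \<in> W"
      then have "infdist (r *\<^sub>R x) W \<le> dist (r *\<^sub>R x) (r *\<^sub>R w)"
        by (intro infdist_le csubspace_scaleR[OF W])
      also have "\<dots> = r * dist x w" using r by (simp add: dist_norm scaleR_diff_right[symmetric])
      finally show "inverse r * infdist (r *\<^sub>R x) W \<le> dist x w" using r by (simp add: field_simps)
    qed
    then show ?thesis using r by (simp add: field_simps)
  qed
  then show ?thesis
    using add complex_vector.subspace_0[OF W] by (auto simp: sublinear_def)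
qed

text \<open>The dominating functional is the distance to W. It vanishes on W, which forces f to
  vanish there at w and - w, and it is positive at e because W is closed.\<close>

theorem Hahn_Banach_separation:
  fixes e :: "'a::complex_normed_vector"
  assumes W: "csubspace W" "closed W" and e: "e \<notin> W"
  obtains \<phi> :: "'a \<Rightarrow> complex" where "bounded_clinear \<phi>" "\<And>w. w \<in> W \<Longrightarrow> \<phi> w = 0" "\<phi> e = 1"
proof -
  obtain f where f: "linear f" "\<And>x. f x \<le> infdist x W" "f e = infdist e W"
    by (rule Hahn_Banach_sublinear[OF sublinear_infdist[OF W(1)], of e]) blast
  have fe: "f e > 0"
    using W e f(3) complex_vector.subspace_0[OF W(1)]
    by (metis infdist_pos_not_in_closed empty_iff)
  have f0: "f w = 0" if "w \<in> W" for w
    using f(2)[of w] f(2)[of "- w"] that complex_vector.subspace_neg[OF W(1) that] linear_neg[OF f(1), of w] by simp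
  have fn: "\<bar>f x\<bar> \<le> norm x" for x
  proof -
    have "infdist x W \<le> norm x" for x
      using infdist_le[of 0 W x] complex_vector.subspace_0[OF W(1)] by simp
    then show ?thesis
      using f(2)[of x] f(2)[of "- x"] linear_neg[OF f(1), of x] by (smt (verit) norm_minus_cancel)
  qed
  \<comment> \<open>The usual complexification f x - i f (i x) of a real functional.\<close>
  define g where "g x = Complex (f x) (- f (\<i> *\<^sub>C x))" for x
  have g_add: "g (x + y) = g x + g y" for x y
    using f(1) by (simp add: g_def complex_eq_iff linear_add scaleC_add_right)
  have gR: "g (r *\<^sub>R x) = of_real r * g x" for r x
  proof -
    have "\<i> *\<^sub>C r *\<^sub>R x = r *\<^sub>R \<i> *\<^sub>C x"
      by (simp add: scaleC_of_real[symmetric] scaleC_scaleC mult.commute)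
    then show ?thesis using f(1) by (simp add: g_def complex_eq_iff linear_cmul)
  qed
  have gi: "g (\<i> *\<^sub>C x) = \<i> * g x" for x
    using linear_neg[OF f(1)] by (simp add: g_def complex_eq_iff scaleC_scaleC)
  have gC: "g (c *\<^sub>C x) = c * g x" for c x
  proof -
    have "c *\<^sub>C x = Re c *\<^sub>R x + Im c *\<^sub>R \<i> *\<^sub>C x"
      by (subst complex_eq[of c]) (simp only: scaleC_add_left scaleC_of_real[symmetric] scaleC_scaleC mult.commute)
    then have "g (c *\<^sub>C x) = of_real (Re c) * g x + of_real (Im c) * (\<i> * g x)"
      by (simp add: g_add gR gi)
    also have "\<dots> = (of_real (Re c) + \<i> * of_real (Im c)) * g x" by (simp add: algebra_simps)
    finally show ?thesis by (simp add: complex_eq[symmetric])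
  qed
  have gn: "norm (g x) \<le> norm x * 2" for x
  proof -
    have "norm (g x) \<le> \<bar>f x\<bar> + \<bar>f (\<i> *\<^sub>C x)\<bar>" using cmod_le[of "g x"] by (simp add: g_def)
    then show ?thesis using fn[of x] fn[of "\<i> *\<^sub>C x"] by (simp add: norm_scaleC)
  qed
  have ge: "g e \<noteq> 0" using fe by (simp add: g_def complex_eq_iff)
  have gb: "bounded_clinear g"
    by (unfold_locales) (auto simp: g_add gR gC scaleC_complex_def scaleR_conv_of_real intro!: exI[of _ 2] gn)
  define \<phi> where "\<phi> x = g x * inverse (g e)" for x
  have "bounded_linear \<phi>"
    unfolding \<phi>_def using bounded_linear_mult_left bounded_clinear.axioms(1)[OF gb]
    by (rule bounded_linear_compose)
  then have "bounded_clinear \<phi>"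
    by (simp add: bounded_clinear_def bounded_clinear_axioms_def) (simp add: \<phi>_def gC scaleC_complex_def)
  moreover have "\<phi> w = 0" if w: "w \<in> W" for w
  proof -
    have "\<i> *\<^sub>C w \<in> W" using complex_vector.subspace_scale[OF W(1) w] .
    then show ?thesis using f0 w by (simp add: \<phi>_def g_def complex_eq_iff)
  qed
  moreover have "\<phi> e = 1" using ge by (simp add: \<phi>_def)
  ultimately show ?thesis using that by blast
qed

lemma bounded_clinear_scale: "bounded_clinear (\<lambda>x. c *\<^sub>C x)"
proof
  show "c *\<^sub>C (x + y) = c *\<^sub>C x + c *\<^sub>C y" for x y :: 'a by (rule scaleC_add_right)
  show "c *\<^sub>C r *\<^sub>R x = r *\<^sub>R c *\<^sub>C x" for r and x :: 'a
    by (simp add: scaleC_of_real[symmetric] scaleC_scaleC mult.commute)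
  show "\<exists>K. \<forall>x::'a. norm (c *\<^sub>C x) \<le> norm x * K"
    by (intro exI[of _ "cmod c"]) (simp add: norm_scaleC mult.commute)
  show "c *\<^sub>C d *\<^sub>C x = d *\<^sub>C c *\<^sub>C x" for d and x :: 'a by (simp add: scaleC_scaleC mult.commute)
qed

lemma bounded_clinear_add:
  assumes "bounded_clinear f" "bounded_clinear g" shows "bounded_clinear (\<lambda>x. f x + g x)"
  using assms unfolding bounded_clinear_def bounded_clinear_axioms_def
  by (auto intro: bounded_linear_add simp: scaleC_add_right)

lemma bounded_clinear_diff:
  assumes "bounded_clinear f" "bounded_clinear g" shows "bounded_clinear (\<lambda>x. f x - g x)"
  using assms unfolding bounded_clinear_def bounded_clinear_axioms_def
  by (auto intro: bounded_linear_sub simp: complex_vector.scale_right_diff_distrib)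

lemma bounded_clinear_compose:
  assumes "bounded_clinear f" "bounded_clinear g" shows "bounded_clinear (\<lambda>x. f (g x))"
  using assms unfolding bounded_clinear_def bounded_clinear_axioms_def
  by (auto intro: bounded_linear_compose)

lemma bounded_clinear_ident: "bounded_clinear (\<lambda>x. x)"
  using bounded_clinear_scale[of 1] by simp

lemma bounded_clinear_zero: "bounded_clinear (\<lambda>x. 0)"
  by standard (auto intro: exI[of _ 0])

lemma bounded_clinear_scale_fixed:
  assumes "bounded_clinear \<phi>" shows "bounded_clinear (\<lambda>x. \<phi> x *\<^sub>C z)"
proof -
  interpret bounded_clinear \<phi> by fact
  obtain K where K: "\<And>x. norm (\<phi> x) \<le> norm x * K" using bounded by blast
  show ?thesis
  proof
    show "\<phi> (x + y) *\<^sub>C z = \<phi> x *\<^sub>C z + \<phi> y *\<^sub>C z" for x y by (simp add: add scaleC_add_left)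
    show "\<phi> (r *\<^sub>R x) *\<^sub>C z = r *\<^sub>R \<phi> x *\<^sub>C z" for r x
      unfolding scaleR scaleR_conv_of_real by (metis scaleC_scaleC scaleC_of_real)
    show "\<phi> (c *\<^sub>C x) *\<^sub>C z = c *\<^sub>C \<phi> x *\<^sub>C z" for c x
      unfolding scaleC scaleC_complex_def scaleC_scaleC ..
    show "\<exists>K. \<forall>x. norm (\<phi> x *\<^sub>C z) \<le> norm x * K"
      by (intro exI[of _ "K * norm z"]) (use K in \<open>auto simp: norm_scaleC mult.assoc[symmetric] intro!: mult_right_mono\<close>)
  qed
qed

text \<open>Built one vector at a time by adding a rank one correction. Two kinds of W occur later:
  {0}, to project onto part of a kernel, and the closed range of a Kato operator, to project onto
  vectors independent modulo it.\<close>

lemma projection_exists: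
  fixes v :: "nat \<Rightarrow> 'a::complex_normed_vector"
  assumes W: "csubspace W" "closed W" and v: "indep_mod W {..<n} v"
  obtains P where "bounded_clinear P" "\<And>x. x \<in> W \<Longrightarrow> P x = 0" "\<And>x. P x \<in> cspan (v ` {..<n})"
    "\<And>x. x \<in> cspan (v ` {..<n}) \<Longrightarrow> P x = x"
proof -
  have "\<exists>P. bounded_clinear P \<and> (\<forall>x\<in>W. P x = 0) \<and> (\<forall>x. P x \<in> cspan (v ` {..<n})) \<and>
     (\<forall>x\<in>cspan (v ` {..<n}). P x = x)"
    using v
  proof (induction n)
    case 0
    show ?case by (intro exI[of _ "\<lambda>_. 0"]) (simp add: bounded_clinear_zero)
  next
    case (Suc n)
    have "indep_mod W {..<n} v" using Suc.prems by (rule indep_mod_subset[rotated 2]) auto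
    then obtain P where P: "bounded_clinear P" "\<And>x. x \<in> W \<Longrightarrow> P x = 0"
        "\<And>x. P x \<in> cspan (v ` {..<n})" "\<And>x. x \<in> cspan (v ` {..<n}) \<Longrightarrow> P x = x"
      using Suc.IH by blast
    interpret P: bounded_clinear P by fact
    \<comment> \<open>The part of \<open>v n\<close> not yet reached. It lies outside W, since
      otherwise \<open>v n\<close> would be dependent on its predecessors modulo W.\<close>
    define z where "z = v n - P (v n)"
    have Pz: "P z = 0" using P(3,4) by (simp add: z_def P.diff)
    have "z \<notin> W"
    proof
      assume z: "z \<in> W"
      have sp: "P (v n) \<in> range (\<lambda>u. \<Sum>x\<in>v ` {..<n}. u x *\<^sub>C x)"
        using P(3)[of "v n"] complex_vector.span_finite[of "v ` {..<n}"] by simp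
      have inj: "inj_on v {..<n}"
      proof (rule inj_onI, rule ccontr)
        fix i j assume ij: "i \<in> {..<n}" "j \<in> {..<n}" "v i = v j" "i \<noteq> j"
        define a :: "nat \<Rightarrow> complex" where "a k = (if k = i then 1 else if k = j then -1 else 0)" for k
        have "(\<Sum>k<Suc n. a k *\<^sub>C v k) = (\<Sum>k\<in>{i,j}. a k *\<^sub>C v k)"
          using ij by (intro sum.mono_neutral_right) (auto simp: a_def)
        also have "\<dots> = 0" using ij by (simp add: a_def)
        finally have "a i = 0"
          using indep_modD[OF Suc.prems, of a i] ij complex_vector.subspace_0[OF W(1)] by simp
        then show False by (simp add: a_def)
      qed
      then obtain u where u: "P (v n) = (\<Sum>i<n. u (v i) *\<^sub>C v i)"
        using sp by (auto simp: sum.reindex)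
      define a where "a i = (if i = n then 1 else - u (v i))" for i
      have "(\<Sum>i<n. a i *\<^sub>C v i) = - P (v n)"
        unfolding u sum_negf[symmetric] by (rule sum.cong) (auto simp: a_def)
      then have "(\<Sum>i<Suc n. a i *\<^sub>C v i) = z" by (simp add: a_def z_def)
      then have "a n = 0" using indep_modD[OF Suc.prems, of a n] z by simp
      then show False by (simp add: a_def)
    qed
    then obtain \<phi> :: "'a \<Rightarrow> complex" where \<phi>: "bounded_clinear \<phi>" "\<And>w. w \<in> W \<Longrightarrow> \<phi> w = 0" "\<phi> z = 1"
      using Hahn_Banach_separation[OF W] by metis
    interpret \<phi>: bounded_clinear \<phi> by fact
    \<comment> \<open>On the old span \<open>x - P x\<close> vanishes, so Q = P there; at
      \<open>v n\<close> the correction is \<open>\<phi> z *\<^sub>C z = z\<close>, exactly what is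
      missing.\<close>
    define Q where "Q x = P x + \<phi> (x - P x) *\<^sub>C z" for x
    have Q: "bounded_clinear Q"
      unfolding Q_def
      by (intro bounded_clinear_add P bounded_clinear_scale_fixed[of "\<lambda>x. \<phi> (x - P x)"]
          bounded_clinear_compose[OF \<phi>(1)] bounded_clinear_diff bounded_clinear_ident)
    have sub: "cspan (v ` {..<n}) \<subseteq> cspan (v ` {..<Suc n})"
      by (intro complex_vector.span_mono) auto
    have zin: "z \<in> cspan (v ` {..<Suc n})"
      unfolding z_def using subsetD[OF sub P(3)]
      by (intro complex_vector.span_diff complex_vector.span_base[of "v n"]) auto
    have "Q x = 0" if "x \<in> W" for x using that P(2) \<phi>(2) by (simp add: Q_def)
    moreover have "Q x \<in> cspan (v ` {..<Suc n})" for x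
      unfolding Q_def using P(3) sub zin
      by (intro complex_vector.span_add complex_vector.span_scale) auto
    moreover have "Q x = x" if "x \<in> cspan (v ` {..<Suc n})" for x
      using that
    proof (induction rule: complex_vector.span_induct)
      case base
      show ?case
      proof (intro complex_vector.subspaceI CollectI)
        interpret Q: bounded_clinear Q by fact
        show "Q 0 = 0" by (rule Q.zero)
        show "x \<in> {x. Q x = x} \<Longrightarrow> y \<in> {x. Q x = x} \<Longrightarrow> Q (x + y) = x + y" for x y by (simp add: Q.add)
        show "x \<in> {x. Q x = x} \<Longrightarrow> Q (c *\<^sub>C x) = c *\<^sub>C x" for c x by (simp add: Q.scaleC)
      qed
    next
      case (step x)
      then obtain i where i: "x = v i" "i < Suc n" by auto
      show ?case
      proof (cases "i = n")
        case True
        then show ?thesis using i \<phi>(3) by (simp add: Q_def z_def[symmetric]) (simp add: z_def)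
      next
        case False
        then have "P x = x" using i by (intro P(4) complex_vector.span_base) auto
        then show ?thesis by (simp add: Q_def \<phi>.zero)
      qed
    qed
    ultimately show ?case using Q by blast
  qed
  then show ?thesis using that by blast
qed

section \<open>Open mappings and their perturbation\<close>

text \<open>Each remainder is again in Y and shrinks by the factor q, so the successive approximate
  solutions form an absolutely convergent series whose sum is an exact solution. The constant c / (1
  - q) is the sum of the geometric series.\<close>

lemma approx_surjective_imp_surjective:
  fixes f :: "'b::banach \<Rightarrow> 'c::real_normed_vector"
  assumes f: "bounded_linear f" and Z: "subspace Z" "closed Z" and Y: "subspace Y" "f ` Z \<subseteq> Y"
    and q: "0 \<le> q" "q < 1"
    and approx: "\<And>y. y \<in> Y \<Longrightarrow> \<exists>x\<in>Z. norm x \<le> c * norm y \<and> norm (y - f x) \<le> q * norm y"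
    and y: "y \<in> Y"
  shows "\<exists>x\<in>Z. f x = y \<and> norm x \<le> c / (1 - q) * norm y"
proof -
  interpret bounded_linear f by fact
  obtain g where g: "\<And>y. y \<in> Y \<Longrightarrow> g y \<in> Z"
      "\<And>y. y \<in> Y \<Longrightarrow> norm (g y) \<le> c * norm y"
      "\<And>y. y \<in> Y \<Longrightarrow> norm (y - f (g y)) \<le> q * norm y"
    using approx by metis
  have c: "0 \<le> c * norm y" using g(2)[OF y] norm_ge_zero order.trans by blast
  define r where "r n = ((\<lambda>y. y - f (g y)) ^^ n) y" for n
  have r0: "r 0 = y" and rS: "r (Suc n) = r n - f (g (r n))" for n by (simp_all add: r_def)
  have rY: "r n \<in> Y" for n
  proof (induction n)
    case (Suc n)
    then show ?case unfolding rS using g(1) Y by (intro subspace_diff) auto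
  qed (simp add: r0 y)
  have rn: "norm (r n) \<le> q ^ n * norm y" for n
  proof (induction n)
    case (Suc n)
    have "norm (r (Suc n)) \<le> q * norm (r n)" unfolding rS by (rule g(3)[OF rY])
    also have "\<dots> \<le> q * (q ^ n * norm y)" using Suc q by (intro mult_left_mono) auto
    finally show ?case by simp
  qed (simp add: r0)
  define x where "x n = g (r n)" for n
  have xn: "norm (x n) \<le> c * norm y * q ^ n" for n
  \<comment> \<open>Only \<open>0 \<le> c * norm y\<close> is known, so c is seen to be nonnegative
    only when y is nonzero.\<close>
  proof (cases "y = 0")
    case True
    then have "r n = 0" using rn[of n] by simp
    then show ?thesis using g(2)[OF rY, of n] True by (simp add: x_def)
  next
    case False
    then have "c \<ge> 0" using c by (simp add: zero_le_mult_iff)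
    have "norm (x n) \<le> c * norm (r n)" unfolding x_def by (rule g(2)[OF rY])
    also have "\<dots> \<le> c * (q ^ n * norm y)" using rn \<open>c \<ge> 0\<close> by (intro mult_left_mono)
    finally show ?thesis by (simp add: mult.assoc mult.commute[of "norm y"])
  qed
  have geo: "summable (\<lambda>n. c * norm y * q ^ n)"
    using q by (intro summable_mult summable_geometric) auto
  have sn: "summable (\<lambda>n. norm (x n))"
    by (rule summable_comparison_test[OF _ geo]) (use xn in auto)
  have sx: "summable x" using sn by (rule summable_norm_cancel)
  have "(\<Sum>n. x n) \<in> Z"
  proof (rule closed_sequentially[OF Z(2)])
    show "(\<lambda>n. \<Sum>i<n. x i) \<longlonglongrightarrow> (\<Sum>n. x n)" using sx by (rule summable_LIMSEQ)
    show "(\<Sum>i<n. x i) \<in> Z" for n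
      unfolding x_def using g(1) rY by (intro subspace_sum[OF Z(1)]) auto
  qed
  moreover have "f (\<Sum>n. x n) = y"
  proof -
    have "(\<lambda>n. q ^ n * norm y) \<longlonglongrightarrow> 0 * norm y"
      using q by (intro tendsto_mult_right LIMSEQ_power_zero) auto
    then have "r \<longlonglongrightarrow> 0"
      by (intro Lim_null_comparison[OF _ , of r "\<lambda>n. q ^ n * norm y"]) (use rn in auto)
    then have "(\<lambda>n. r n - r (Suc n)) sums (r 0 - 0)" by (rule telescope_sums')
    moreover have "(\<lambda>n. f (x n)) sums f (\<Sum>n. x n)" using sums[OF summable_sums[OF sx]] .
    moreover have "f (x n) = r n - r (Suc n)" for n by (simp add: rS x_def)
    ultimately show ?thesis using r0 sums_unique2 by (metis (no_types, lifting) diff_zero sums_cong)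
  qed
  moreover have "norm (\<Sum>n. x n) \<le> c / (1 - q) * norm y"
  proof -
    have "norm (\<Sum>n. x n) \<le> (\<Sum>n. norm (x n))" by (rule summable_norm[OF sn])
    also have "\<dots> \<le> (\<Sum>n. c * norm y * q ^ n)" by (rule suminf_le[OF xn sn geo])
    also have "\<dots> = c * norm y * (1 / (1 - q))"
      using q by (simp add: suminf_mult suminf_geometric summable_geometric)
    finally show ?thesis by (simp add: field_simps)
  qed
  ultimately show ?thesis by blast
qed

text \<open>Surjectivity of f from Z onto Y with a bound on preimages. Positivity of c is included
  because 1 / c serves as the admissible size of perturbations.\<close>

definition lifts :: "('b::real_normed_vector \<Rightarrow> 'c::real_normed_vector) \<Rightarrow> 'b set \<Rightarrow> 'c set \<Rightarrow> real \<Rightarrow> bool"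
  where "lifts f Z Y c \<longleftrightarrow> c > 0 \<and> (\<forall>y\<in>Y. \<exists>x\<in>Z. f x = y \<and> norm x \<le> c * norm y)"

text \<open>Baire's theorem in Y, completely metrizable as a closed set, gives an image of a ball
  whose closure has interior in Y. Approximate solvability with q = 1/2 follows, and the iteration
  removes the closure.\<close>

theorem open_mapping_subspace:
  fixes f :: "'b::banach \<Rightarrow> 'c::banach"
  assumes f: "bounded_linear f" and Z: "subspace Z" "closed Z" and Y: "closed Y" "f ` Z = Y"
  obtains c where "lifts f Z Y c"
proof -
  interpret bounded_linear f by fact
  have sY: "subspace Y" using Z(1) linear_axioms Y(2) linear_subspace_image by blast
  define F where "F n = closure (f ` (Z \<inter> cball 0 (real n)))" for n
  have FY: "F n \<subseteq> Y" for n
    unfolding F_def using Y by (intro closure_minimal) auto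
  have un: "(\<Union>n. F n) = Y"
  proof
    show "Y \<subseteq> (\<Union>n. F n)"
    proof
      fix y assume "y \<in> Y"
      then obtain x where x: "x \<in> Z" "y = f x" using Y by auto
      obtain n where "norm x \<le> real n" using real_arch_simple by blast
      then have "y \<in> F n" using x closure_subset unfolding F_def by fastforce
      then show "y \<in> (\<Union>n. F n)" by blast
    qed
  qed (use FY in blast)
  have "\<exists>n. (top_of_set Y) interior_of (F n) \<noteq> {}"
  proof (rule ccontr)
    assume no: "\<not> ?thesis"
    have "(top_of_set Y) interior_of \<Union> (range F) = {}"
    proof (rule Baire_category_alt)
      have "completely_metrizable_space (top_of_set Y)"
        using Y(1) completely_metrizable_space_closedin completely_metrizable_space_euclidean
        by (metis closed_closedin)
      then show "completely_metrizable_space (top_of_set Y) \<or>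
         locally_compact_space (top_of_set Y) \<and> regular_space (top_of_set Y)" ..
      show "countable (range F)" by simp
      fix T assume "T \<in> range F"
      then obtain n where "T = F n" by blast
      then show "closedin (top_of_set Y) T \<and> top_of_set Y interior_of T = {}"
        using no FY[of n] by (auto simp: F_def closedin_closed_eq intro: closed_subset)
    qed
    then have "(top_of_set Y) interior_of (topspace (top_of_set Y)) = {}" using un by simp
    then have "Y = {}" by (simp only: interior_of_topspace) simp
    then show False using subspace_0[OF sY] by simp
  qed
  then obtain n y0 U where U: "openin (top_of_set Y) U" "y0 \<in> U" "U \<subseteq> F n"
    by (auto simp: interior_of_def)
  then obtain e where e: "e > 0" "ball y0 e \<inter> Y \<subseteq> F n"
    unfolding openin_contains_ball by (meson order.trans)
  have y0: "y0 \<in> Y" using U openin_imp_subset by blast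
  \<comment> \<open>Subtracting approximate preimages of \<open>y0 + y\<close> and \<open>y0\<close>
    moves the centre to the origin at the price of doubling the radius.\<close>
  have small: "y \<in> F (2 * n)" if y: "y \<in> Y" "norm y < e" for y
  proof -
    have "y0 + y \<in> F n" "y0 \<in> F n"
      using e y y0 subspace_add[OF sY y0 y(1)] by (auto simp: dist_norm)
    show ?thesis
      unfolding F_def closure_approachable
    proof (intro allI impI)
      fix d :: real assume d: "d > 0"
      obtain a b where ab: "a \<in> Z" "norm a \<le> n" "dist (f a) (y0 + y) < d/2"
          "b \<in> Z" "norm b \<le> n" "dist (f b) y0 < d/2"
        using \<open>y0 + y \<in> F n\<close> \<open>y0 \<in> F n\<close> half_gt_zero[OF d]
        unfolding F_def closure_approachable by (auto dest!: spec[of _ "d/2"])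
      have "a - b \<in> Z \<inter> cball 0 (real (2 * n))"
        using ab subspace_diff[OF Z(1)] norm_triangle_ineq4[of a b] by auto
      moreover have "f (a - b) - y = (f a - (y0 + y)) - (f b - y0)" by (simp add: diff)
      then have "dist (f (a - b)) y < d"
        using ab(3,6) norm_triangle_ineq4[of "f a - (y0 + y)" "f b - y0"]
        by (simp only: dist_norm)
      ultimately show "\<exists>z\<in>f ` (Z \<inter> cball 0 (real (2 * n))). dist z y < d" by blast
    qed
  qed
  \<comment> \<open>Scaling y to norm e / 2, lifting with norm at most 2 n and scaling back costs 4
    n / e; the added 1 keeps c positive for n = 0.\<close>
  define c where "c = 4 * (real n + 1) / e"
  have approx: "\<exists>x\<in>Z. norm x \<le> c * norm y \<and> norm (y - f x) \<le> (1/2) * norm y" if y: "y \<in> Y" for y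
  proof (cases "y = 0")
    case True
    then show ?thesis using subspace_0[OF Z(1)] by (intro bexI[of _ 0]) (auto simp: zero)
  next
    case False
    define t where "t = e / (2 * norm y)"
    have t: "t > 0" using e False by (simp add: t_def)
    have "t *\<^sub>R y \<in> F (2 * n)"
      using y e False subspace_scale[OF sY y, of t] t by (intro small) (auto simp: t_def)
    moreover have "t * norm y / 2 > 0" using t False by simp
    ultimately have "\<exists>z\<in>f ` (Z \<inter> cball 0 (real (2 * n))). dist z (t *\<^sub>R y) < t * norm y / 2"
      unfolding F_def closure_approachable by blast
    then obtain x where x: "x \<in> Z" "norm x \<le> real (2 * n)" "dist (f x) (t *\<^sub>R y) < t * norm y / 2"
      by auto
    let ?x = "inverse t *\<^sub>R x"
    have "norm ?x \<le> c * norm y"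
    proof -
      have "norm ?x \<le> inverse t * real (2 * n)" using x t by simp
      also have "\<dots> \<le> c * norm y" using e False by (simp add: t_def c_def field_simps)
      finally show ?thesis .
    qed
    moreover have "norm (y - f ?x) \<le> (1/2) * norm y"
    proof -
      have "y - f ?x = - (inverse t *\<^sub>R (f x - t *\<^sub>R y))" using t by (simp add: scaleR algebra_simps)
      then have "norm (y - f ?x) = inverse t * dist (f x) (t *\<^sub>R y)" using t by (simp add: dist_norm)
      also have "\<dots> \<le> inverse t * (t * norm y / 2)" using x t by (intro mult_left_mono) auto
      also have "\<dots> = (1/2) * norm y" using t by simp
      finally show ?thesis .
    qed
    moreover have "?x \<in> Z" using subspace_scale[OF Z(1) x(1)] .
    ultimately show ?thesis by blast
  qed
  have "lifts f Z Y (c / (1 - 1/2))"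
    unfolding lifts_def
  proof (intro conjI ballI)
    show "0 < c / (1 - 1/2)" using e by (simp add: c_def)
    show "\<exists>x\<in>Z. f x = y \<and> norm x \<le> c / (1 - 1/2) * norm y" if "y \<in> Y" for y
      by (rule approx_surjective_imp_surjective[OF f Z sY _ _ _ approx that]) (use Y in auto)
  qed
  then show ?thesis by (rule that)
qed

text \<open>An exact solution of f x = y is an approximate one for f - g: the remainder is g x, of
  norm at most c * k times that of y. So the iteration runs with q = c * k.\<close>

lemma lifts_perturb:
  fixes f g :: "'b::banach \<Rightarrow> 'c::banach"
  assumes f: "bounded_linear f" and g: "bounded_linear g" and Z: "subspace Z" "closed Z"
    and Y: "subspace Y" "f ` Z \<subseteq> Y" "g ` Z \<subseteq> Y" and c: "lifts f Z Y c"
    and k: "\<And>x. x \<in> Z \<Longrightarrow> norm (g x) \<le> k * norm x" "0 \<le> k" "c * k < 1"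
  shows "lifts (\<lambda>x. f x - g x) Z Y (c / (1 - c * k))"
  unfolding lifts_def
proof (intro conjI ballI)
  have c0: "c > 0" using c by (simp add: lifts_def)
  then show "0 < c / (1 - c * k)" using k by simp
  have approx: "\<exists>x\<in>Z. norm x \<le> c * norm y \<and> norm (y - (f x - g x)) \<le> (c * k) * norm y" if "y \<in> Y" for y
  proof -
    obtain x where x: "x \<in> Z" "f x = y" "norm x \<le> c * norm y"
      using c \<open>y \<in> Y\<close> by (auto simp: lifts_def)
    have "norm (g x) \<le> k * (c * norm y)"
      using k(1)[OF x(1)] mult_left_mono[OF x(3) k(2)] by linarith
    then show ?thesis using x by (intro bexI[of _ x]) (auto simp: algebra_simps)
  qed
  show "\<exists>x\<in>Z. f x - g x = y \<and> norm x \<le> c / (1 - c * k) * norm y" if "y \<in> Y" for y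
  proof (rule approx_surjective_imp_surjective[OF _ Z Y(1) _ _ k(3) approx that])
    show "bounded_linear (\<lambda>x. f x - g x)" using f g by (rule bounded_linear_sub)
    show "(\<lambda>x. f x - g x) ` Z \<subseteq> Y" using subspace_diff[OF Y(1)] Y(2,3) by blast
    show "0 \<le> c * k" using c0 k by simp
  qed
qed

lemma lifts_inj:
  assumes "lifts f Z Y c" "linear f" "subspace Z" "f ` Z \<subseteq> Y" "\<And>x. x \<in> Z \<Longrightarrow> f x = 0 \<Longrightarrow> x = 0" "x \<in> Z"
  shows "norm x \<le> c * norm (f x)"
proof -
  obtain z where z: "z \<in> Z" "f z = f x" "norm z \<le> c * norm (f x)"
    using assms(1,4,6) unfolding lifts_def by blast
  have "f (z - x) = 0" using z linear_diff[OF assms(2)] by simp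
  then have "z - x = 0" using z assms subspace_diff by blast
  then show ?thesis using z by simp
qed

section \<open>Stability of the index\<close>

abbreviation shifted :: "('a::complex_normed_vector \<Rightarrow> 'a) \<Rightarrow> complex \<Rightarrow> 'a \<Rightarrow> 'a"
  where "shifted S \<mu> \<equiv> \<lambda>x. S x - \<mu> *\<^sub>C x"

definition operator_on :: "'a::complex_banach set \<Rightarrow> ('a \<Rightarrow> 'a) \<Rightarrow> bool"
  where "operator_on Y A \<longleftrightarrow> bounded_clinear A \<and> csubspace Y \<and> closed Y \<and> A ` Y \<subseteq> Y"

abbreviation nul :: "'a::complex_normed_vector set \<Rightarrow> ('a \<Rightarrow> 'a) \<Rightarrow> enat"
  where "nul Y A \<equiv> qdim (kernel_on Y A) {0}"

abbreviation dfc :: "'a::complex_normed_vector set \<Rightarrow> ('a \<Rightarrow> 'a) \<Rightarrow> enat"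
  where "dfc Y A \<equiv> qdim Y (A ` Y)"

lemma csubspace_imp_subspace: "csubspace W \<Longrightarrow> subspace W"
  by (simp add: subspace_def complex_vector.subspace_0 complex_vector.subspace_add csubspace_scaleR)

lemma bounded_clinear_shifted: "bounded_clinear A \<Longrightarrow> bounded_clinear (shifted A \<mu>)"
  by (intro bounded_clinear_diff bounded_clinear_scale)

lemma bounded_clinear_funpow:
  fixes A :: "'a::complex_normed_vector \<Rightarrow> 'a"
  shows "bounded_clinear A \<Longrightarrow> bounded_clinear (A ^^ n)"
proof (induction n)
  case 0
  then show ?case using bounded_clinear_ident by (simp add: id_def)
next
  case (Suc n)
  then show ?case using bounded_clinear_compose[of A "A ^^ n"] by (simp add: o_def)
qed

lemma csubspace_image: "bounded_clinear A \<Longrightarrow> csubspace Y \<Longrightarrow> csubspace (A ` Y)"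
proof -
  assume "bounded_clinear A" and Y: "csubspace Y"
  then interpret bounded_clinear A by simp
  show ?thesis
  proof (rule complex_vector.subspaceI)
    show "0 \<in> A ` Y" using zero complex_vector.subspace_0[OF Y] by (metis imageI)
    show "x + y \<in> A ` Y" if "x \<in> A ` Y" "y \<in> A ` Y" for x y
      using that complex_vector.subspace_add[OF Y] by (auto simp: add[symmetric])
    show "c *\<^sub>C x \<in> A ` Y" if "x \<in> A ` Y" for c x
      using that complex_vector.subspace_scale[OF Y] by (auto simp: scaleC[symmetric])
  qed
qed

lemma csubspace_kernel_on: "bounded_clinear A \<Longrightarrow> csubspace Y \<Longrightarrow> csubspace (kernel_on Y A)"
proof -
  assume "bounded_clinear A" and Y: "csubspace Y"
  then interpret bounded_clinear A by simp
  show ?thesis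
    using Y by (auto intro!: complex_vector.subspaceI simp: kernel_on_def zero add scaleC
        complex_vector.subspace_0 complex_vector.subspace_add complex_vector.subspace_scale)
qed

lemma closed_kernel_on: "bounded_clinear A \<Longrightarrow> closed Y \<Longrightarrow> closed (kernel_on Y A)"
proof -
  assume "bounded_clinear A" and Y: "closed Y"
  then interpret bounded_clinear A by simp
  have "closed (Y \<inter> {x. A x = 0})"
    using Y by (intro closed_Int closed_Collect_eq continuous_intros continuous_on) auto
  then show ?thesis by (simp add: kernel_on_def Collect_conj_eq)
qed

lemma kernel_on_subset: "kernel_on Y A \<subseteq> Y"
  by (auto simp: kernel_on_def)

lemma operator_on_shifted: "operator_on Y A \<Longrightarrow> operator_on Y (shifted A \<mu>)"
  by (auto simp: operator_on_def bounded_clinear_shifted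
      intro!: complex_vector.subspace_diff complex_vector.subspace_scale)

lemma shifted_shifted: "shifted (shifted A \<mu>) \<nu> = shifted A (\<mu> + \<nu>)"
  by (simp add: scaleC_add_left algebra_simps fun_eq_iff)

lemma funpow_Suc_image:
  fixes A :: "'a \<Rightarrow> 'a"
  shows "(A ^^ Suc n) ` Y = A ` (A ^^ n) ` Y" "(A ^^ Suc n) ` Y = (A ^^ n) ` A ` Y"
  by (simp add: image_comp) (simp only: image_comp funpow_Suc_right)

lemma funpow_image_subset: "A ` Y \<subseteq> Y \<Longrightarrow> (A ^^ n) ` Y \<subseteq> Y"
  by (induction n) (auto simp: image_subset_iff)

lemma funpow_image_decreasing:
  assumes "A ` Y \<subseteq> Y" "m \<le> n" shows "(A ^^ n) ` Y \<subseteq> (A ^^ m) ` Y"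
proof -
  have "(A ^^ n) ` Y = (A ^^ m) ` (A ^^ (n - m)) ` Y"
    unfolding image_comp funpow_add[symmetric] using assms(2) by simp
  then show ?thesis using image_mono[OF funpow_image_subset[OF assms(1), of "n - m"], of "A ^^ m"] by simp
qed

lemma fredholm_on_iff:
  assumes "operator_on Y A"
  shows "fredholm_on Y A \<longleftrightarrow> nul Y A \<noteq> \<infinity> \<and> dfc Y A \<noteq> \<infinity>"
  using assms unfolding fredholm_on_def operator_on_def
  by (simp add: cfinite_dim_iff_qdim cfinite_codim_iff_qdim csubspace_image csubspace_kernel_on)

lemma weyl_on_iff:
  assumes "operator_on Y A"
  shows "weyl_on Y A \<longleftrightarrow> fredholm_on Y A \<and> nul Y A = dfc Y A"
proof -
  have "enat (cdim (kernel_on Y A)) = nul Y A \<and> enat (ccodim Y (A ` Y)) = dfc Y A" if "fredholm_on Y A"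
    using that assms fredholm_on_iff[OF assms] unfolding operator_on_def
    by (simp add: cdim_eq_qdim ccodim_eq_qdim csubspace_image csubspace_kernel_on)
  then show ?thesis unfolding weyl_on_def using enat.inject by metis
qed

text \<open>The span is the set of fixed points of a bounded projection.\<close>

lemma closed_span_indep:
  fixes v :: "nat \<Rightarrow> 'a::complex_normed_vector"
  assumes "indep_mod {0} {..<n} v" shows "closed (cspan (v ` {..<n}))"
proof -
  obtain P where P: "bounded_clinear P" "\<And>x. P x \<in> cspan (v ` {..<n})"
      "\<And>x. x \<in> cspan (v ` {..<n}) \<Longrightarrow> P x = x"
    using projection_exists[OF complex_vector.subspace_single_0 closed_singleton assms] by metis
  interpret P: bounded_clinear P by fact
  have "cspan (v ` {..<n}) = {x. P x = x}" using P(2,3) by (auto intro: back_subst[of "\<lambda>x. x \<in> cspan (v ` {..<n})"])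
  moreover have "closed {x. P x = x}"
    by (intro closed_Collect_eq continuous_intros P.continuous_on)
  ultimately show ?thesis by simp
qed

lemma bounded_linear_sum_pair:
  assumes "bounded_linear A" shows "bounded_linear (\<lambda>z. A (fst z) + snd z)"
  by (intro bounded_linear_add bounded_linear_compose[OF assms] bounded_linear_fst bounded_linear_snd)

lemma subspace_Times: "subspace Y \<Longrightarrow> subspace C \<Longrightarrow> subspace (Y \<times> C)"
  by (auto simp: subspace_def zero_prod_def)

text \<open>Lifting \<open>y\<close> in the closure of \<open>f ` Y\<close> along \<open>(x, c) \<mapsto> f x + c\<close> separates its component in
  the complement \<open>C\<close> continuously.\<close>

lemma closed_image_finite_codim:
  fixes f :: "'a::complex_banach \<Rightarrow> 'a"
  assumes f: "bounded_clinear f" and Y: "csubspace Y" "closed Y" "f ` Y \<subseteq> Y"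
    and fin: "qdim Y (f ` Y) \<noteq> \<infinity>"
  shows "closed (f ` Y)"
proof -
  interpret f: bounded_clinear f by fact
  obtain n where n: "qdim Y (f ` Y) = enat n" using fin by auto
  have fY: "csubspace (f ` Y)" using csubspace_image[OF f Y(1)] .
  obtain v where v: "v ` {..<n} \<subseteq> Y" "indep_mod (f ` Y) {..<n} v"
      "direct_sum Y (f ` Y) (cspan (v ` {..<n}))"
    using complement_exists[OF Y(1) fY Y(3) n] .
  define C where "C = cspan (v ` {..<n})"
  have "indep_mod {0} {..<n} v"
    using v(2) complex_vector.subspace_0[OF fY] by (elim indep_mod_mono) auto
  then have Cc: "closed C" unfolding C_def by (rule closed_span_indep)
  have C: "csubspace C" "f ` Y \<inter> C = {0}"
    using v(3) by (auto simp: direct_sum_def C_def)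
  have CY: "C \<subseteq> Y" unfolding C_def using v(1) Y(1) by (rule complex_vector.span_minimal)
  have split: "\<exists>x\<in>Y. \<exists>c\<in>C. y = f x + c" if "y \<in> Y" for y
    using v(3) that unfolding direct_sum_def C_def[symmetric] by blast
  let ?g = "\<lambda>z. f (fst z) + snd z"
  have im: "?g ` (Y \<times> C) = Y"
  proof
    show "?g ` (Y \<times> C) \<subseteq> Y"
      using Y(3) CY by (auto intro!: complex_vector.subspace_add[OF Y(1)])
    show "Y \<subseteq> ?g ` (Y \<times> C)"
    proof
      fix y assume "y \<in> Y"
      then obtain x c where "x \<in> Y" "c \<in> C" "y = f x + c" using split by blast
      then show "y \<in> ?g ` (Y \<times> C)" by (intro image_eqI[of _ _ "(x, c)"]) auto
    qed
  qed
  obtain K where K: "lifts ?g (Y \<times> C) Y K"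
    by (rule open_mapping_subspace[OF bounded_linear_sum_pair[OF f.bounded_linear_axioms] _ _ Y(2) im])
      (auto intro: subspace_Times csubspace_imp_subspace Y C(1) closed_Times Cc)
  show ?thesis
    unfolding closed_sequential_limits
  proof (intro allI impI, elim conjE)
    fix y l assume y: "\<forall>n. y n \<in> f ` Y" "y \<longlonglongrightarrow> l"
    have "l \<in> Y" using y Y by (metis closed_sequentially subsetD)
    then obtain x c where xc: "x \<in> Y" "c \<in> C" "l = f x + c" using split by blast
    have "\<exists>u d. u \<in> Y \<and> d \<in> C \<and> f u + d = y n - l \<and> norm (u, d) \<le> K * norm (y n - l)" for n
    proof -
      have "y n - l \<in> Y" using y(1) \<open>l \<in> Y\<close> Y complex_vector.subspace_diff by blast
      then obtain z where "z \<in> Y \<times> C" "?g z = y n - l" "norm z \<le> K * norm (y n - l)"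
        using K unfolding lifts_def by blast
      then show ?thesis by (intro exI[of _ "fst z"] exI[of _ "snd z"]) auto
    qed
    then obtain u d where ud: "\<And>n. u n \<in> Y" "\<And>n. d n \<in> C" "\<And>n. f (u n) + d n = y n - l"
        "\<And>n. norm (u n, d n) \<le> K * norm (y n - l)"
      by metis
    have "d n = - c" for n
    proof -
      obtain x' where x': "x' \<in> Y" "y n = f x'" using y(1) by auto
      have "d n + c = f (x' - x - u n)" using ud(3)[of n] x' xc by (simp add: f.diff) (simp add: algebra_simps)
      moreover have "x' - x - u n \<in> Y" using x' xc ud Y(1) by (intro complex_vector.subspace_diff)
      moreover have "d n + c \<in> C" using ud xc C(1) by (intro complex_vector.subspace_add)
      ultimately have "d n + c \<in> f ` Y \<inter> C" by auto
      then show ?thesis using C(2) by (simp add: eq_neg_iff_add_eq_0)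
    qed
    then have "norm c \<le> K * norm (y n - l)" for n
      using ud(4)[of n] norm_snd_le[of "d n" "u n"] by simp
    moreover have "(\<lambda>n. K * norm (y n - l)) \<longlonglongrightarrow> 0"
    proof -
      have "(\<lambda>n. y n - l) \<longlonglongrightarrow> l - l" using y(2) by (intro tendsto_intros)
      then have "(\<lambda>n. norm (y n - l)) \<longlonglongrightarrow> 0" by (simp add: tendsto_norm_zero)
      then show ?thesis by (rule tendsto_mult_right_zero)
    qed
    ultimately have "norm c \<le> 0" by (intro LIMSEQ_le_const) auto
    then show "l \<in> f ` Y" using xc by simp
  qed
qed

lemma subspace_sum_commute: "subspace_sum M N = subspace_sum N M"
  by (auto simp: subspace_sum_def) (metis add.commute)+

text \<open>With K the kernel of B, the chains \<open>B\<close> Y0 \<subseteq> B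
  \<open>Y \<subseteq> Y\<close> and \<open>Y0 \<subseteq> Y0 + K \<subseteq> Y\<close> share one
  defect k. Thus the dimensions of C and N, which come from an unperturbed operator, exceed
  deficiency and nullity of B by the same amount.\<close>

lemma index_algebra:
  assumes B: "bounded_clinear B" and Y: "csubspace Y" "B ` Y \<subseteq> Y"
    and Y0: "csubspace Y0" "csubspace N" "Y = subspace_sum N Y0" "N \<inter> Y0 = {0}"
    and inj: "\<And>x. x \<in> Y0 \<Longrightarrow> B x = 0 \<Longrightarrow> x = 0" and C: "direct_sum Y (B ` Y0) C"
  obtains k where "qdim C {0} = dfc Y B + k" "qdim N {0} = nul Y B + k"
proof -
  interpret B: bounded_clinear B by fact
  define K where "K = kernel_on Y B"
  have K: "csubspace K" unfolding K_def by (rule csubspace_kernel_on[OF B Y(1)])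
  have KY: "K \<subseteq> Y" unfolding K_def by (rule kernel_on_subset)
  have Y0Y: "Y0 \<subseteq> Y" unfolding Y0(3) by (rule subspace_sum_superset2[OF Y0(2)])
  define k where "k = qdim Y (subspace_sum Y0 K)"
  \<comment> \<open>This identity makes the codimension of \<open>B\<close> Y0\<open>in\<close>B
    \<open>Y\<close> equal to that of Y0 + K in Y.\<close>
  have pre: "Y \<inter> B -` (B ` Y0) = subspace_sum Y0 K"
  proof
    show "Y \<inter> B -` (B ` Y0) \<subseteq> subspace_sum Y0 K"
    proof
      fix y assume "y \<in> Y \<inter> B -` (B ` Y0)"
      then obtain x where x: "y \<in> Y" "x \<in> Y0" "B y = B x" by auto
      then have "y - x \<in> K"
        using Y0Y complex_vector.subspace_diff[OF Y(1)] by (auto simp: K_def kernel_on_def B.diff)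
      then show "y \<in> subspace_sum Y0 K" using subspace_sum_memI[OF x(2), of "y - x"] by simp
    qed
    show "subspace_sum Y0 K \<subseteq> Y \<inter> B -` (B ` Y0)"
      using Y0Y complex_vector.subspace_add[OF Y(1)]
      by (auto simp: subspace_sum_def K_def kernel_on_def B.add)
  qed
  have "qdim (B ` Y) (B ` Y0) = k"
    using qdim_Int[OF Y(1), of "B -` (B ` Y0)"] pre by (simp add: qdim_image[OF B] k_def)
  moreover have "qdim Y (B ` Y0) = qdim Y (B ` Y) + qdim (B ` Y) (B ` Y0)"
    using Y Y0 Y0Y by (intro qdim_add csubspace_image B) auto
  moreover have "qdim Y (B ` Y0) = qdim C {0}" by (rule qdim_direct_sum[OF C])
  ultimately have 1: "qdim C {0} = dfc Y B + k" by simp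
  have "direct_sum Y Y0 N"
    using Y0 by (auto simp: direct_sum_def subspace_sum_def) (metis add.commute)+
  then have "qdim N {0} = qdim Y Y0" by (rule qdim_direct_sum[symmetric])
  also have "\<dots> = k + qdim (subspace_sum Y0 K) Y0"
    unfolding k_def using Y0 Y K pre
    by (intro qdim_add csubspace_subspace_sum subspace_sum_superset1) auto
  also have "qdim (subspace_sum Y0 K) Y0 = qdim K Y0"
    by (subst subspace_sum_commute) (rule qdim_subspace_sum[OF Y0(1) Y0(1) order.refl])
  also have "\<dots> = qdim K (K \<inter> Y0)" by (rule qdim_Int[OF K, symmetric])
  also have "K \<inter> Y0 = {0}"
    using inj complex_vector.subspace_0[OF K] complex_vector.subspace_0[OF Y0(1)]
    by (auto simp: K_def kernel_on_def)
  finally have 2: "qdim N {0} = nul Y B + k" by (simp add: K_def add.commute)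
  show ?thesis using that[OF 1 2] .
qed

lemma kernel_basis:
  assumes K: "csubspace K" and n: "qdim K {0} = enat n"
  obtains v where "indep_mod {0} {..<n} v" "K = cspan (v ` {..<n})"
proof -
  obtain v where v: "v ` {..<n} \<subseteq> K" "indep_mod {0} {..<n} v" "K \<subseteq> subspace_sum {0} (cspan (v ` {..<n}))"
    using qdim_basis[OF complex_vector.subspace_single_0 n] .
  have "K \<subseteq> cspan (v ` {..<n})" using v(3) by (auto simp: subspace_sum_def)
  then show ?thesis using that[OF v(2)] complex_vector.span_minimal[OF v(1) K] by blast
qed

text \<open>Let Y0 complement the kernel and C complement the range. Then (x, c) \<mapsto> A x + c
  is a bijection from Y0 \<times> C onto Y with bounded inverse, and it stays one when A is replaced
  by A - \<mu>. So C and Y0 keep their roles for A - \<mu>, and its index is read off from the fixed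
  spaces N and C.\<close>

theorem fredholm_stable:
  assumes op: "operator_on Y A" and fr: "fredholm_on Y A"
  obtains e where "e > 0" "\<And>\<mu>. cmod \<mu> < e \<Longrightarrow>
    nul Y (shifted A \<mu>) \<le> nul Y A \<and> dfc Y (shifted A \<mu>) \<le> dfc Y A \<and>
    nul Y (shifted A \<mu>) + dfc Y A = nul Y A + dfc Y (shifted A \<mu>)"
proof -
  have A: "bounded_clinear A" and Y: "csubspace Y" "closed Y" "A ` Y \<subseteq> Y"
    using op by (auto simp: operator_on_def)
  interpret A: bounded_clinear A by fact
  have AY: "csubspace (A ` Y)" using csubspace_image[OF A Y(1)] .
  define N where "N = kernel_on Y A"
  have N: "csubspace N" "N \<subseteq> Y"
    unfolding N_def by (rule csubspace_kernel_on[OF A Y(1)], rule kernel_on_subset)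
  obtain n d where nd: "qdim N {0} = enat n" "qdim Y (A ` Y) = enat d"
    using fr fredholm_on_iff[OF op] unfolding N_def by auto
  obtain v where v: "indep_mod {0} {..<n} v" "N = cspan (v ` {..<n})"
    using kernel_basis[OF N(1) nd(1)] .
  obtain P where P: "bounded_clinear P" "\<And>x. P x \<in> N" "\<And>x. x \<in> N \<Longrightarrow> P x = x"
    using projection_exists[OF complex_vector.subspace_single_0 closed_singleton v(1)] v(2) by metis
  interpret P: bounded_clinear P by fact
  define Y0 where "Y0 = kernel_on Y P"
  have Y0: "csubspace Y0" "closed Y0" "Y0 \<subseteq> Y"
    unfolding Y0_def using csubspace_kernel_on[OF P(1) Y(1)] closed_kernel_on[OF P(1) Y(2)] kernel_on_subset
    by auto
  have Ysum: "Y = subspace_sum N Y0"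
  proof
    show "Y \<subseteq> subspace_sum N Y0"
    proof
      fix y assume y: "y \<in> Y"
      have "P (y - P y) = 0" using P(2)[of y] by (simp add: P.diff P(3))
      then have "y - P y \<in> Y0"
        using y P(2) N(2) complex_vector.subspace_diff[OF Y(1) y, of "P y"] by (auto simp: Y0_def kernel_on_def)
      then show "y \<in> subspace_sum N Y0" using subspace_sum_memI[OF P(2)[of y], of "y - P y"] by simp
    qed
    show "subspace_sum N Y0 \<subseteq> Y"
      using N(2) Y0(3) complex_vector.subspace_add[OF Y(1)] by (auto simp: subspace_sum_def)
  qed
  have NY0: "N \<inter> Y0 = {0}"
    using P(3) complex_vector.subspace_0[OF N(1)] complex_vector.subspace_0[OF Y0(1)]
    by (auto simp: Y0_def kernel_on_def)
  obtain w where w: "w ` {..<d} \<subseteq> Y" "indep_mod (A ` Y) {..<d} w" "direct_sum Y (A ` Y) (cspan (w ` {..<d}))"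
    using complement_exists[OF Y(1) AY Y(3) nd(2)] .
  define C where "C = cspan (w ` {..<d})"
  have "indep_mod {0} {..<d} w"
    using w(2) complex_vector.subspace_0[OF AY] by (elim indep_mod_mono) auto
  then have Cc: "closed C" unfolding C_def by (rule closed_span_indep)
  have C: "csubspace C" "A ` Y \<inter> C = {0}"
    using w(3) by (auto simp: direct_sum_def C_def)
  have split: "\<exists>x\<in>Y. \<exists>c\<in>C. y = A x + c" if "y \<in> Y" for y
    using w(3) that unfolding direct_sum_def C_def[symmetric] by blast
  have CY: "C \<subseteq> Y" unfolding C_def using w(1) Y(1) by (rule complex_vector.span_minimal)
  define f where "f z = A (fst z) + snd z" for z
  define Z where "Z = Y0 \<times> C"
  have Z: "subspace Z" "closed Z"
    unfolding Z_def using Y0 C Cc by (auto intro: subspace_Times csubspace_imp_subspace closed_Times)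
  have f: "bounded_linear f"
    unfolding f_def[abs_def] by (rule bounded_linear_sum_pair[OF A.bounded_linear_axioms])
  have fZ: "f ` Z = Y"
  proof
    show "f ` Z \<subseteq> Y"
    proof
      fix y assume "y \<in> f ` Z"
      then obtain a b where "a \<in> Y0" "b \<in> C" "y = A a + b" by (auto simp: f_def Z_def)
      then show "y \<in> Y" using Y(3) Y0(3) CY complex_vector.subspace_add[OF Y(1)] by blast
    qed
    show "Y \<subseteq> f ` Z"
    proof
      fix y assume "y \<in> Y"
      then obtain x c where x: "x \<in> Y" "c \<in> C" "y = A x + c" using split by blast
      have "x \<in> subspace_sum N Y0" using x(1) Ysum by simp
      then obtain a b where ab: "a \<in> N" "b \<in> Y0" "x = a + b" by (auto simp: subspace_sum_def)
      have "A x = A b" using ab by (simp add: A.add N_def kernel_on_def)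
      then show "y \<in> f ` Z" using x ab by (intro image_eqI[of _ _ "(b, c)"]) (auto simp: f_def Z_def)
    qed
  qed
  have f_inj: "z = 0" if z: "z \<in> Z" "f z = 0" for z
  proof -
    obtain y c where yc: "z = (y, c)" "y \<in> Y0" "c \<in> C" using z by (auto simp: Z_def)
    have "A y \<in> C"
      using z(2) yc complex_vector.subspace_neg[OF C(1) yc(3)] by (simp add: f_def eq_neg_iff_add_eq_0[symmetric])
    then have "A y = 0" using C(2) yc Y0(3) by blast
    then have "y \<in> N" using yc Y0 by (auto simp: N_def kernel_on_def)
    then have "y = 0" using NY0 yc by blast
    then show ?thesis using z yc by (simp add: f_def A.zero zero_prod_def)
  qed
  obtain c where c: "lifts f Z Y c"
    by (rule open_mapping_subspace[OF f Z Y(2) fZ])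
  have c0: "c > 0" using c by (simp add: lifts_def)
  \<comment> \<open>The perturbation is \<mu> times the first component, of norm at most
    \<open>cmod \<mu>\<close>, so the lifting constant c of f allows
    \<open>cmod \<mu> < 1 / c\<close>.\<close>
  show ?thesis
  proof (rule that[of "1 / c"])
    show "1 / c > 0" using c0 by simp
    fix \<mu> assume mu: "cmod \<mu> < 1 / c"
    let ?B = "shifted A \<mu>"
    define g :: "'a \<times> 'a \<Rightarrow> 'a" where "g z = \<mu> *\<^sub>C fst z" for z
    have g: "bounded_linear g"
      unfolding g_def[abs_def]
      by (intro bounded_linear_compose[OF bounded_clinear.axioms(1)[OF bounded_clinear_scale]] bounded_linear_fst)
    have gn: "norm (g z) \<le> cmod \<mu> * norm z" for z
      using norm_fst_le[of "fst z" "snd z"] by (simp add: g_def norm_scaleC mult_left_mono)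
    have gZ: "g ` Z \<subseteq> Y" using Y0 complex_vector.subspace_scale[OF Y(1)] by (auto simp: g_def Z_def)
    have mc: "c * cmod \<mu> < 1" using mu c0 by (simp add: field_simps)
    have L: "lifts (\<lambda>z. f z - g z) Z Y (c / (1 - c * cmod \<mu>))"
      using fZ by (intro lifts_perturb[OF f g Z csubspace_imp_subspace[OF Y(1)] _ gZ c gn _ mc]) auto
    have fg: "f z - g z = ?B (fst z) + snd z" for z by (simp add: f_def g_def)
    have fg_inj: "z = 0" if z: "z \<in> Z" "f z - g z = 0" for z
    proof -
      have "norm z \<le> c * norm (f z)"
        using fZ by (intro lifts_inj[OF c bounded_linear.linear[OF f] Z(1) _ f_inj z(1)]) auto
      also have "\<dots> \<le> c * (cmod \<mu> * norm z)" using z gn[of z] c0 by (intro mult_left_mono) auto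
      finally have "(1 - c * cmod \<mu>) * norm z \<le> 0" by (simp add: algebra_simps)
      then show ?thesis using mc by (simp add: mult_le_0_iff)
    qed
    have op': "operator_on Y ?B" by (rule operator_on_shifted[OF op])
    then have B: "bounded_clinear ?B" "?B ` Y \<subseteq> Y" by (auto simp: operator_on_def)
    interpret B: bounded_clinear ?B by fact
    have inj: "x = 0" if "x \<in> Y0" "?B x = 0" for x
      using fg_inj[of "(x, 0)"] that complex_vector.subspace_0[OF C(1)] by (simp add: fg Z_def zero_prod_def)
    have "direct_sum Y (?B ` Y0) C"
      unfolding direct_sum_def
    proof (intro conjI)
      show "csubspace (?B ` Y0)" by (rule csubspace_image[OF B(1) Y0(1)])
      show "csubspace C" by fact
      show "?B ` Y0 \<inter> C = {0}"
      proof
        show "?B ` Y0 \<inter> C \<subseteq> {0}"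
        proof
          fix x assume "x \<in> ?B ` Y0 \<inter> C"
          then obtain y where y: "y \<in> Y0" "x = ?B y" "x \<in> C" by auto
          then have "(y, - x) = 0"
            using complex_vector.subspace_neg[OF C(1), of x] by (intro fg_inj) (auto simp: fg Z_def)
          then show "x \<in> {0}" by (simp add: zero_prod_def)
        qed
        show "{0} \<subseteq> ?B ` Y0 \<inter> C"
          using complex_vector.subspace_0[OF C(1)] complex_vector.subspace_0[OF csubspace_image[OF B(1) Y0(1)]] by auto
      qed
      show "Y = {m + n |m n. m \<in> ?B ` Y0 \<and> n \<in> C}"
      proof
        show "{m + n |m n. m \<in> ?B ` Y0 \<and> n \<in> C} \<subseteq> Y"
          using B(2) Y0(3) CY complex_vector.subspace_add[OF Y(1)] by blast
        show "Y \<subseteq> {m + n |m n. m \<in> ?B ` Y0 \<and> n \<in> C}"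
        proof
          fix y assume "y \<in> Y"
          then obtain z where z: "z \<in> Z" "f z - g z = y" using L unfolding lifts_def by blast
          then have "?B (fst z) \<in> ?B ` Y0" "snd z \<in> C" "y = ?B (fst z) + snd z"
            by (auto simp: fg Z_def)
          then show "y \<in> {m + n |m n. m \<in> ?B ` Y0 \<and> n \<in> C}" by blast
        qed
      qed
    qed
    then obtain k where k: "qdim C {0} = dfc Y ?B + k" "qdim N {0} = nul Y ?B + k"
      using index_algebra[OF B(1) Y(1) B(2) Y0(1) N(1) Ysum NY0 inj] by blast
    moreover have "qdim C {0} = dfc Y A"
      using qdim_direct_sum[OF w(3)] by (simp add: C_def)
    ultimately show "nul Y ?B \<le> nul Y A \<and> dfc Y ?B \<le> dfc Y A \<and>
        nul Y ?B + dfc Y A = nul Y A + dfc Y ?B"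
      by (simp add: N_def[symmetric] add_ac)
  qed
qed

section \<open>Kato operators\<close>

lemma operator_onD:
  assumes "operator_on Y A"
  shows "bounded_clinear A" "csubspace Y" "closed Y" "A ` Y \<subseteq> Y"
  using assms by (auto simp: operator_on_def)

lemma csubspace_funpow_image: "operator_on Y A \<Longrightarrow> csubspace ((A ^^ n) ` Y)"
  by (intro csubspace_image bounded_clinear_funpow operator_onD)

lemma operator_on_funpow_image:
  assumes "operator_on Y A" "closed ((A ^^ n) ` Y)" shows "operator_on ((A ^^ n) ` Y) A"
  unfolding operator_on_def
proof (intro conjI)
  show "A ` (A ^^ n) ` Y \<subseteq> (A ^^ n) ` Y"
    using funpow_image_decreasing[OF operator_onD(4)[OF assms(1)], of n "Suc n"]
    by (simp only: funpow_Suc_image le_SucI order.refl)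
qed (use assms csubspace_funpow_image operator_onD in blast)+

lemma kernel_on_subspace: "V \<subseteq> Y \<Longrightarrow> kernel_on V A = kernel_on Y A \<inter> V"
  by (auto simp: kernel_on_def)

lemma fredholm_on_image:
  assumes op: "operator_on Y A" and fr: "fredholm_on Y A"
  shows "operator_on (A ` Y) A" "fredholm_on (A ` Y) A"
    "nul Y A + dfc (A ` Y) A = nul (A ` Y) A + dfc Y A"
proof -
  note A = operator_onD[OF op]
  have AY: "csubspace (A ` Y)" by (rule csubspace_image[OF A(1,2)])
  define K where "K = kernel_on Y A"
  have K: "csubspace K" "K \<subseteq> Y"
    unfolding K_def by (rule csubspace_kernel_on[OF A(1,2)], rule kernel_on_subset)
  have fin: "nul Y A \<noteq> \<infinity>" "dfc Y A \<noteq> \<infinity>" using fr fredholm_on_iff[OF op] by auto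
  have cl: "closed (A ` Y)" by (rule closed_image_finite_codim[OF A fin(2)])
  show op': "operator_on (A ` Y) A" using operator_on_funpow_image[OF op, of 1] cl by simp
  define m where "m = qdim K (A ` Y)"
  have ker: "kernel_on (A ` Y) A = K \<inter> A ` Y" unfolding K_def by (rule kernel_on_subspace[OF A(4)])
  have "nul Y A = qdim K (K \<inter> A ` Y) + qdim (K \<inter> A ` Y) {0}"
    unfolding K_def[symmetric] using K AY complex_vector.subspace_0[OF K(1)] complex_vector.subspace_0[OF AY]
    by (intro qdim_add complex_vector.subspace_inter complex_vector.subspace_single_0) auto
  then have n: "nul Y A = m + nul (A ` Y) A"
    unfolding m_def ker by (simp add: qdim_Int[OF K(1)])
  have pre: "Y \<inter> A -` (A ` A ` Y) = subspace_sum K (A ` Y)"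
  proof
    interpret A: bounded_clinear A by (rule A(1))
    show "Y \<inter> A -` (A ` A ` Y) \<subseteq> subspace_sum K (A ` Y)"
    proof
      fix y assume "y \<in> Y \<inter> A -` (A ` A ` Y)"
      then obtain x where x: "y \<in> Y" "x \<in> A ` Y" "A y = A x" by auto
      then have "y - x \<in> K"
        using A(4) complex_vector.subspace_diff[OF A(2)] by (auto simp: K_def kernel_on_def A.diff)
      then show "y \<in> subspace_sum K (A ` Y)" using subspace_sum_memI[OF _ x(2), of "y - x"] by simp
    qed
    show "subspace_sum K (A ` Y) \<subseteq> Y \<inter> A -` (A ` A ` Y)"
    proof
      fix y assume "y \<in> subspace_sum K (A ` Y)"
      then obtain k x where kx: "k \<in> K" "x \<in> A ` Y" "y = k + x" by (auto simp: subspace_sum_def)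
      then have "A y = A x" by (simp add: A.add K_def kernel_on_def)
      then show "y \<in> Y \<inter> A -` (A ` A ` Y)"
        using kx K(2) A(4) complex_vector.subspace_add[OF A(2)] by auto
    qed
  qed
  have "dfc (A ` Y) A = qdim Y (subspace_sum K (A ` Y))"
    using qdim_Int[OF A(2), of "A -` (A ` A ` Y)"] pre by (simp add: qdim_image[OF A(1)])
  moreover have "qdim (subspace_sum K (A ` Y)) (A ` Y) = m"
    unfolding m_def by (rule qdim_subspace_sum[OF AY AY order.refl])
  moreover have "dfc Y A = qdim Y (subspace_sum K (A ` Y)) + qdim (subspace_sum K (A ` Y)) (A ` Y)"
    using pre by (intro qdim_add AY csubspace_subspace_sum K(1) subspace_sum_superset2) auto
  ultimately have d: "dfc Y A = dfc (A ` Y) A + m" by simp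
  show "fredholm_on (A ` Y) A"
    using fin n d unfolding fredholm_on_iff[OF op'] by (metis plus_enat_simps(2,3))
  show "nul Y A + dfc (A ` Y) A = nul (A ` Y) A + dfc Y A"
    by (simp only: n d add_ac)
qed

lemma fredholm_on_funpow_image:
  assumes op: "operator_on Y A" and fr: "fredholm_on Y A"
  shows "operator_on ((A ^^ k) ` Y) A \<and> fredholm_on ((A ^^ k) ` Y) A \<and>
    (weyl_on ((A ^^ k) ` Y) A \<longleftrightarrow> weyl_on Y A)"
proof (induction k)
  case (Suc k)
  let ?U = "(A ^^ k) ` Y"
  have op: "operator_on ?U A" and fr: "fredholm_on ?U A" using Suc by auto
  note * = fredholm_on_image[OF op fr]
  have "nul ?U A \<noteq> \<infinity>" "dfc ?U A \<noteq> \<infinity>" "nul (A ` ?U) A \<noteq> \<infinity>" "dfc (A ` ?U) A \<noteq> \<infinity>"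
    using fr *(2) fredholm_on_iff[OF op] fredholm_on_iff[OF *(1)] by auto
  then have "nul (A ` ?U) A = dfc (A ` ?U) A \<longleftrightarrow> nul ?U A = dfc ?U A"
    using *(3) by auto
  then have "weyl_on (A ` ?U) A \<longleftrightarrow> weyl_on ?U A"
    using weyl_on_iff[OF op] weyl_on_iff[OF *(1)] fr *(2) by blast
  then show ?case using * Suc unfolding funpow_Suc_image(1) by blast
qed (use assms in simp)

text \<open>The kernels of A on the decreasing ranges of its powers decrease and are finite
  dimensional. Once their dimension is minimal they no longer change, so the kernel lies in every
  later range.\<close>

theorem fredholm_on_imp_kato_on:
  assumes op: "operator_on Y A" and fr: "fredholm_on Y A"
  obtains k where "kato_on ((A ^^ k) ` Y) A"
proof -
  note A = operator_onD[OF op]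
  define U where "U k = (A ^^ k) ` Y" for k
  have U: "operator_on (U k) A" "fredholm_on (U k) A" for k
    using fredholm_on_funpow_image[OF op fr, of k] by (auto simp: U_def)
  have dec: "U j \<subseteq> U k" if "k \<le> j" for j k
    unfolding U_def using funpow_image_decreasing[OF A(4) that] .
  define q where "q k = nul (U k) A" for k
  have "(LEAST x. x \<in> range q) \<in> range q" by (rule LeastI) auto
  then obtain k where k: "q k = (LEAST x. x \<in> range q)" by auto
  have qk: "q k \<le> q j" for j unfolding k by (rule Least_le) auto
  have sub: "kernel_on (U k) A \<subseteq> kernel_on (U j) A" if "k \<le> j" for j
  proof -
    let ?K = "kernel_on (U k) A" and ?J = "kernel_on (U j) A"
    have JK: "?J \<subseteq> ?K" using dec[OF that] by (auto simp: kernel_on_def)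
    have cs: "csubspace ?J" "csubspace ?K"
      using csubspace_kernel_on[OF A(1) operator_onD(2)[OF U(1)]] by auto
    have "q k = qdim ?K ?J + q j"
      unfolding q_def using cs JK complex_vector.subspace_0[OF cs(1)]
      by (intro qdim_add complex_vector.subspace_single_0) auto
    moreover have "q k \<noteq> \<infinity>" unfolding q_def using U(2)[of k] fredholm_on_iff[OF U(1)] by blast
    ultimately have "qdim ?K ?J = 0" using qk[of j] by (cases "q k"; cases "q j"; cases "qdim ?K ?J") (auto simp: zero_enat_def)
    then show ?thesis using qdim_eq_0_iff[OF cs(2,1)] by simp
  qed
  have "kato_on (U k) A"
    unfolding kato_on_def
  proof (intro conjI allI)
    show "closed (A ` U k)"
      using operator_onD(3)[OF fredholm_on_image(1)[OF U]] .
    show "kernel_on (U k) A \<subseteq> (A ^^ n) ` U k" for n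
    proof -
      have "kernel_on (U k) A \<subseteq> U (n + k)"
        using sub[of "n + k"] kernel_on_subset[of "U (n + k)" A] by auto
      then show ?thesis unfolding U_def by (simp only: funpow_add image_comp)
    qed
  qed
  then show ?thesis using that U_def by simp
qed

text \<open>As V contains the kernel, membership in V can be tested after applying f. If f (v n)
  converges to f x, the open mapping theorem lifts the differences to a null sequence u n, and u n +
  x, being v n up to the kernel, lies in the closed V.\<close>

lemma closed_image_kernel_subset:
  fixes f :: "'a::complex_banach \<Rightarrow> 'a"
  assumes f: "bounded_clinear f" and M: "csubspace M" "closed M" "closed (f ` M)"
    and V: "csubspace V" "closed V" "kernel_on M f \<subseteq> V" "V \<subseteq> M"
  shows "closed (f ` V)"
proof -
  interpret f: bounded_clinear f by fact
  obtain K where K: "lifts f M (f ` M) K"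
    by (rule open_mapping_subspace[OF f.bounded_linear_axioms csubspace_imp_subspace[OF M(1)] M(2,3) refl])
  show ?thesis
    unfolding closed_sequential_limits
  proof (intro allI impI, elim conjE)
    fix y l assume y: "\<forall>n. y n \<in> f ` V" "y \<longlonglongrightarrow> l"
    have "l \<in> f ` M" using y M(3) V(4) closed_sequentially[of "f ` M" y l] by blast
    then obtain x where x: "x \<in> M" "l = f x" by auto
    have "\<exists>u v. u \<in> M \<and> v \<in> V \<and> y n = f v \<and> f u = y n - l \<and> norm u \<le> K * norm (y n - l)" for n
    proof -
      obtain v where v: "v \<in> V" "y n = f v" using y(1) by auto
      have "v - x \<in> M" using v x V(4) complex_vector.subspace_diff[OF M(1)] by auto
      then have "y n - l \<in> f ` M" using v x by (auto simp: f.diff[symmetric])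
      then show ?thesis using K v unfolding lifts_def by blast
    qed
    then obtain u v where uv: "\<And>n. u n \<in> M" "\<And>n. v n \<in> V" "\<And>n. y n = f (v n)"
        "\<And>n. f (u n) = y n - l" "\<And>n. norm (u n) \<le> K * norm (y n - l)"
      by metis
    have "u n + x \<in> V" for n
    proof -
      have "v n - u n - x \<in> M"
        using uv x V(4) by (intro complex_vector.subspace_diff[OF M(1)]) auto
      moreover have "f (v n - u n - x) = 0" using uv(3,4)[of n] x by (simp add: f.diff)
      ultimately have "v n - u n - x \<in> V" using V(3) by (auto simp: kernel_on_def)
      then have "v n - (v n - u n - x) \<in> V" by (rule complex_vector.subspace_diff[OF V(1) uv(2)])
      moreover have "v n - (v n - u n - x) = u n + x" by simp
      ultimately show ?thesis by simp
    qed
    moreover have "(\<lambda>n. u n + x) \<longlonglongrightarrow> 0 + x"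
    proof (intro tendsto_intros)
      have "(\<lambda>n. y n - l) \<longlonglongrightarrow> l - l" using y(2) by (intro tendsto_intros)
      then have "(\<lambda>n. norm (y n - l)) \<longlonglongrightarrow> 0" by (simp add: tendsto_norm_zero)
      then have "(\<lambda>n. K * norm (y n - l)) \<longlonglongrightarrow> 0" by (rule tendsto_mult_right_zero)
      then show "u \<longlonglongrightarrow> 0" by (rule Lim_null_comparison[rotated]) (use uv(5) in auto)
    qed
    ultimately have "0 + x \<in> V" using closed_sequentially[OF V(2), of "\<lambda>n. u n + x" "0 + x"] by blast
    then show "l \<in> f ` V" using x by simp
  qed
qed

text \<open>The generalized range, also called hyperrange, of A on M.\<close>

definition core_on :: "'a::complex_normed_vector set \<Rightarrow> ('a \<Rightarrow> 'a) \<Rightarrow> 'a set"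
  where "core_on M A = (\<Inter>n. (A ^^ n) ` M)"

text \<open>Ranges of powers contain the kernel, so closedness passes from each to the next. For
  surjectivity on the core it also matters that the kernel lies in all of them.\<close>

lemma kato_on_core:
  assumes op: "operator_on M A" and kt: "kato_on M A"
  shows "closed ((A ^^ n) ` M)" "operator_on (core_on M A) A" "A ` core_on M A = core_on M A"
    "kernel_on M A \<subseteq> core_on M A" "core_on M A \<subseteq> M"
proof -
  note A = operator_onD[OF op]
  interpret A: bounded_clinear A by (rule A)
  have cl: "closed (A ` M)" and ker: "\<And>n. kernel_on M A \<subseteq> (A ^^ n) ` M"
    using kt by (auto simp: kato_on_def)
  show clA: "closed ((A ^^ n) ` M)" for n
  proof (induction n)
    case 0
    then show ?case using A(3) by simp
  next
    case (Suc n)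
    show ?case unfolding funpow_Suc_image(1)
      by (rule closed_image_kernel_subset[OF A(1-3) cl csubspace_funpow_image[OF op] Suc ker
            funpow_image_subset[OF A(4)]])
  qed
  show kc: "kernel_on M A \<subseteq> core_on M A" using ker by (auto simp: core_on_def)
  show cM: "core_on M A \<subseteq> M" unfolding core_on_def using INT_lower[of 0 UNIV "\<lambda>n. (A ^^ n) ` M"] by simp
  have cs: "csubspace (core_on M A)"
    unfolding core_on_def using csubspace_funpow_image[OF op] by (intro complex_vector.subspace_Inter) auto
  have "A ` core_on M A \<subseteq> (A ^^ n) ` M" for n
  proof -
    have "A ` core_on M A \<subseteq> A ` (A ^^ n) ` M" by (intro image_mono) (auto simp: core_on_def)
    also have "\<dots> \<subseteq> (A ^^ n) ` M"
      using funpow_image_decreasing[OF A(4), of n "Suc n"] unfolding funpow_Suc_image(1) by simp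
    finally show ?thesis .
  qed
  then have sub: "A ` core_on M A \<subseteq> core_on M A" by (auto simp: core_on_def)
  show "A ` core_on M A = core_on M A"
  proof (rule antisym[OF sub])
    show "core_on M A \<subseteq> A ` core_on M A"
    proof
      fix y assume y: "y \<in> core_on M A"
      then have "y \<in> (A ^^ Suc 0) ` M" unfolding core_on_def by blast
      then obtain x where x: "x \<in> M" "y = A x" by auto
      \<comment> \<open>The preimage x is chosen before n. A preimage z in the n-th range differs
        from it by a kernel element, which lies in that range as well.\<close>
      have "x \<in> (A ^^ n) ` M" for n
      proof -
        have "y \<in> (A ^^ Suc n) ` M" using y unfolding core_on_def by blast
        then obtain z where z: "z \<in> (A ^^ n) ` M" "y = A z" unfolding funpow_Suc_image(1) by auto
        have "z \<in> M" using z funpow_image_subset[OF A(4), of n] by blast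
        then have "x - z \<in> kernel_on M A"
          using x z complex_vector.subspace_diff[OF A(2)] by (simp add: kernel_on_def A.diff)
        then have "x - z + z \<in> (A ^^ n) ` M"
          using ker[of n] z by (intro complex_vector.subspace_add[OF csubspace_funpow_image[OF op]]) auto
        then show ?thesis by simp
      qed
      then show "y \<in> A ` core_on M A" using x by (auto simp: core_on_def)
    qed
  qed
  have "closed (core_on M A)" unfolding core_on_def using clA by (intro closed_INT) auto
  then show "operator_on (core_on M A) A" using sub cs A(1) by (simp add: operator_on_def)
qed

lemma lifts_mono: "lifts f Z Y c \<Longrightarrow> c \<le> d \<Longrightarrow> lifts f Z Y d"
  unfolding lifts_def by (meson less_le_trans mult_right_mono norm_ge_zero order_trans)

lemma subspace_closure:
  fixes S :: "'a::real_normed_vector set"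
  assumes S: "subspace S" shows "subspace (closure S)"
proof (rule subspaceI)
  show "0 \<in> closure S" using subspace_0[OF S] closure_subset by blast
  show "x + y \<in> closure S" if xy: "x \<in> closure S" "y \<in> closure S" for x y
  proof -
    obtain f g where "\<forall>n. f n \<in> S" "f \<longlonglongrightarrow> x" "\<forall>n. g n \<in> S" "g \<longlonglongrightarrow> y"
      using xy unfolding closure_sequential by metis
    then show ?thesis
      unfolding closure_sequential
      by (intro exI[of _ "\<lambda>n. f n + g n"]) (auto intro: tendsto_add subspace_add[OF S])
  qed
  show "c *\<^sub>R x \<in> closure S" if x: "x \<in> closure S" for c x
  proof -
    obtain f where "\<forall>n. f n \<in> S" "f \<longlonglongrightarrow> x"
      using x unfolding closure_sequential by metis
    then show ?thesis
      unfolding closure_sequential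
      by (intro exI[of _ "\<lambda>n. c *\<^sub>R f n"]) (auto intro: tendsto_intros subspace_scale[OF S])
  qed
qed

text \<open>A point y of the closure has a neighbour z in the image within half its norm; lifting z,
  of norm at most 3/2 that of y, solves f x = y up to a remainder of half size. The iteration then
  puts y into the image.\<close>

lemma closed_image_if_approx_inverse:
  fixes f :: "'a::complex_banach \<Rightarrow> 'a"
  assumes f: "bounded_clinear f" and M: "csubspace M" "closed M"
    and c: "0 \<le> c" "\<And>y. y \<in> f ` M \<Longrightarrow> \<exists>x\<in>M. f x = y \<and> norm x \<le> c * norm y"
  shows "closed (f ` M)"
proof -
  interpret f: bounded_clinear f by fact
  have fM: "subspace (f ` M)" by (intro csubspace_imp_subspace csubspace_image f M)
  have approx: "\<exists>x\<in>M. norm x \<le> (c * (3/2)) * norm y \<and> norm (y - f x) \<le> (1/2) * norm y"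
    if y: "y \<in> closure (f ` M)" for y
  proof (cases "y = 0")
    case True
    then show ?thesis using complex_vector.subspace_0[OF M(1)] by (intro bexI[of _ 0]) (auto simp: f.zero)
  next
    case False
    then obtain z where z: "z \<in> f ` M" "dist z y < norm y / 2"
      using y unfolding closure_approachable by (meson half_gt_zero zero_less_norm_iff)
    then obtain x where x: "x \<in> M" "f x = z" "norm x \<le> c * norm z" using c(2) by blast
    have "norm z \<le> (3/2) * norm y" using z(2) norm_triangle_sub[of z y] by (simp add: dist_norm)
    then have "c * norm z \<le> c * ((3/2) * norm y)" using c(1) by (rule mult_left_mono)
    then show ?thesis using x z by (intro bexI[of _ x]) (auto simp: dist_norm norm_minus_commute)
  qed
  have "closure (f ` M) \<subseteq> f ` M"
  proof
    fix y assume "y \<in> closure (f ` M)"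
    then have "\<exists>x\<in>M. f x = y \<and> norm x \<le> c * (3/2) / (1 - 1/2) * norm y"
      by (intro approx_surjective_imp_surjective[OF f.bounded_linear_axioms csubspace_imp_subspace[OF M(1)] M(2)
          subspace_closure[OF fM] closure_subset _ _ approx]) auto
    then show "y \<in> f ` M" by blast
  qed
  then show ?thesis by (simp add: closure_subset_eq)
qed

text \<open>An eigenvector for \<open>\<mu> \<noteq> 0\<close> is the image of its multiple by
  \<open>inverse \<mu>\<close>, and this can be repeated.\<close>

lemma kernel_shifted_subset_funpow:
  assumes "operator_on M A" "\<mu> \<noteq> 0"
  shows "kernel_on M (shifted A \<mu>) \<subseteq> (A ^^ n) ` M"
proof (induction n)
  case 0
  then show ?case by (simp add: kernel_on_subset)
next
  case (Suc n)
  interpret A: bounded_clinear A using assms by (simp add: operator_on_def)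
  show ?case
  proof
    fix x assume x: "x \<in> kernel_on M (shifted A \<mu>)"
    then have "x = A (inverse \<mu> *\<^sub>C x)" using assms(2) by (simp add: kernel_on_def A.scaleC)
    moreover have "inverse \<mu> *\<^sub>C x \<in> (A ^^ n) ` M"
      using Suc x by (intro complex_vector.subspace_scale[OF csubspace_funpow_image[OF assms(1)]]) auto
    ultimately show "x \<in> (A ^^ Suc n) ` M" unfolding funpow_Suc_image(1) by (rule image_eqI)
  qed
qed

text \<open>Small shifts remain surjective on the core of A. This lets one correct elements of the
  kernel of A inside the core into elements of the kernel of A - \<mu>, with uniform control of the
  distance to that kernel; closed range follows. The estimate is exported because the deficiency
  bound needs its uniformity in \<mu>.\<close>

lemma kato_on_shifted:
  assumes op: "operator_on M A" and kt: "kato_on M A"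
  obtains e c where "e > 0" "c \<ge> 0"
    "\<And>\<mu>. cmod \<mu> < e \<Longrightarrow> kato_on M (shifted A \<mu>) \<and> shifted A \<mu> ` core_on M A = core_on M A \<and>
      (\<forall>x\<in>M. \<exists>z\<in>kernel_on M (shifted A \<mu>). norm (x - z) \<le> c * norm (A x - \<mu> *\<^sub>C x))"
proof -
  note A = operator_onD[OF op]
  interpret A: bounded_clinear A by (rule A)
  let ?N = "core_on M A"
  note core = kato_on_core[OF op kt]
  note N = operator_onD[OF core(2)]
  obtain c1 where c1: "lifts A M (A ` M) c1"
    using kt A by (auto intro: open_mapping_subspace[OF A.bounded_linear_axioms csubspace_imp_subspace, of M "A ` M"]
        simp: kato_on_def)
  obtain c2 where c2: "lifts A ?N ?N c2"
    using core(3) N by (auto intro: open_mapping_subspace[OF A.bounded_linear_axioms csubspace_imp_subspace, of ?N ?N])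
  define c where "c = max c1 c2"
  have c: "lifts A M (A ` M) c" "lifts A ?N ?N c"
    using lifts_mono[OF c1, of c] lifts_mono[OF c2, of c] by (auto simp: c_def)
  have c0: "c > 0" using c(1) by (simp add: lifts_def)
  \<comment> \<open>Smallness 1/8 of \<delta> = c |\<mu>| makes the loss 4 \<delta> in one
    correction at most 1/2. The factor 5 is 4 from summing the corrections plus 1 to absorb the
    tail.\<close>
  show ?thesis
  proof (rule that[of "1 / (8 * c)" "5 * c"])
    show "1 / (8 * c) > 0" "5 * c \<ge> 0" using c0 by auto
    fix \<mu> assume mu: "cmod \<mu> < 1 / (8 * c)"
    define B where "B = shifted A \<mu>"
    define \<delta> where "\<delta> = c * cmod \<mu>"
    have \<delta>: "0 \<le> \<delta>" "\<delta> < 1/8" using mu c0 by (auto simp: \<delta>_def field_simps)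
    have opB: "operator_on M B" unfolding B_def by (rule operator_on_shifted[OF op])
    interpret B: bounded_clinear B using opB by (simp add: operator_on_def)
    have K: "csubspace (kernel_on M B)" by (intro csubspace_kernel_on operator_onD[OF opB])
    have L: "lifts B ?N ?N (2 * c)"
    proof (rule lifts_mono)
      show "lifts B ?N ?N (c / (1 - c * cmod \<mu>))"
        unfolding B_def
        by (rule lifts_perturb[OF A.bounded_linear_axioms bounded_clinear.axioms(1)[OF bounded_clinear_scale]
              csubspace_imp_subspace[OF N(2)] N(3) csubspace_imp_subspace[OF N(2)] N(4) _ c(2)])
          (use \<delta> complex_vector.subspace_scale[OF N(2)] in \<open>auto simp: norm_scaleC \<delta>_def\<close>)
      show "c / (1 - c * cmod \<mu>) \<le> 2 * c" using \<delta> c0 by (simp add: \<delta>_def[symmetric] field_simps)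
    qed
    have BN: "B ` ?N = ?N"
    proof
      show "B ` ?N \<subseteq> ?N" using operator_onD(4)[OF operator_on_shifted[OF core(2)]] by (simp add: B_def)
      show "?N \<subseteq> B ` ?N"
      proof
        fix y assume "y \<in> ?N"
        then obtain x where "x \<in> ?N" "B x = y" using L unfolding lifts_def by blast
        then show "y \<in> B ` ?N" by blast
      qed
    qed
    \<comment> \<open>Removing a short u with A u = A x leaves x0 in the kernel of A, hence in the
      core. There B x0 = - \<mu> x0 is small, and solving B w = B x0 in the core yields x0 - w in
      the kernel of B, close to x.\<close>
    have step: "\<exists>z\<in>kernel_on M B. norm (x - z) \<le> 2 * c * norm (B x) + norm x / 2" if x: "x \<in> M" for x
    proof -
      obtain u where u: "u \<in> M" "A u = A x" "norm u \<le> c * norm (A x)" using c(1) x unfolding lifts_def by blast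
      define x0 where "x0 = x - u"
      have x0: "x0 \<in> kernel_on M A"
        using u x complex_vector.subspace_diff[OF A(2)] by (simp add: x0_def kernel_on_def A.diff)
      then have x0N: "x0 \<in> ?N" using core(4) by blast
      then have "B x0 \<in> ?N" using BN by blast
      then obtain w where w: "w \<in> ?N" "B w = B x0" "norm w \<le> 2 * c * norm (B x0)"
        using L unfolding lifts_def by blast
      have "B x0 = - (\<mu> *\<^sub>C x0)" using x0 by (simp add: B_def kernel_on_def)
      then have "norm w \<le> 2 * \<delta> * norm x0" using w(3) by (simp add: norm_scaleC \<delta>_def mult_ac)
      also have "\<dots> \<le> 2 * \<delta> * (norm x + norm u)"
        unfolding x0_def using \<delta> norm_triangle_ineq4[of x u] by (intro mult_left_mono) auto
      also have "\<dots> \<le> 2 * \<delta> * norm x + norm u"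
        using \<delta> mult_right_mono[of "2 * \<delta>" 1 "norm u"] by (simp add: algebra_simps)
      finally have wn: "norm w \<le> 2 * \<delta> * norm x + norm u" .
      have "norm (A x) \<le> norm (B x) + cmod \<mu> * norm x"
        using norm_triangle_ineq[of "B x" "\<mu> *\<^sub>C x"] by (simp add: B_def norm_scaleC)
      then have "c * norm (A x) \<le> c * (norm (B x) + cmod \<mu> * norm x)" using c0 by (intro mult_left_mono) auto
      then have un: "norm u \<le> c * norm (B x) + \<delta> * norm x" using u(3) by (simp add: \<delta>_def algebra_simps)
      have eq: "x - (x0 - w) = u + w" by (simp add: x0_def)
      have "norm (x - (x0 - w)) \<le> norm u + norm w" unfolding eq by (rule norm_triangle_ineq)
      also have "\<dots> \<le> 2 * c * norm (B x) + 4 * \<delta> * norm x" using wn un by (simp add: algebra_simps)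
      also have "\<dots> \<le> 2 * c * norm (B x) + norm x / 2"
        using \<delta> mult_right_mono[of "4 * \<delta>" "1/2" "norm x"] by simp
      finally have "norm (x - (x0 - w)) \<le> 2 * c * norm (B x) + norm x / 2" .
      moreover have "x0 - w \<in> kernel_on M B"
        using x0N w core(5) complex_vector.subspace_diff[OF A(2)] by (auto simp: kernel_on_def B.diff)
      ultimately show ?thesis by blast
    qed
    \<comment> \<open>The remainder x - z has the same image under B, so \<open>step\<close> can be
      repeated; 4 c is the fixed point of t \<mapsto> 2 c + t / 2.\<close>
    have iter: "\<exists>z\<in>kernel_on M B. norm (x - z) \<le> 4 * c * norm (B x) + norm x / 2 ^ n" if x: "x \<in> M" for x n
    proof (induction n)
      case 0
      then show ?case using complex_vector.subspace_0[OF K] c0 by (intro bexI[of _ 0]) auto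
    next
      case (Suc n)
      then obtain z where z: "z \<in> kernel_on M B" "norm (x - z) \<le> 4 * c * norm (B x) + norm x / 2 ^ n" by blast
      have "x - z \<in> M" using x z complex_vector.subspace_diff[OF A(2)] by (auto simp: kernel_on_def)
      then obtain z' where z': "z' \<in> kernel_on M B"
          "norm (x - z - z') \<le> 2 * c * norm (B (x - z)) + norm (x - z) / 2"
        using step by blast
      have "B (x - z) = B x" using z by (simp add: B.diff kernel_on_def)
      then have "norm (x - (z + z')) \<le> 4 * c * norm (B x) + norm x / 2 ^ Suc n"
        using z' z(2) by (simp add: diff_diff_eq)
      moreover have "z + z' \<in> kernel_on M B" using z z' by (intro complex_vector.subspace_add[OF K])
      ultimately show ?case by blast
    qed
    have est: "\<exists>z\<in>kernel_on M B. norm (x - z) \<le> 5 * c * norm (B x)" if x: "x \<in> M" for x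
    proof (cases "B x = 0")
      case True
      then show ?thesis using x by (intro bexI[of _ x]) (auto simp: kernel_on_def)
    next
      case False
      then have pos: "c * norm (B x) > 0" using c0 by simp
      have "(\<lambda>n. norm x * (1/2) ^ n) \<longlonglongrightarrow> norm x * 0"
        by (intro tendsto_intros LIMSEQ_power_zero) auto
      then have "\<forall>\<^sub>F n in sequentially. norm x * (1/2) ^ n < c * norm (B x)"
        using pos by (intro order_tendstoD) auto
      then obtain n where "norm x * (1/2) ^ n < c * norm (B x)" by (auto simp: eventually_sequentially)
      then have n: "norm x / 2 ^ n \<le> c * norm (B x)" by (simp add: power_divide)
      obtain z where "z \<in> kernel_on M B" "norm (x - z) \<le> 4 * c * norm (B x) + norm x / 2 ^ n"
        using iter[OF x] by blast
      then show ?thesis using n by (intro bexI[of _ z]) auto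
    qed
    have "kato_on M B"
    \<comment> \<open>For nonzero \<mu> the kernel of B consists of eigenvectors of A, which lie in
      the core, and the core is reproduced by every power of B.\<close>
    proof (cases "\<mu> = 0")
      case True
      then show ?thesis using kt by (simp add: B_def)
    next
      case False
      have "closed (B ` M)"
      proof (rule closed_image_if_approx_inverse[OF operator_onD(1)[OF opB] A(2,3)])
        show "0 \<le> 5 * c" using c0 by simp
        fix y assume "y \<in> B ` M"
        then obtain x where x: "x \<in> M" "y = B x" by auto
        then obtain z where z: "z \<in> kernel_on M B" "norm (x - z) \<le> 5 * c * norm (B x)" using est by blast
        have "x - z \<in> M" "B (x - z) = y"
          using x z complex_vector.subspace_diff[OF A(2)] by (auto simp: kernel_on_def B.diff)
        then show "\<exists>x\<in>M. B x = y \<and> norm x \<le> 5 * c * norm y" using z x by auto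
      qed
      moreover have "kernel_on M B \<subseteq> (B ^^ n) ` M" for n
      proof -
        have "kernel_on M B \<subseteq> ?N"
          unfolding B_def core_on_def using kernel_shifted_subset_funpow[OF op False] by blast
        also have "?N = (B ^^ n) ` ?N"
        proof (induction n)
          case (Suc n)
          then show ?case unfolding funpow_Suc_image(1) using BN by simp
        qed simp
        also have "\<dots> \<subseteq> (B ^^ n) ` M" using core(5) by (rule image_mono)
        finally show ?thesis .
      qed
      ultimately show ?thesis by (simp add: kato_on_def)
    qed
    then show "kato_on M (shifted A \<mu>) \<and> shifted A \<mu> ` core_on M A = core_on M A \<and>
      (\<forall>x\<in>M. \<exists>z\<in>kernel_on M (shifted A \<mu>). norm (x - z) \<le> 5 * c * norm (A x - \<mu> *\<^sub>C x))"
      using BN est by (simp add: B_def)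
  qed
qed

section \<open>Kato operators that are limits of Fredholm operators\<close>

text \<open>Cut the core by the kernel of a projection onto m kernel vectors. A still maps the
  smaller space Z onto the core, and so does A - \<mu>; hence the core lies in the sum of Z and the
  kernel of A - \<mu>. As it contains m vectors independent modulo Z, that kernel has dimension at
  least m.\<close>

lemma kato_on_nul_lower:
  assumes op: "operator_on M A" and kt: "kato_on M A" and m: "enat m \<le> nul M A"
  obtains e where "e > 0" "\<And>\<mu>. cmod \<mu> < e \<Longrightarrow> enat m \<le> nul M (shifted A \<mu>)"
proof -
  note A = operator_onD[OF op]
  interpret A: bounded_clinear A by (rule A)
  let ?N = "core_on M A"
  note core = kato_on_core[OF op kt]
  note N = operator_onD[OF core(2)]
  obtain v where v: "v ` {..<m} \<subseteq> kernel_on M A" "indep_mod {0} {..<m} v"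
    using le_qdimE[OF m] .
  obtain P where P: "bounded_clinear P" "\<And>x. P x \<in> cspan (v ` {..<m})"
      "\<And>x. x \<in> cspan (v ` {..<m}) \<Longrightarrow> P x = x"
    using projection_exists[OF complex_vector.subspace_single_0 closed_singleton v(2)] by metis
  interpret P: bounded_clinear P by fact
  have span: "cspan (v ` {..<m}) \<subseteq> kernel_on M A"
    by (intro complex_vector.span_minimal v csubspace_kernel_on A)
  define Z where "Z = kernel_on ?N P"
  have Z: "csubspace Z" "closed Z" "Z \<subseteq> ?N"
    unfolding Z_def using csubspace_kernel_on[OF P(1) N(2)] closed_kernel_on[OF P(1) N(3)] kernel_on_subset by auto
  have AZ: "A ` Z = ?N"
  proof
    show "A ` Z \<subseteq> ?N" using Z(3) N(4) by blast
    show "?N \<subseteq> A ` Z"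
    proof
      fix y assume "y \<in> ?N"
      then obtain x where x: "x \<in> ?N" "y = A x" using core(3) by blast
      have Px: "P x \<in> kernel_on M A" using P(2) span by blast
      then have "x - P x \<in> ?N" using x core(4) by (intro complex_vector.subspace_diff[OF N(2)]) auto
      moreover have "P (x - P x) = 0" using P(2)[of x] by (simp add: P.diff P(3))
      moreover have "A (x - P x) = y" using Px x by (simp add: A.diff kernel_on_def)
      ultimately show "y \<in> A ` Z" by (force simp: Z_def kernel_on_def)
    qed
  qed
  obtain c where c: "lifts A Z ?N c"
    by (rule open_mapping_subspace[OF A.bounded_linear_axioms csubspace_imp_subspace[OF Z(1)] Z(2) N(3) AZ])
  have c0: "c > 0" using c by (simp add: lifts_def)
  show ?thesis
  proof (rule that[of "1 / c"])
    show "1 / c > 0" using c0 by simp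
    fix \<mu> assume "cmod \<mu> < 1 / c"
    then have mc: "c * cmod \<mu> < 1" using c0 by (simp add: field_simps)
    let ?B = "shifted A \<mu>" and ?K = "kernel_on M (shifted A \<mu>)"
    have opB: "operator_on M ?B" "operator_on ?N ?B" using op core(2) by (simp_all add: operator_on_shifted)
    interpret B: bounded_clinear ?B using operator_onD(1)[OF opB(1)] .
    have K: "csubspace ?K" by (intro csubspace_kernel_on operator_onD[OF opB(1)])
    have L: "lifts ?B Z ?N (c / (1 - c * cmod \<mu>))"
      by (rule lifts_perturb[OF A.bounded_linear_axioms bounded_clinear.axioms(1)[OF bounded_clinear_scale]
            csubspace_imp_subspace[OF Z(1)] Z(2) csubspace_imp_subspace[OF N(2)] _ _ c])
        (use mc Z(3) AZ complex_vector.subspace_scale[OF N(2)] in \<open>auto simp: norm_scaleC\<close>)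
    have sub: "?N \<subseteq> subspace_sum ?K Z"
    proof
      fix x assume x: "x \<in> ?N"
      then have "?B x \<in> ?N" using operator_onD(4)[OF opB(2)] by blast
      then obtain z where z: "z \<in> Z" "?B z = ?B x" using L unfolding lifts_def by blast
      then have "?B (x - z) = 0" by (simp only: B.diff) simp
      then have "x - z \<in> ?K"
        using x z Z(3) core(5) complex_vector.subspace_diff[OF A(2), of x z] by (auto simp: kernel_on_def)
      then show "x \<in> subspace_sum ?K Z" using subspace_sum_memI[of "x - z" ?K z Z] z(1) by simp
    qed
    have "indep_mod Z {..<m} v"
      unfolding indep_mod_def
    proof (intro allI impI)
      fix a assume s: "(\<Sum>i<m. a i *\<^sub>C v i) \<in> Z"
      then have "(\<Sum>i<m. a i *\<^sub>C v i) = 0"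
        using P(3)[OF sum_in_span] by (auto simp: Z_def kernel_on_def)
      then show "\<forall>i\<in>{..<m}. a i = 0" using v(2) by (simp add: indep_mod_def)
    qed
    then have "enat (card {..<m}) \<le> qdim ?N Z" using v(1) core(4) by (intro card_le_qdim) auto
    also have "\<dots> \<le> qdim (subspace_sum ?K Z) Z" using sub by (intro qdim_mono) auto
    also have "\<dots> = qdim ?K Z" by (rule qdim_subspace_sum[OF Z(1) Z(1) order.refl])
    also have "\<dots> \<le> qdim ?K {0}" using complex_vector.subspace_0[OF Z(1)] by (intro qdim_mono) auto
    finally show "enat m \<le> nul M ?B" by simp
  qed
qed

text \<open>Vectors independent modulo the range of A stay independent modulo that of A - \<mu>. If
  w is in their span and w = (A - \<mu>) x with x of norm at most c |w|, a projection P onto the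
  span that kills the range of A gives w = - \<mu> P x, too short unless w = 0.\<close>

lemma kato_on_dfc_lower:
  assumes op: "operator_on M A" and kt: "kato_on M A" and m: "enat m \<le> dfc M A"
  obtains e where "e > 0" "\<And>\<mu>. cmod \<mu> < e \<Longrightarrow> enat m \<le> dfc M (shifted A \<mu>)"
proof -
  note A = operator_onD[OF op]
  obtain e c where ec: "e > 0" "c \<ge> 0"
    and est: "\<And>\<mu> x. cmod \<mu> < e \<Longrightarrow> x \<in> M \<Longrightarrow>
      \<exists>z\<in>kernel_on M (shifted A \<mu>). norm (x - z) \<le> c * norm (A x - \<mu> *\<^sub>C x)"
    by (rule kato_on_shifted[OF op kt]) blast
  have AM: "csubspace (A ` M)" "closed (A ` M)"
    using csubspace_image[OF A(1,2)] kt by (auto simp: kato_on_def)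
  obtain v where v: "v ` {..<m} \<subseteq> M" "indep_mod (A ` M) {..<m} v" using le_qdimE[OF m] .
  obtain P where P: "bounded_clinear P" "\<And>x. x \<in> A ` M \<Longrightarrow> P x = 0"
      "\<And>x. x \<in> cspan (v ` {..<m}) \<Longrightarrow> P x = x"
    using projection_exists[OF AM v(2)] by metis
  interpret P: bounded_clinear P by fact
  obtain p where p: "p > 0" "\<And>x. norm (P x) \<le> norm x * p" using P.pos_bounded by blast
  \<comment> \<open>The bound required is |\<mu>| p c < 1; c + 1 replaces c since c may be
    0.\<close>
  define d where "d = min e (1 / (p * (c + 1)))"
  show ?thesis
  proof (rule that[of d])
    show "d > 0" using ec p by (simp add: d_def)
    fix \<mu> assume mu: "cmod \<mu> < d"
    let ?B = "shifted A \<mu>"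
    interpret B: bounded_clinear ?B using bounded_clinear_shifted[OF A(1)] .
    have triv: "w = 0" if w: "w \<in> ?B ` M" "w \<in> cspan (v ` {..<m})" for w
    proof -
      obtain x where x: "x \<in> M" "w = ?B x" using w by auto
      obtain z where z: "z \<in> kernel_on M ?B" "norm (x - z) \<le> c * norm w"
        using est[of \<mu> x] mu x by (auto simp: d_def)
      have xz: "x - z \<in> M" using x z complex_vector.subspace_diff[OF A(2)] by (auto simp: kernel_on_def)
      have "?B (x - z) = w" using x(2) z(1) by (simp only: B.diff) (simp add: kernel_on_def)
      then have "P w = P (A (x - z)) - P (\<mu> *\<^sub>C (x - z))" by (metis P.diff)
      then have "w = - (\<mu> *\<^sub>C P (x - z))" using P(2,3) xz w(2) by (simp add: P.scaleC)
      then have "norm w = cmod \<mu> * norm (P (x - z))" by (metis norm_minus_cancel norm_scaleC)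
      also have "\<dots> \<le> cmod \<mu> * ((c * norm w) * p)"
        using p(2)[of "x - z"] mult_right_mono[OF z(2), of p] p(1)
        by (intro mult_left_mono[OF order.trans]) auto
      finally have "norm w \<le> (cmod \<mu> * (p * c)) * norm w" by (simp add: mult_ac)
      moreover have "cmod \<mu> * (p * c) < 1"
      proof -
        have "p * (c + 1) > 0" using p ec by simp
        then have "cmod \<mu> * (p * (c + 1)) < 1"
          using mu by (simp add: d_def pos_less_divide_eq)
        moreover have "cmod \<mu> * (p * c) \<le> cmod \<mu> * (p * (c + 1))"
          using p ec by (intro mult_left_mono) auto
        ultimately show ?thesis by linarith
      qed
      moreover have "k * norm w < norm w" if "k < 1" "w \<noteq> 0" for k
        using mult_strict_right_mono[OF that(1), of "norm w"] that(2) by simp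
      ultimately show "w = 0" by (meson not_le)
    qed
    have "indep_mod (?B ` M) {..<m} v"
      unfolding indep_mod_def
    proof (intro allI impI)
      fix a assume "(\<Sum>i<m. a i *\<^sub>C v i) \<in> ?B ` M"
      then have "(\<Sum>i<m. a i *\<^sub>C v i) = 0" using sum_in_span by (rule triv)
      then have "(\<Sum>i<m. a i *\<^sub>C v i) \<in> A ` M" using complex_vector.subspace_0[OF AM(1)] by simp
      then show "\<forall>i\<in>{..<m}. a i = 0" using v(2) unfolding indep_mod_def by blast
    qed
    then have "enat (card {..<m}) \<le> dfc M ?B" using v(1) by (intro card_le_qdim) auto
    then show "enat m \<le> dfc M ?B" by simp
  qed
qed

lemma kato_fredholm_constant:
  assumes op: "operator_on M A" and kt: "kato_on M A" and fr: "fredholm_on M A"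
  obtains e where "e > 0"
    "\<And>\<mu>. cmod \<mu> < e \<Longrightarrow> nul M (shifted A \<mu>) = nul M A \<and> dfc M (shifted A \<mu>) = dfc M A"
proof -
  obtain n d where nd: "nul M A = enat n" "dfc M A = enat d"
    using fr fredholm_on_iff[OF op] by auto
  obtain e1 where e1: "e1 > 0" "\<And>\<mu>. cmod \<mu> < e1 \<Longrightarrow> nul M (shifted A \<mu>) \<le> nul M A \<and> dfc M (shifted A \<mu>) \<le> dfc M A"
    by (rule fredholm_stable[OF op fr]) blast
  obtain e2 where e2: "e2 > 0" "\<And>\<mu>. cmod \<mu> < e2 \<Longrightarrow> nul M A \<le> nul M (shifted A \<mu>)"
    unfolding nd(1) by (rule kato_on_nul_lower[OF op kt, of n]) (use nd in auto)
  obtain e3 where e3: "e3 > 0" "\<And>\<mu>. cmod \<mu> < e3 \<Longrightarrow> dfc M A \<le> dfc M (shifted A \<mu>)"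
    unfolding nd(2) by (rule kato_on_dfc_lower[OF op kt, of d]) (use nd in auto)
  show ?thesis
    using e1 e2 e3 by (intro that[of "min e1 (min e2 e3)"]) (auto intro!: antisym)
qed

text \<open>On a disc of Kato operators nullity and deficiency are lower semicontinuous, and locally
  constant where they are finite; hence a finite pair of values is taken on a clopen set.\<close>

theorem kato_fredholm_limit:
  assumes op: "operator_on M A" and kt: "kato_on M A"
    and lim: "\<And>e. e > 0 \<Longrightarrow> \<exists>\<mu>. cmod \<mu> < e \<and> fredholm_on M (shifted A \<mu>)"
  shows "fredholm_on M A"
proof -
  obtain e where e: "e > 0" "\<And>\<mu>. cmod \<mu> < e \<Longrightarrow> kato_on M (shifted A \<mu>)"
    by (rule kato_on_shifted[OF op kt]) blast
  obtain \<mu>1 where mu1: "cmod \<mu>1 < e" "fredholm_on M (shifted A \<mu>1)" using lim[OF e(1)] by blast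
  obtain n d where nd: "nul M (shifted A \<mu>1) = enat n" "dfc M (shifted A \<mu>1) = enat d"
    using mu1 fredholm_on_iff[OF operator_on_shifted[OF op]] by auto
  define Q where "Q \<mu> \<longleftrightarrow> nul M (shifted A \<mu>) = enat n \<and> dfc M (shifted A \<mu>) = enat d" for \<mu>
  have local: "\<exists>r>0. \<forall>\<nu>. cmod (\<nu> - \<mu>) < r \<longrightarrow> Q \<nu> = Q \<mu>" if mu: "cmod \<mu> < e" for \<mu>
  proof -
    let ?B = "shifted A \<mu>"
    have opB: "operator_on M ?B" by (rule operator_on_shifted[OF op])
    have shift: "shifted ?B (\<nu> - \<mu>) = shifted A \<nu>" for \<nu>
      using shifted_shifted[of A \<mu> "\<nu> - \<mu>"] by simp
    consider "fredholm_on M ?B" | "nul M ?B = \<infinity>" | "dfc M ?B = \<infinity>" using fredholm_on_iff[OF opB] by blast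
    then show ?thesis
    proof cases
      case 1
      obtain r where r: "r > 0" "\<And>\<nu>. cmod \<nu> < r \<Longrightarrow>
          nul M (shifted ?B \<nu>) = nul M ?B \<and> dfc M (shifted ?B \<nu>) = dfc M ?B"
        by (rule kato_fredholm_constant[OF opB e(2)[OF mu] 1]) blast
      have "Q \<nu> = Q \<mu>" if "cmod (\<nu> - \<mu>) < r" for \<nu>
        using r(2)[OF that] unfolding Q_def shift by simp
      then show ?thesis using r(1) by blast
    next
      case 2
      \<comment> \<open>Infinite nullity forces nullity above n nearby, so \<open>Q\<close> fails
        both at \<mu> and around it. The deficiency is treated alike.\<close>
      then have "enat (Suc n) \<le> nul M ?B" by simp
      then obtain r where r: "r > 0" "\<And>\<nu>. cmod \<nu> < r \<Longrightarrow> enat (Suc n) \<le> nul M (shifted ?B \<nu>)"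
        by (rule kato_on_nul_lower[OF opB e(2)[OF mu]]) blast
      have "Q \<nu> = Q \<mu>" if "cmod (\<nu> - \<mu>) < r" for \<nu>
        using r(2)[OF that] 2 unfolding Q_def shift by auto
      then show ?thesis using r(1) by blast
    next
      case 3
      then have "enat (Suc d) \<le> dfc M ?B" by simp
      then obtain r where r: "r > 0" "\<And>\<nu>. cmod \<nu> < r \<Longrightarrow> enat (Suc d) \<le> dfc M (shifted ?B \<nu>)"
        by (rule kato_on_dfc_lower[OF opB e(2)[OF mu]]) blast
      have "Q \<nu> = Q \<mu>" if "cmod (\<nu> - \<mu>) < r" for \<nu>
        using r(2)[OF that] 3 unfolding Q_def shift by auto
      then show ?thesis using r(1) by blast
    qed
  qed
  have "\<exists>T. openin (top_of_set (ball 0 e)) T \<and> \<mu> \<in> T \<and> (\<forall>\<nu>\<in>T. Q \<nu> = Q \<mu>)"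
    if mu: "\<mu> \<in> ball 0 e" for \<mu>
  proof -
    obtain r where r: "r > 0" "\<And>\<nu>. cmod (\<nu> - \<mu>) < r \<Longrightarrow> Q \<nu> = Q \<mu>" using local[of \<mu>] mu by auto
    show ?thesis
    proof (intro exI conjI ballI)
      show "openin (top_of_set (ball 0 e)) (ball 0 e \<inter> ball \<mu> r)" by (simp add: openin_open_Int)
      show "\<mu> \<in> ball 0 e \<inter> ball \<mu> r" using mu r(1) by simp
      show "Q \<nu> = Q \<mu>" if "\<nu> \<in> ball 0 e \<inter> ball \<mu> r" for \<nu>
        using that by (intro r(2)) (auto simp: dist_norm norm_minus_commute)
    qed
  qed
  then have "Q constant_on ball 0 e" by (intro locally_constant_imp_constant) auto
  then have "Q \<mu>1 = Q 0" using mu1(1) e(1) unfolding constant_on_def by auto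
  then have "Q 0" using nd by (simp add: Q_def)
  then show ?thesis unfolding Q_def fredholm_on_iff[OF op] by simp
qed

section \<open>B-Fredholm, Drazin invertible and Kato type operators\<close>

lemma operator_on_UNIV: "bounded_clinear S \<Longrightarrow> operator_on UNIV S"
  by (simp add: operator_on_def)

lemma nul_eq_0_iff:
  assumes "operator_on Y A" shows "nul Y A = 0 \<longleftrightarrow> kernel_on Y A \<subseteq> {0}"
  by (intro qdim_eq_0_iff csubspace_kernel_on complex_vector.subspace_single_0 operator_onD[OF assms])

lemma dfc_eq_0_iff:
  assumes "operator_on Y A" shows "dfc Y A = 0 \<longleftrightarrow> A ` Y = Y"
proof -
  have "dfc Y A = 0 \<longleftrightarrow> Y \<subseteq> A ` Y"
    by (intro qdim_eq_0_iff csubspace_image operator_onD[OF assms])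
  then show ?thesis using operator_onD(4)[OF assms] by blast
qed

lemma invertible_on_iff:
  assumes op: "operator_on Y A"
  shows "invertible_on Y A \<longleftrightarrow> nul Y A = 0 \<and> dfc Y A = 0"
proof
  note A = operator_onD[OF op]
  assume "invertible_on Y A"
  then obtain R where R: "R ` Y \<subseteq> Y" "\<forall>c. \<forall>x\<in>Y. R (c *\<^sub>C x) = c *\<^sub>C R x"
      "\<forall>x\<in>Y. R (A x) = x \<and> A (R x) = x"
    unfolding invertible_on_def by blast
  have "R 0 = 0" using R(2) complex_vector.subspace_0[OF A(2)] by (metis complex_vector.scale_zero_left)
  then have "kernel_on Y A \<subseteq> {0}" using R(3) by (force simp: kernel_on_def)
  moreover have "A ` Y = Y"
  proof (rule antisym[OF A(4)])
    show "Y \<subseteq> A ` Y"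
    proof
      fix y assume "y \<in> Y"
      then have "R y \<in> Y" "y = A (R y)" using R by auto
      then show "y \<in> A ` Y" by blast
    qed
  qed
  ultimately show "nul Y A = 0 \<and> dfc Y A = 0" using nul_eq_0_iff[OF op] dfc_eq_0_iff[OF op] by simp
next
  note A = operator_onD[OF op]
  interpret A: bounded_clinear A by (rule A)
  assume "nul Y A = 0 \<and> dfc Y A = 0"
  then have ker: "kernel_on Y A \<subseteq> {0}" and onto: "A ` Y = Y"
    using nul_eq_0_iff[OF op] dfc_eq_0_iff[OF op] by auto
  have inj: "inj_on A Y"
  proof (rule inj_onI)
    fix x y assume xy: "x \<in> Y" "y \<in> Y" "A x = A y"
    then have "x - y \<in> kernel_on Y A"
      using complex_vector.subspace_diff[OF A(2)] by (simp add: kernel_on_def A.diff)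
    then show "x = y" using ker by auto
  qed
  obtain c where c: "lifts A Y Y c"
    by (rule open_mapping_subspace[OF A.bounded_linear_axioms csubspace_imp_subspace[OF A(2)] A(3) A(3) onto])
  define R where "R = inv_into Y A"
  have RY: "R y \<in> Y" "A (R y) = y" if "y \<in> Y" for y
    unfolding R_def using that onto inv_into_into[of y A Y] f_inv_into_f[of y A Y] by auto
  have RA: "R (A x) = x" if "x \<in> Y" for x
    unfolding R_def using inv_into_f_f[OF inj that] .
  have Req: "R y = x" if "x \<in> Y" "A x = y" for x y using RA that by blast
  show "invertible_on Y A"
    unfolding invertible_on_def
  proof (intro exI[of _ R] conjI ballI allI)
    show "R ` Y \<subseteq> Y" using RY by blast
    show "R (x + y) = R x + R y" if "x \<in> Y" "y \<in> Y" for x y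
      using RY that complex_vector.subspace_add[OF A(2)] by (intro Req) (auto simp: A.add)
    show "R (a *\<^sub>C x) = a *\<^sub>C R x" if "x \<in> Y" for a x
      using RY that complex_vector.subspace_scale[OF A(2)] by (intro Req) (auto simp: A.scaleC)
    show "\<exists>K. \<forall>x\<in>Y. norm (R x) \<le> K * norm x"
    proof (intro exI[of _ c] ballI)
      fix y assume "y \<in> Y"
      then obtain x where x: "x \<in> Y" "A x = y" "norm x \<le> c * norm y" using c unfolding lifts_def by blast
      then show "norm (R y) \<le> c * norm y" using Req[OF x(1,2)] by simp
    qed
    show "R (A x) = x" "A (R x) = x" if "x \<in> Y" for x using RA RY that by auto
  qed
qed

section \<open>Transfer between the whole space and ranges of powers\<close>

lemma shifted_preimage_range:
  fixes S :: "'a::complex_banach \<Rightarrow> 'a"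
  assumes S: "bounded_clinear S" and mu: "\<mu> \<noteq> 0" and x: "shifted S \<mu> x \<in> range (S ^^ k)"
  shows "x \<in> range (S ^^ k)"
  using x
proof (induction k)
  case (Suc k)
  interpret bounded_clinear S by fact
  note op = operator_on_UNIV[OF S]
  have "shifted S \<mu> x \<in> range (S ^^ k)"
    using Suc.prems funpow_image_decreasing[of S UNIV k "Suc k"] by (meson le_SucI order.refl subset_UNIV subsetD)
  then have "x \<in> range (S ^^ k)" by (rule Suc.IH)
  then have Sx: "S x \<in> range (S ^^ Suc k)" unfolding funpow_Suc_image(1) by blast
  have "S x - shifted S \<mu> x \<in> range (S ^^ Suc k)"
    by (rule complex_vector.subspace_diff[OF csubspace_funpow_image[OF op] Sx Suc.prems])
  then have "inverse \<mu> *\<^sub>C (S x - shifted S \<mu> x) \<in> range (S ^^ Suc k)"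
    by (rule complex_vector.subspace_scale[OF csubspace_funpow_image[OF op]])
  then show ?case using mu by simp
qed simp

text \<open>For \<open>\<mu> \<noteq> 0\<close> the polynomials \<open>z\<^sup>k\<close> and \<open>z - \<mu>\<close> are coprime.\<close>

lemma range_sum_shifted:
  fixes S :: "'a::complex_banach \<Rightarrow> 'a"
  assumes S: "bounded_clinear S" and mu: "\<mu> \<noteq> 0"
  shows "subspace_sum (range (S ^^ k)) (range (shifted S \<mu>)) = UNIV"
proof (induction k)
  case 0
  show ?case using subspace_sum_superset1[OF csubspace_image[OF bounded_clinear_shifted[OF S] complex_vector.subspace_UNIV], of UNIV \<mu>]
    by auto
next
  case (Suc k)
  interpret bounded_clinear S by fact
  interpret P: bounded_clinear "S ^^ k" by (rule bounded_clinear_funpow[OF S])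
  interpret Q: bounded_clinear "shifted S \<mu>" by (rule bounded_clinear_shifted[OF S])
  show ?case
  proof (intro UNIV_eq_I[symmetric])
    fix x
    have "x \<in> subspace_sum (range (S ^^ k)) (range (shifted S \<mu>))" using Suc by simp
    then obtain a b where ab: "x = (S ^^ k) a + shifted S \<mu> b" unfolding subspace_sum_def by blast
    \<comment> \<open>One more power is gained from \<mu> y = S y - (S - \<mu>) y, with y the k-th
      power applied to a.\<close>
    have "(S ^^ k) a = inverse \<mu> *\<^sub>C (S ((S ^^ k) a) - shifted S \<mu> ((S ^^ k) a))" using mu by simp
    also have "\<dots> = (S ^^ Suc k) (inverse \<mu> *\<^sub>C a) + shifted S \<mu> (- inverse \<mu> *\<^sub>C (S ^^ k) a)"
      by (simp add: P.scaleC scaleC complex_vector.scale_right_diff_distrib neg)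
    finally have a: "(S ^^ k) a = (S ^^ Suc k) (inverse \<mu> *\<^sub>C a) + shifted S \<mu> (- inverse \<mu> *\<^sub>C (S ^^ k) a)" .
    note ab
    also have "(S ^^ k) a + shifted S \<mu> b =
        (S ^^ Suc k) (inverse \<mu> *\<^sub>C a) + shifted S \<mu> (- inverse \<mu> *\<^sub>C (S ^^ k) a) + shifted S \<mu> b"
      by (rule arg_cong[OF a])
    also have "\<dots> = (S ^^ Suc k) (inverse \<mu> *\<^sub>C a) + shifted S \<mu> (- inverse \<mu> *\<^sub>C (S ^^ k) a + b)"
      by (simp only: Q.add add.assoc)
    finally have "x = (S ^^ Suc k) (inverse \<mu> *\<^sub>C a) + shifted S \<mu> (- inverse \<mu> *\<^sub>C (S ^^ k) a + b)" .
    then show "x \<in> subspace_sum (range (S ^^ Suc k)) (range (shifted S \<mu>))"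
      unfolding subspace_sum_def by blast
  qed
qed

text \<open>Eigenvectors lie in the range Y of S^k. With B = S - \<mu>, the whole space is Y + R(B),
  so its quotient by R(B) is Y / (Y \<inter> R(B)), and Y \<inter> R(B) is the image of Y under
  B.\<close>

lemma nul_dfc_range:
  fixes S :: "'a::complex_banach \<Rightarrow> 'a"
  assumes S: "bounded_clinear S" and mu: "\<mu> \<noteq> 0"
  shows "kernel_on UNIV (shifted S \<mu>) = kernel_on (range (S ^^ k)) (shifted S \<mu>)"
    and "dfc UNIV (shifted S \<mu>) = dfc (range (S ^^ k)) (shifted S \<mu>)"
proof -
  note op = operator_on_UNIV[OF S]
  let ?Y = "range (S ^^ k)" and ?B = "shifted S \<mu>"
  have Y: "csubspace ?Y" by (rule csubspace_funpow_image[OF op])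
  have B: "bounded_clinear ?B" by (rule bounded_clinear_shifted[OF S])
  have BX: "csubspace (range ?B)" by (rule csubspace_image[OF B complex_vector.subspace_UNIV])
  show "kernel_on UNIV ?B = kernel_on ?Y ?B"
    using kernel_shifted_subset_funpow[OF op mu, of k] kernel_on_subspace[of ?Y UNIV ?B] by auto
  have BY: "?B ` ?Y \<subseteq> ?Y"
  proof -
    have "S ` ?Y \<subseteq> ?Y"
      using funpow_image_decreasing[of S UNIV k "Suc k"] unfolding funpow_Suc_image(1) by simp
    then show ?thesis
      by (auto intro!: complex_vector.subspace_diff[OF Y] complex_vector.subspace_scale[OF Y] simp del: funpow.simps)
  qed
  have eq: "?Y \<inter> range ?B = ?B ` ?Y"
  proof
    show "?Y \<inter> range ?B \<subseteq> ?B ` ?Y"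
    proof
      fix y assume y: "y \<in> ?Y \<inter> range ?B"
      then obtain x where x: "y = ?B x" by auto
      then have "x \<in> ?Y" using y shifted_preimage_range[OF S mu, of x k] by simp
      then show "y \<in> ?B ` ?Y" using x by blast
    qed
    show "?B ` ?Y \<subseteq> ?Y \<inter> range ?B" using BY by blast
  qed
  have "dfc UNIV ?B = qdim (subspace_sum ?Y (range ?B)) (range ?B)"
    using range_sum_shifted[OF S mu, of k] by simp
  also have "\<dots> = qdim ?Y (range ?B)" by (rule qdim_subspace_sum[OF BX BX order.refl])
  also have "\<dots> = dfc ?Y ?B" unfolding eq[symmetric] by (rule qdim_Int[OF Y, symmetric])
  finally show "dfc UNIV ?B = dfc ?Y ?B" .
qed

text \<open>Bijectivity of S on the range of S^m makes S^m bijective there. So every x agrees, up to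
  the kernel of S^m, with a unique element of the range: range and kernel of S^m form the reducing
  pair.\<close>

lemma drazin_invertible_if_bijective_range:
  fixes S :: "'a::complex_banach \<Rightarrow> 'a"
  assumes S: "bounded_clinear S" and cl: "closed (range (S ^^ m))"
    and "nul (range (S ^^ m)) S = 0" "dfc (range (S ^^ m)) S = 0"
  shows "drazin_invertible S"
proof -
  let ?Y = "range (S ^^ m)" and ?N = "kernel_on UNIV (S ^^ m)"
  have op: "operator_on ?Y S" by (rule operator_on_funpow_image[OF operator_on_UNIV[OF S] cl])
  have inv: "invertible_on ?Y S" using invertible_on_iff[OF op] assms by simp
  have ker: "kernel_on ?Y S \<subseteq> {0}" and onto: "S ` ?Y = ?Y"
    using nul_eq_0_iff[OF op] dfc_eq_0_iff[OF op] assms by auto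
  have SP: "bounded_clinear (S ^^ m)" by (rule bounded_clinear_funpow[OF S])
  interpret P: bounded_clinear "S ^^ m" by fact
  interpret S: bounded_clinear S by fact
  have N: "csubspace ?N" "closed ?N" by (auto intro: csubspace_kernel_on closed_kernel_on SP)
  have inj: "y = 0" if "y \<in> ?Y" "(S ^^ j) y = 0" for y j
    using that
  proof (induction j arbitrary: y)
    case (Suc j)
    have "(S ^^ j) (S y) = 0" using Suc.prems(2) by (simp add: funpow_swap1)
    moreover have "S y \<in> ?Y" using imageI[OF Suc.prems(1), of S] unfolding onto .
    ultimately have "S y = 0" by (rule Suc.IH[rotated])
    then show ?case using ker Suc.prems(1) by (auto simp: kernel_on_def)
  qed simp
  have surj: "(S ^^ j) ` ?Y = ?Y" for j
  proof (induction j)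
    case (Suc j)
    then show ?case unfolding funpow_Suc_image(1)[of j S ?Y] using onto by simp
  qed simp
  have "direct_sum UNIV ?Y ?N"
    unfolding direct_sum_def
  proof (intro conjI)
    show "?Y \<inter> ?N = {0}"
    proof
      show "?Y \<inter> ?N \<subseteq> {0}"
      proof
        fix x assume "x \<in> ?Y \<inter> ?N"
        then have "x \<in> ?Y" "(S ^^ m) x = 0" unfolding kernel_on_def by blast+
        then show "x \<in> {0}" using inj by blast
      qed
      show "{0} \<subseteq> ?Y \<inter> ?N"
        using complex_vector.subspace_0[OF N(1)] complex_vector.subspace_0[OF operator_onD(2)[OF op]] by blast
    qed
    show "UNIV = {a + b |a b. a \<in> ?Y \<and> b \<in> ?N}"
    proof (intro UNIV_eq_I)
      fix x
      have "(S ^^ m) x \<in> (S ^^ m) ` ?Y" unfolding surj by blast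
      then obtain y where y: "y \<in> ?Y" "(S ^^ m) x = (S ^^ m) y" by blast
      then have "x - y \<in> ?N" by (simp add: kernel_on_def P.diff)
      then show "x \<in> {a + b |a b. a \<in> ?Y \<and> b \<in> ?N}"
        using y(1) by (intro CollectI exI[of _ y] exI[of _ "x - y"]) simp
    qed
  qed (use N operator_onD(2)[OF op] in auto)
  moreover have "S ` ?N \<subseteq> ?N"
    by (auto simp: kernel_on_def funpow_swap1[symmetric] S.zero)
  ultimately have "(?Y, ?N) \<in> Red S"
    using cl N(2) operator_onD(4)[OF op] by (simp add: Red_def)
  moreover have "nilpotent_on ?N S" by (auto simp: nilpotent_on_def kernel_on_def)
  ultimately show ?thesis using inv unfolding drazin_invertible_def by blast
qed

lemma Red_operator_on:
  fixes S :: "'a::complex_banach \<Rightarrow> 'a"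
  assumes "bounded_clinear S" "(M, N) \<in> Red S" shows "operator_on M S"
  using assms by (auto simp: Red_def operator_on_def direct_sum_def)

lemma range_funpow_Red:
  fixes S :: "'a::complex_banach \<Rightarrow> 'a"
  assumes S: "bounded_clinear S" and MN: "(M, N) \<in> Red S" and k: "\<And>x. x \<in> N \<Longrightarrow> (S ^^ k) x = 0"
  shows "range (S ^^ k) = (S ^^ k) ` M"
proof
  interpret P: bounded_clinear "S ^^ k" by (rule bounded_clinear_funpow[OF S])
  show "range (S ^^ k) \<subseteq> (S ^^ k) ` M"
  proof
    fix y assume "y \<in> range (S ^^ k)"
    then obtain x where x: "y = (S ^^ k) x" by blast
    have "x \<in> {m + n | m n. m \<in> M \<and> n \<in> N}" using MN by (auto simp: Red_def direct_sum_def)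
    then obtain m n where mn: "m \<in> M" "n \<in> N" "x = m + n" by blast
    then have "y = (S ^^ k) m" using x k by (simp add: P.add)
    then show "y \<in> (S ^^ k) ` M" using mn by blast
  qed
qed auto

text \<open>With k a nilpotency exponent on N, the k-th power kills N and maps M onto itself, so its
  range is M.\<close>

lemma drazin_invertibleE:
  fixes S :: "'a::complex_banach \<Rightarrow> 'a"
  assumes S: "bounded_clinear S" and dr: "drazin_invertible S"
  obtains k where "operator_on (range (S ^^ k)) S" "nul (range (S ^^ k)) S = 0" "dfc (range (S ^^ k)) S = 0"
proof -
  obtain M N k where MN: "(M, N) \<in> Red S" "invertible_on M S" and k: "\<And>x. x \<in> N \<Longrightarrow> (S ^^ k) x = 0"
    using dr by (auto simp: drazin_invertible_def nilpotent_on_def)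
  have op: "operator_on M S" by (rule Red_operator_on[OF S MN(1)])
  have z: "nul M S = 0" "dfc M S = 0" using MN(2) invertible_on_iff[OF op] by auto
  then have "S ` M = M" using dfc_eq_0_iff[OF op] by simp
  then have "(S ^^ j) ` M = M" for j
  proof (induction j)
    case (Suc j)
    then show ?case unfolding funpow_Suc_image(1)[of j S M] using \<open>S ` M = M\<close> by simp
  qed simp
  then have "range (S ^^ k) = M" using range_funpow_Red[OF S MN(1) k] by simp
  then show ?thesis using that[of k] op z by simp
qed

lemma drazin_imp_b_weyl:
  fixes S :: "'a::complex_banach \<Rightarrow> 'a"
  assumes S: "bounded_clinear S" and dr: "drazin_invertible S" shows "b_weyl S"
proof -
  obtain k where k: "operator_on (range (S ^^ k)) S" "nul (range (S ^^ k)) S = 0" "dfc (range (S ^^ k)) S = 0"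
    using drazin_invertibleE[OF S dr] .
  have "weyl_on (range (S ^^ k)) S"
    using k(2,3) unfolding weyl_on_iff[OF k(1)] fredholm_on_iff[OF k(1)] by simp
  then show ?thesis unfolding b_weyl_def using operator_onD(3)[OF k(1)] by blast
qed

lemma drazin_imp_kato_type:
  fixes S :: "'a::complex_banach \<Rightarrow> 'a"
  assumes S: "bounded_clinear S" and dr: "drazin_invertible S" shows "kato_type S"
proof -
  obtain M N where MN: "(M, N) \<in> Red S" "invertible_on M S" "nilpotent_on N S"
    using dr by (auto simp: drazin_invertible_def)
  have op: "operator_on M S" by (rule Red_operator_on[OF S MN(1)])
  have "kernel_on M S \<subseteq> {0}" "S ` M = M"
    using MN(2) invertible_on_iff[OF op] nul_eq_0_iff[OF op] dfc_eq_0_iff[OF op] by auto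
  moreover have "{0} \<subseteq> (S ^^ n) ` M" for n
    using complex_vector.subspace_0[OF csubspace_funpow_image[OF op]] by simp
  ultimately have "kato_on M S"
    unfolding kato_on_def using operator_onD(3)[OF op] by (metis order.trans)
  then show ?thesis using MN unfolding kato_type_def by blast
qed

lemma drazin_punctured:
  fixes S :: "'a::complex_banach \<Rightarrow> 'a"
  assumes S: "bounded_clinear S" and dr: "drazin_invertible S"
  obtains e where "e > 0" "\<And>\<mu>. \<mu> \<noteq> 0 \<Longrightarrow> cmod \<mu> < e \<Longrightarrow> nul UNIV (shifted S \<mu>) = 0 \<and> dfc UNIV (shifted S \<mu>) = 0"
proof -
  obtain k where k: "operator_on (range (S ^^ k)) S" "nul (range (S ^^ k)) S = 0" "dfc (range (S ^^ k)) S = 0"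
    using drazin_invertibleE[OF S dr] .
  let ?Y = "range (S ^^ k)"
  have "fredholm_on ?Y S" using k(2,3) fredholm_on_iff[OF k(1)] by simp
  then obtain e where e: "e > 0" "\<And>\<mu>. cmod \<mu> < e \<Longrightarrow>
      nul ?Y (shifted S \<mu>) \<le> nul ?Y S \<and> dfc ?Y (shifted S \<mu>) \<le> dfc ?Y S"
    by (rule fredholm_stable[OF k(1)]) blast
  show ?thesis
  proof (rule that[OF e(1)])
    fix \<mu> :: complex assume mu: "\<mu> \<noteq> 0" "cmod \<mu> < e"
    then show "nul UNIV (shifted S \<mu>) = 0 \<and> dfc UNIV (shifted S \<mu>) = 0"
      using e(2)[OF mu(2)] nul_dfc_range[OF S mu(1), of k] k(2,3) by simp
  qed
qed

lemma b_weyl_imp_b_fredholm: "b_weyl S \<Longrightarrow> b_fredholm S"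
  by (auto simp: b_weyl_def b_fredholm_def weyl_on_def)

text \<open>The constants n and d are nullity and deficiency on a range deep enough for S to be Kato
  there. The index does not change on the way down, so n = d also decides the Weyl property at the
  originally given power k, which is what a B-Weyl point provides.\<close>

theorem b_fredholm_punctured:
  fixes S :: "'a::complex_banach \<Rightarrow> 'a"
  assumes S: "bounded_clinear S" and cl: "closed (range (S ^^ k))" and fr: "fredholm_on (range (S ^^ k)) S"
  obtains n d e where "e > 0"
    "\<And>\<mu>. \<mu> \<noteq> 0 \<Longrightarrow> cmod \<mu> < e \<Longrightarrow> nul UNIV (shifted S \<mu>) = enat n \<and>
       dfc UNIV (shifted S \<mu>) = enat d \<and> kato_on UNIV (shifted S \<mu>)"
    "weyl_on (range (S ^^ k)) S \<longleftrightarrow> n = d" "n = d \<Longrightarrow> b_weyl S"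
    "n = 0 \<Longrightarrow> d = 0 \<Longrightarrow> drazin_invertible S"
proof -
  have op: "operator_on (range (S ^^ k)) S" by (rule operator_on_funpow_image[OF operator_on_UNIV[OF S] cl])
  obtain j where j: "kato_on ((S ^^ j) ` range (S ^^ k)) S" using fredholm_on_imp_kato_on[OF op fr] .
  define m where "m = j + k"
  let ?Y = "range (S ^^ m)"
  have Y: "?Y = (S ^^ j) ` range (S ^^ k)" unfolding m_def by (simp only: funpow_add image_comp)
  have kt: "kato_on ?Y S" and opY: "operator_on ?Y S" and frY: "fredholm_on ?Y S"
    and w: "weyl_on ?Y S \<longleftrightarrow> weyl_on (range (S ^^ k)) S"
    using j fredholm_on_funpow_image[OF op fr, of j] unfolding Y by auto
  obtain n d where nd: "nul ?Y S = enat n" "dfc ?Y S = enat d" using frY fredholm_on_iff[OF opY] by auto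
  have wn: "weyl_on ?Y S \<longleftrightarrow> n = d" using weyl_on_iff[OF opY] frY nd by simp
  obtain e1 where e1: "e1 > 0" "\<And>\<mu>. cmod \<mu> < e1 \<Longrightarrow> kato_on ?Y (shifted S \<mu>)"
    by (rule kato_on_shifted[OF opY kt]) blast
  obtain e2 where e2: "e2 > 0" "\<And>\<mu>. cmod \<mu> < e2 \<Longrightarrow>
      nul ?Y (shifted S \<mu>) = nul ?Y S \<and> dfc ?Y (shifted S \<mu>) = dfc ?Y S"
    by (rule kato_fredholm_constant[OF opY kt frY]) blast
  show ?thesis
  proof (rule that[of "min e1 e2" n d])
    show "min e1 e2 > 0" using e1 e2 by simp
    show "weyl_on (range (S ^^ k)) S \<longleftrightarrow> n = d" using w wn by simp
    show "b_weyl S" if "n = d" using that wn operator_onD(3)[OF opY] unfolding b_weyl_def by blast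
    show "drazin_invertible S" if "n = 0" "d = 0"
      using that nd operator_onD(3)[OF opY]
      by (intro drazin_invertible_if_bijective_range[OF S]) (auto simp: zero_enat_def)
    fix \<mu> :: complex assume mu: "\<mu> \<noteq> 0" "cmod \<mu> < min e1 e2"
    let ?B = "shifted S \<mu>"
    note tr = nul_dfc_range[OF S mu(1), of m]
    have 1: "nul UNIV ?B = enat n" "dfc UNIV ?B = enat d" using e2(2)[of \<mu>] mu nd tr by auto
    have ktB: "kato_on ?Y ?B" using e1(2)[of \<mu>] mu by simp
    \<comment> \<open>On the whole space closedness comes from finite codimension; the kernel
      inclusions are inherited from \<open>?Y\<close>, as both kernels coincide.\<close>
    have "closed (range ?B)"
      by (rule closed_image_finite_codim[OF bounded_clinear_shifted[OF S]]) (use 1 in auto)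
    moreover have "kernel_on UNIV ?B \<subseteq> range (?B ^^ i)" for i
      unfolding tr(1) using ktB unfolding kato_on_def by blast
    ultimately show "nul UNIV ?B = enat n \<and> dfc UNIV ?B = enat d \<and> kato_on UNIV ?B"
      using 1 by (simp add: kato_on_def)
  qed
qed

text \<open>Fredholmness of the nearby shifts passes from the whole space to the Kato summand M,
  where the limit theorem applies. Then S is Fredholm on M, hence on the image of M under S^k, which
  is the full range once S^k kills N.\<close>

lemma kato_type_b_fredholm_limit:
  fixes S :: "'a::complex_banach \<Rightarrow> 'a"
  assumes S: "bounded_clinear S" and kt: "kato_type S"
    and lim: "\<And>e. e > 0 \<Longrightarrow> \<exists>\<mu>. cmod \<mu> < e \<and> fredholm_on UNIV (shifted S \<mu>)"
  shows "b_fredholm S"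
proof -
  obtain M N k where MN: "(M, N) \<in> Red S" "kato_on M S" and k: "\<And>x. x \<in> N \<Longrightarrow> (S ^^ k) x = 0"
    using kt by (auto simp: kato_type_def nilpotent_on_def)
  have op: "operator_on M S" by (rule Red_operator_on[OF S MN(1)])
  note M = operator_onD[OF op]
  have N: "csubspace N" "M \<inter> N = {0}" "UNIV = {m + n | m n. m \<in> M \<and> n \<in> N}" "S ` N \<subseteq> N"
    using MN(1) by (auto simp: Red_def direct_sum_def)
  have "fredholm_on M (shifted S \<mu>)" if fr: "fredholm_on UNIV (shifted S \<mu>)" for \<mu>
  proof -
    let ?B = "shifted S \<mu>"
    have B: "operator_on M ?B" "operator_on UNIV ?B"
      using operator_on_shifted op operator_on_UNIV[OF S] by auto
    interpret B: bounded_clinear ?B by (rule operator_onD(1)[OF B(1)])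
    \<comment> \<open>If B x lies in M, the N-component of x is mapped into M \<inter> N and so to
      0.\<close>
    have eq: "M \<inter> range ?B = ?B ` M"
    proof
      show "M \<inter> range ?B \<subseteq> ?B ` M"
      proof
        fix y assume y: "y \<in> M \<inter> range ?B"
        then obtain x where x: "y = ?B x" by auto
        have "x \<in> {m + n | m n. m \<in> M \<and> n \<in> N}" using N(3) by blast
        then obtain m n where mn: "m \<in> M" "n \<in> N" "x = m + n" by blast
        have Bm: "?B m \<in> M" using operator_onD(4)[OF B(1)] mn(1) by blast
        have sum: "?B n = y - ?B m" unfolding x mn(3) by (simp only: B.add) simp
        then have "?B n \<in> M" using y Bm complex_vector.subspace_diff[OF M(2)] by simp
        moreover have "?B n \<in> N"
          using mn(2) N(4) complex_vector.subspace_scale[OF N(1)] by (intro complex_vector.subspace_diff[OF N(1)]) auto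
        ultimately have "?B n = 0" using N(2) by blast
        then show "y \<in> ?B ` M" using sum mn(1) by force
      qed
      show "?B ` M \<subseteq> M \<inter> range ?B" using operator_onD(4)[OF B(1)] by blast
    qed
    have "nul M ?B \<le> nul UNIV ?B" by (intro qdim_mono) (auto simp: kernel_on_def)
    moreover have "dfc M ?B \<le> dfc UNIV ?B"
      unfolding eq[symmetric] qdim_Int[OF M(2)] by (rule qdim_mono) auto
    ultimately show ?thesis
      using fr unfolding fredholm_on_iff[OF B(1)] fredholm_on_iff[OF B(2)] by (metis enat_ord_simps(5))
  qed
  then have fr: "fredholm_on M S" using lim by (intro kato_fredholm_limit[OF op MN(2)]) blast
  have "range (S ^^ k) = (S ^^ k) ` M" by (rule range_funpow_Red[OF S MN(1) k])
  then show ?thesis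
    using fredholm_on_funpow_image[OF op fr, of k] operator_onD(3) unfolding b_fredholm_def by metis
qed

text \<open>For |\<kappa>| above a norm bound K of T, the operator T - \<kappa> is a perturbation of
  - \<kappa> by T with c * k = K / |\<kappa>| < 1, so it is onto; the norm bound excludes
  eigenvectors.\<close>

lemma bounded_drazin_spectrum:
  fixes T :: "'a::complex_banach \<Rightarrow> 'a"
  assumes T: "bounded_clinear T" shows "bounded (drazin_spectrum T)"
proof -
  interpret bounded_clinear T by fact
  obtain K where K: "K > 0" "\<And>x. norm (T x) \<le> norm x * K" using pos_bounded by blast
  have "cmod \<kappa> \<le> K" if l: "\<kappa> \<in> drazin_spectrum T" for \<kappa>
  proof (rule ccontr)
    assume "\<not> ?thesis"
    then have lK: "cmod \<kappa> > K" by simp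
    then have l0: "cmod \<kappa> > 0" using K by linarith
    let ?B = "shifted T \<kappa>"
    have B: "bounded_clinear ?B" by (rule bounded_clinear_shifted[OF T])
    note op = operator_on_UNIV[OF B]
    have "lifts (\<lambda>x::'a. (- \<kappa>) *\<^sub>C x) UNIV UNIV (1 / cmod \<kappa>)"
      unfolding lifts_def
    proof (intro conjI ballI)
      fix y :: 'a
      show "\<exists>x\<in>UNIV. (- \<kappa>) *\<^sub>C x = y \<and> norm x \<le> 1 / cmod \<kappa> * norm y"
        using l0 by (intro bexI[of _ "(- inverse \<kappa>) *\<^sub>C y"]) (auto simp: norm_scaleC norm_inverse divide_inverse)
    qed (use l0 in simp)
    then have "lifts (\<lambda>x. (- \<kappa>) *\<^sub>C x - (- T x)) UNIV UNIV (1 / cmod \<kappa> / (1 - 1 / cmod \<kappa> * K))"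
      using K lK l0
      by (intro lifts_perturb[where k = K] bounded_clinear.axioms(1)[OF bounded_clinear_scale]
          bounded_linear_minus bounded_linear_axioms) (auto simp: mult.commute)
    then have "range ?B = UNIV" unfolding lifts_def by (auto simp: image_iff) metis
    moreover have "kernel_on UNIV ?B \<subseteq> {0}"
    proof
      fix x assume "x \<in> kernel_on UNIV ?B"
      then have "T x = \<kappa> *\<^sub>C x" by (simp add: kernel_on_def)
      then have "cmod \<kappa> * norm x \<le> K * norm x" using K(2)[of x] by (simp add: norm_scaleC mult.commute)
      then show "x \<in> {0}" using lK by (simp add: mult_le_cancel_right)
    qed
    ultimately have "drazin_invertible ?B"
      using nul_eq_0_iff[OF op] dfc_eq_0_iff[OF op]
      by (intro drazin_invertible_if_bijective_range[OF B, of 0]) auto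
    then show False using l by (simp add: drazin_spectrum_def)
  qed
  then show ?thesis by (auto intro: boundedI)
qed

text \<open>An unbounded component of the complement of K cannot stay inside the bounded D. If it
  met D it would, being connected, meet the frontier of D, which lies in K.\<close>

lemma connected_hull_eq:
  assumes bd: "bounded D" and KD: "K \<subseteq> D" and fr: "frontier D \<subseteq> K"
  shows "connected_hull K = connected_hull D"
proof -
  have "outside K \<subseteq> outside D"
  proof
    fix x assume "x \<in> outside K"
    then have x: "x \<notin> K" and ub: "\<not> bounded (connected_component_set (- K) x)"
      by (auto simp: outside_def)
    let ?C = "connected_component_set (- K) x"
    have xC: "x \<in> ?C" using x by (simp add: connected_component_refl)
    have CK: "?C \<subseteq> - K" by (rule connected_component_subset)
    have "?C \<inter> D = {}"
    proof (rule ccontr)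
      assume "?C \<inter> D \<noteq> {}"
      moreover have "?C - D \<noteq> {}" using ub bd bounded_subset by blast
      ultimately have "?C \<inter> frontier D \<noteq> {}"
        by (intro connected_Int_frontier connected_connected_component)
      then show False using fr CK by blast
    qed
    then have "?C \<subseteq> connected_component_set (- D) x"
      using xC by (intro connected_component_maximal connected_connected_component) auto
    moreover have "x \<notin> D" using xC \<open>?C \<inter> D = {}\<close> by blast
    ultimately show "x \<in> outside D"
      using ub bounded_subset by (auto simp: outside_def)
  qed
  then show ?thesis using outside_mono[OF KD] by (auto simp: connected_hull_def)
qed

text \<open>Used to compare the constants of two overlapping punctured discs at a common point that
  is neither of the centres.\<close>

lemma nearby_avoiding:
  fixes x y :: complex
  assumes "dist x y < e" "d > 0"
  obtains z where "z \<noteq> x" "z \<noteq> y" "dist x z < e" "dist y z < d"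
proof -
  let ?U = "ball x e \<inter> ball y d"
  have "y \<in> ?U" using assms by simp
  then have "infinite ?U" using finite_imp_not_open[of ?U] by blast
  then have "\<not> ?U \<subseteq> {x, y}" using finite_subset by blast
  then obtain z where "z \<in> ?U" "z \<notin> {x, y}" by blast
  then show ?thesis using that[of z] by simp
qed

section \<open>Frontiers and hulls of the four spectra\<close>

theorem theorem4p7:
  fixes T :: "'a::complex_banach \<Rightarrow> 'a"
  assumes "\<not> cfinite_dim (UNIV :: 'a set)"
    and "bounded_clinear T"
  shows "frontier (drazin_spectrum T) \<subseteq> frontier (b_weyl_spectrum T) \<and>
    frontier (b_weyl_spectrum T) \<subseteq> frontier (b_fredholm_spectrum T) \<and>
    frontier (b_fredholm_spectrum T) \<subseteq> frontier (kato_type_spectrum T) \<and>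
    connected_hull (kato_type_spectrum T) = connected_hull (b_fredholm_spectrum T) \<and>
    connected_hull (b_fredholm_spectrum T) = connected_hull (b_weyl_spectrum T) \<and>
    connected_hull (b_weyl_spectrum T) = connected_hull (drazin_spectrum T)"
proof -
  let ?D = "drazin_spectrum T" and ?W = "b_weyl_spectrum T"
  let ?F = "b_fredholm_spectrum T" and ?K = "kato_type_spectrum T"
  let ?n = "\<lambda>\<nu>. nul UNIV (shifted T \<nu>)" and ?d = "\<lambda>\<nu>. dfc UNIV (shifted T \<nu>)"
  have S: "bounded_clinear (shifted T \<kappa>)" for \<kappa> by (rule bounded_clinear_shifted[OF assms(2)])
  note op = operator_on_UNIV[OF S]
  have shift: "shifted (shifted T \<kappa>) (\<nu> - \<kappa>) = shifted T \<nu>" for \<kappa> \<nu>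
    using shifted_shifted[of T \<kappa> "\<nu> - \<kappa>"] by simp
  have WD: "?W \<subseteq> ?D" and KD: "?K \<subseteq> ?D" and FW: "?F \<subseteq> ?W"
    using drazin_imp_b_weyl[OF S] drazin_imp_kato_type[OF S] b_weyl_imp_b_fredholm
    by (auto simp: drazin_spectrum_def b_weyl_spectrum_def kato_type_spectrum_def b_fredholm_spectrum_def)
  have fredholmI: "\<nu> \<notin> ?F" if "fredholm_on UNIV (shifted T \<nu>)" for \<nu>
    using that by (auto simp: b_fredholm_spectrum_def b_fredholm_def intro!: exI[of _ 0])
  have weylI: "\<nu> \<notin> ?W" if "?n \<nu> = ?d \<nu>" "?n \<nu> \<noteq> \<infinity>" for \<nu>
    using that weyl_on_iff[OF op] fredholm_on_iff[OF op]
    by (auto simp: b_weyl_spectrum_def b_weyl_def intro!: exI[of _ 0])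
  have drazinI: "\<nu> \<notin> ?D" if "?n \<nu> = 0" "?d \<nu> = 0" for \<nu>
    using drazin_invertible_if_bijective_range[OF S, of 0 \<nu>] that by (simp add: drazin_spectrum_def)
  have katoI: "\<nu> \<notin> ?K" if "kato_on UNIV (shifted T \<nu>)" for \<nu>
  proof -
    have "shifted T \<nu> 0 = 0" using linear_0[OF bounded_linear.linear[OF bounded_clinear.axioms(1)[OF S]]] .
    then have "(UNIV, {0}) \<in> Red (shifted T \<nu>)"
      by (auto simp: Red_def direct_sum_def complex_vector.subspace_single_0)
    moreover have "nilpotent_on {0} (shifted T \<nu>)" unfolding nilpotent_on_def by (intro exI[of _ 0]) simp
    ultimately show ?thesis using that unfolding kato_type_spectrum_def kato_type_def by blast
  qed
  have D_near: "\<exists>e>0. \<forall>\<nu>. \<nu> \<noteq> \<kappa> \<longrightarrow> dist \<kappa> \<nu> < e \<longrightarrow> ?n \<nu> = 0 \<and> ?d \<nu> = 0" if l: "\<kappa> \<notin> ?D" for \<kappa>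
  proof -
    have "drazin_invertible (shifted T \<kappa>)" using l by (simp add: drazin_spectrum_def)
    then obtain e where e: "e > 0" "\<And>\<mu>. \<mu> \<noteq> 0 \<Longrightarrow> cmod \<mu> < e \<Longrightarrow>
        nul UNIV (shifted (shifted T \<kappa>) \<mu>) = 0 \<and> dfc UNIV (shifted (shifted T \<kappa>) \<mu>) = 0"
      by (rule drazin_punctured[OF S]) blast
    have "?n \<nu> = 0 \<and> ?d \<nu> = 0" if "\<nu> \<noteq> \<kappa>" "dist \<kappa> \<nu> < e" for \<nu>
      using e(2)[of "\<nu> - \<kappa>"] that unfolding shift by (simp add: dist_norm norm_minus_commute)
    then show ?thesis using e(1) by blast
  qed
  \<comment> \<open>The constants of a punctured disc around a B-Fredholm point, together with what
    they decide about its centre.\<close>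
  define P where "P \<kappa> n d e \<longleftrightarrow> e > 0 \<and> (\<forall>\<nu>. \<nu> \<noteq> \<kappa> \<longrightarrow> dist \<kappa> \<nu> < e \<longrightarrow>
      ?n \<nu> = enat n \<and> ?d \<nu> = enat d \<and> kato_on UNIV (shifted T \<nu>)) \<and>
      (n = d \<longrightarrow> \<kappa> \<notin> ?W) \<and> (n = 0 \<longrightarrow> d = 0 \<longrightarrow> \<kappa> \<notin> ?D)" for \<kappa> n d and e :: real
  have F_near: "\<exists>n d e. P \<kappa> n d e \<and> (weyl_on (range (shifted T \<kappa> ^^ k)) (shifted T \<kappa>) \<longrightarrow> n = d)"
    if l: "closed (range (shifted T \<kappa> ^^ k))" "fredholm_on (range (shifted T \<kappa> ^^ k)) (shifted T \<kappa>)" for \<kappa> k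
  proof -
    obtain n d e where e: "e > 0" "\<And>\<mu>. \<mu> \<noteq> 0 \<Longrightarrow> cmod \<mu> < e \<Longrightarrow>
          nul UNIV (shifted (shifted T \<kappa>) \<mu>) = enat n \<and>
          dfc UNIV (shifted (shifted T \<kappa>) \<mu>) = enat d \<and> kato_on UNIV (shifted (shifted T \<kappa>) \<mu>)"
        "weyl_on (range (shifted T \<kappa> ^^ k)) (shifted T \<kappa>) \<longleftrightarrow> n = d" "n = d \<Longrightarrow> b_weyl (shifted T \<kappa>)"
        "n = 0 \<Longrightarrow> d = 0 \<Longrightarrow> drazin_invertible (shifted T \<kappa>)"
      by (rule b_fredholm_punctured[OF S l]) (rule that, assumption+)
    have "?n \<nu> = enat n \<and> ?d \<nu> = enat d \<and> kato_on UNIV (shifted T \<nu>)"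
      if "\<nu> \<noteq> \<kappa>" "dist \<kappa> \<nu> < e" for \<nu>
      using e(2)[of "\<nu> - \<kappa>"] that unfolding shift by (simp add: dist_norm norm_minus_commute)
    moreover have "n = d \<longrightarrow> \<kappa> \<notin> ?W" "n = 0 \<longrightarrow> d = 0 \<longrightarrow> \<kappa> \<notin> ?D"
      using e(4,5) by (auto simp: b_weyl_spectrum_def drazin_spectrum_def)
    ultimately have "P \<kappa> n d e" using e(1) unfolding P_def by blast
    then show ?thesis using e(3) by blast
  qed
  have Phi_near: "\<exists>n d e. P \<kappa> n d e" if l: "\<kappa> \<notin> ?F" for \<kappa>
  proof -
    obtain k where "closed (range (shifted T \<kappa> ^^ k))" "fredholm_on (range (shifted T \<kappa> ^^ k)) (shifted T \<kappa>)"
      using l by (auto simp: b_fredholm_spectrum_def b_fredholm_def)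
    from F_near[OF this] show ?thesis by blast
  qed
  have W_near: "\<exists>e>0. \<forall>\<nu>. \<nu> \<noteq> \<kappa> \<longrightarrow> dist \<kappa> \<nu> < e \<longrightarrow> ?n \<nu> = ?d \<nu> \<and> ?n \<nu> \<noteq> \<infinity>" if l: "\<kappa> \<notin> ?W" for \<kappa>
  proof -
    obtain k where k: "closed (range (shifted T \<kappa> ^^ k))" "weyl_on (range (shifted T \<kappa> ^^ k)) (shifted T \<kappa>)"
      using l by (auto simp: b_weyl_spectrum_def b_weyl_def)
    then have "fredholm_on (range (shifted T \<kappa> ^^ k)) (shifted T \<kappa>)" by (simp add: weyl_on_def)
    from F_near[OF k(1) this] k(2) obtain n e where "P \<kappa> n n e" by blast
    then show ?thesis unfolding P_def by (intro exI[of _ e]) simp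
  qed
  have closedI: "closed X" if "\<And>x. x \<notin> X \<Longrightarrow> \<exists>e>0. \<forall>y. y \<noteq> x \<longrightarrow> dist x y < e \<longrightarrow> y \<notin> X" for X :: "complex set"
    unfolding closed_def open_contains_ball using that by (metis ComplD ComplI mem_ball subsetI)
  have cD: "closed ?D" using D_near drazinI by (intro closedI) metis
  have cW: "closed ?W" using W_near weylI by (intro closedI) metis
  have cF: "closed ?F"
  proof (rule closedI)
    fix x assume "x \<notin> ?F"
    then obtain n d e where "P x n d e" using Phi_near by blast
    then have e: "e > 0" "\<And>\<nu>. \<nu> \<noteq> x \<Longrightarrow> dist x \<nu> < e \<Longrightarrow> ?n \<nu> = enat n \<and> ?d \<nu> = enat d"
      unfolding P_def by simp_all
    then have "y \<notin> ?F" if "y \<noteq> x" "dist x y < e" for y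
      using that by (intro fredholmI) (simp add: fredholm_on_iff[OF op])
    then show "\<exists>e>0. \<forall>y. y \<noteq> x \<longrightarrow> dist x y < e \<longrightarrow> y \<notin> ?F" using e(1) by blast
  qed
  have frontierD: "\<exists>y. y \<notin> X \<and> dist x y < e" if "x \<in> frontier X" "e > 0" for X :: "complex set" and x e
    using that by (auto simp: frontier_straddle)
  have frontier_mem: "frontier X \<subseteq> X" if "closed X" for X :: "complex set"
    using that by (rule frontier_subset_closed)
  have frontierI: "x \<in> frontier X" if "x \<in> X" "\<And>e. e > 0 \<Longrightarrow> \<exists>y. y \<notin> X \<and> dist x y < e"
    for X :: "complex set" and x
    using that by (auto simp: frontier_straddle intro!: bexI[of _ x])
  have DW: "frontier ?D \<subseteq> frontier ?W"
  proof
    fix x assume x: "x \<in> frontier ?D"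
    show "x \<in> frontier ?W"
    proof (rule frontierI)
      show "x \<in> ?W"
      proof (rule ccontr)
        assume "x \<notin> ?W"
        then have "x \<notin> ?F" using FW by blast
        then obtain n d e where "P x n d e" using Phi_near by blast
        then have e: "e > 0" "\<And>\<nu>. \<nu> \<noteq> x \<Longrightarrow> dist x \<nu> < e \<Longrightarrow> ?n \<nu> = enat n \<and> ?d \<nu> = enat d"
            "n = 0 \<Longrightarrow> d = 0 \<Longrightarrow> x \<notin> ?D"
          unfolding P_def by simp_all
        \<comment> \<open>Both numbers vanish near y and equal n and d near x. A point z common to
          both punctured discs gives n = d = 0, which excludes x from the closed set
          \<open>?D\<close>.\<close>
        obtain y where y: "y \<notin> ?D" "dist x y < e" using frontierD[OF x e(1)] by blast
        obtain e' where e': "e' > 0" "\<And>\<nu>. \<nu> \<noteq> y \<Longrightarrow> dist y \<nu> < e' \<Longrightarrow> ?n \<nu> = 0 \<and> ?d \<nu> = 0"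
          using D_near[OF y(1)] by blast
        obtain z where "z \<noteq> x" "z \<noteq> y" "dist x z < e" "dist y z < e'"
          using nearby_avoiding[OF y(2) e'(1)] .
        then have "n = 0" "d = 0" using e(2)[of z] e'(2)[of z] by (auto simp: zero_enat_def)
        then show False using e(3) frontier_mem[OF cD] x by blast
      qed
      show "\<exists>y. y \<notin> ?W \<and> dist x y < e" if "e > 0" for e using frontierD[OF x that] WD by blast
    qed
  qed
  have WF: "frontier ?W \<subseteq> frontier ?F"
  proof
    fix x assume x: "x \<in> frontier ?W"
    show "x \<in> frontier ?F"
    proof (rule frontierI)
      show "x \<in> ?F"
      proof (rule ccontr)
        assume "x \<notin> ?F"
        then obtain n d e where "P x n d e" using Phi_near by blast
        then have e: "e > 0" "\<And>\<nu>. \<nu> \<noteq> x \<Longrightarrow> dist x \<nu> < e \<Longrightarrow> ?n \<nu> = enat n \<and> ?d \<nu> = enat d"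
            "n = d \<Longrightarrow> x \<notin> ?W"
          unfolding P_def by simp_all
        obtain y where y: "y \<notin> ?W" "dist x y < e" using frontierD[OF x e(1)] by blast
        obtain e' where e': "e' > 0" "\<And>\<nu>. \<nu> \<noteq> y \<Longrightarrow> dist y \<nu> < e' \<Longrightarrow> ?n \<nu> = ?d \<nu>"
          using W_near[OF y(1)] by blast
        obtain z where "z \<noteq> x" "z \<noteq> y" "dist x z < e" "dist y z < e'"
          using nearby_avoiding[OF y(2) e'(1)] .
        then have "n = d" using e(2)[of z] e'(2)[of z] by auto
        then show False using e(3) frontier_mem[OF cW] x by blast
      qed
      show "\<exists>y. y \<notin> ?F \<and> dist x y < e" if "e > 0" for e using frontierD[OF x that] FW by blast
    qed
  qed
  \<comment> \<open>Fredholmness of z feeds the limit argument that puts x into \<open>?K\<close>,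
    and the Kato property of z shows that x is approached from outside \<open>?K\<close>.\<close>
  have near_F: "\<exists>z. dist x z < e \<and> fredholm_on UNIV (shifted T z) \<and> kato_on UNIV (shifted T z)"
    if x: "x \<in> frontier ?F" and e: "e > 0" for x e
  proof -
    obtain y where y: "y \<notin> ?F" "dist x y < e" using frontierD[OF x e] by blast
    obtain n d e' where "P y n d e'" using Phi_near[OF y(1)] by blast
    then have e': "e' > 0" "\<And>\<nu>. \<nu> \<noteq> y \<Longrightarrow> dist y \<nu> < e' \<Longrightarrow>
        ?n \<nu> = enat n \<and> ?d \<nu> = enat d \<and> kato_on UNIV (shifted T \<nu>)"
      unfolding P_def by simp_all
    obtain z where z: "z \<noteq> x" "z \<noteq> y" "dist x z < e" "dist y z < e'"
      using nearby_avoiding[OF y(2) e'(1)] .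
    then show ?thesis using e'(2)[OF z(2,4)] fredholm_on_iff[OF op, of z] by auto
  qed
  \<comment> \<open>Membership in \<open>?K\<close> itself is stated apart, since the comparison of
    hulls asks for it rather than for membership in the frontier.\<close>
  have FK': "frontier ?F \<subseteq> ?K"
  proof
    fix x assume x: "x \<in> frontier ?F"
    show "x \<in> ?K"
    proof (rule ccontr)
      assume "x \<notin> ?K"
      then have kt: "kato_type (shifted T x)" by (simp add: kato_type_spectrum_def)
      have "b_fredholm (shifted T x)"
      proof (rule kato_type_b_fredholm_limit[OF S kt])
        fix e :: real assume "e > 0"
        then obtain z where "dist x z < e" "fredholm_on UNIV (shifted T z)" using near_F[OF x] by blast
        then show "\<exists>\<mu>. cmod \<mu> < e \<and> fredholm_on UNIV (shifted (shifted T x) \<mu>)"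
          by (intro exI[of _ "z - x"]) (simp only: shift, simp add: dist_norm norm_minus_commute)
      qed
      then show False using frontier_mem[OF cF] x by (auto simp: b_fredholm_spectrum_def)
    qed
  qed
  have FK: "frontier ?F \<subseteq> frontier ?K"
  proof
    fix x assume x: "x \<in> frontier ?F"
    show "x \<in> frontier ?K"
    proof (rule frontierI)
      show "x \<in> ?K" using FK' x by blast
      show "\<exists>y. y \<notin> ?K \<and> dist x y < e" if "e > 0" for e using near_F[OF x that] katoI by blast
    qed
  qed
  have bD: "bounded ?D" by (rule bounded_drazin_spectrum[OF assms(2)])
  have "connected_hull ?W = connected_hull ?D"
    by (rule connected_hull_eq[OF bD WD]) (use DW frontier_mem[OF cW] in blast)
  moreover have "connected_hull ?F = connected_hull ?D"
    by (rule connected_hull_eq[OF bD]) (use FW WD DW WF frontier_mem[OF cF] in blast)+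
  moreover have "connected_hull ?K = connected_hull ?D"
    by (rule connected_hull_eq[OF bD KD]) (use DW WF FK' in blast)
  ultimately show ?thesis using DW WF FK by simp
qed

end
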